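(* Let $1<p<+\infty$, let $\Omega=(a,b)$ be a bounded open interval and let $w:\mathbb{R}\to\mathbb{R}$ satisfy $w\ge 0$ a.e. and $w\in L^1_{\rm loc}(\mathbb{R})$. Suppose that $w$ is finitely degenerate in $\Omega$ (i.e. $1\le N_w<+\infty$). Let $X=L^p(\Omega,(\hat w_p)^{p-1})$, and define $F:X\to[0,+\infty]$ by $$F(u)=\begin{cases}\displaystyle\int_a^b |u'|^p\,w\,dx & \text{if } u\in AC([a,b]),\\ +\infty & \text{if } u\in X\setminus AC([a,b]).\end{cases}$$ Let $\overline F$ be the lower semicontinuous envelope of $F$ with respect to the (strong) $L^p(\Omega,(\hat w_p)^{p-1})$-convergence, and let $D=\{u\in X:\overline F(u)<+\infty\}$. Then $$D={\rm Dom}_w,$$ and the following representation holds: $$\overline F(u)=\begin{cases}\displaystyle\int_{I_{\Omega,w}}|u'|^p\,w\,dx & \text{if } u\in {\rm Dom}_w,\\ +\infty & \text{if } u\in L^p(\Omega,(\hat w_p)^{p-1})\setminus{\rm Dom}_w.\end{cases}$$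
   Context: Conventions: $w^{-1/(p-1)}=+\infty$ where $w=0$. Functions are real valued and measurable. The set $I_{\Omega,w}$: $$I_{\Omega,w}=\{x\in\Omega:\ \exists\,\epsilon>0 \text{ such that } w^{-\frac1{p-1}}\in L^1((x-\epsilon,x+\epsilon))\}.$$ It is open, and it is written as the disjoint union of its connected components, $I_{\Omega,w}=\bigcup_{i=1}^{N_w}(a_i,b_i)$, where $N_w\in\{0,1,2,\dots\}\cup\{\infty\}$ is the number of components ($N_w=0$ if $I_{\Omega,w}=\emptyset$). The weight $w$ is called finitely degenerate in $\Omega$ if $1\le N_w<+\infty$. The set ${\rm Dom}_w$: $${\rm Dom}_w=\Big\{u:\Omega\to\mathbb{R}:\ u\in W^{1,1}_{\rm loc}(I_{\Omega,w}),\ \int_{I_{\Omega,w}}|u'|^p\,w\,dx<+\infty\Big\}.$$ The auxiliary weight $\hat w_p:\Omega\to[0,+\infty)$: $\hat w_p=0$ on $\Omega\setminus I_{\Omega,w}$, and on each component $(a_i,b_i)$ $$\hat w_p(x)=\begin{cases}\left(\int_x^{\frac{a_i+b_i}2}w^{-\frac1{p-1}}(y)\,dy\right)^{-1}& a_i<x<\frac{3a_i+b_i}4,\\[4pt] \left(\int_{\frac{3a_i+b_i}4}^{\frac{a_i+3b_i}4}w^{-\frac1{p-1}}(y)\,dy\right)^{-1}& \frac{3a_i+b_i}4\le x\le\frac{a_i+3b_i}4,\\[4pt] \left(\int_{\frac{a_i+b_i}2}^{x}w^{-\frac1{p-1}}(y)\,dy\right)^{-1}& \frac{a_i+3b_i}4<x<b_i.\end{cases}$$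 The space $L^p(\Omega,(\hat w_p)^{p-1})$ consists of the measurable $u:\Omega\to\mathbb{R}$ with $\int_\Omega|u|^p(\hat w_p)^{p-1}dx<+\infty$, with the topology induced by the seminorm $\big(\int_\Omega|u|^p(\hat w_p)^{p-1}dx\big)^{1/p}$; since $\hat w_p$ may vanish on $\Omega\setminus I_{\Omega,w}$, its elements are regarded here as functions on $\Omega$ (up to Lebesgue-null sets), so that $F$ is well defined. $AC([a,b])$ is the set of absolutely continuous functions on $[a,b]$. The lower semicontinuous envelope of $F$ is the largest functional on $X$ that is lower semicontinuous for this topology and is $\le F$. *)

theory Defs
  imports "HOL-Analysis.Analysis"
begin

text \<open>
  A real function on a set \<open>S\<close> of reals is represented by a total function of type
  \<open>real \<Rightarrow> real\<close>; every notion below depends only on its values on \<open>S\<close>. Measurable means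
  Lebesgue measurable.
\<close>

section \<open>Local Sobolev functions and absolutely continuous functions\<close>

definition locally_integrable_on :: "(real \<Rightarrow> real) \<Rightarrow> real set \<Rightarrow> bool"  (infix "locally'_integrable'_on" 46)
  where "f locally_integrable_on U \<longleftrightarrow>
    f \<in> borel_measurable (lebesgue_on U) \<and>
    (\<forall>K. compact K \<and> K \<subseteq> U \<longrightarrow> f absolutely_integrable_on K)"

definition test_function :: "real set \<Rightarrow> (real \<Rightarrow> real) \<Rightarrow> bool"
  where "test_function U \<phi> \<longleftrightarrow>
    (\<forall>n x. (deriv ^^ n) \<phi> differentiable (at x)) \<and>
    compact (closure {x. \<phi> x \<noteq> 0}) \<and> closure {x. \<phi> x \<noteq> 0} \<subseteq> U"

definition has_weak_derivative :: "real set \<Rightarrow> (real \<Rightarrow> real) \<Rightarrow> (real \<Rightarrow> real) \<Rightarrow> bool"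
  where "has_weak_derivative U u g \<longleftrightarrow>
    u locally_integrable_on U \<and> g locally_integrable_on U \<and>
    (\<forall>\<phi>. test_function U \<phi> \<longrightarrow>
      (LINT x:U|lebesgue. u x * deriv \<phi> x) = - (LINT x:U|lebesgue. g x * \<phi> x))"

definition W11_loc :: "real set \<Rightarrow> (real \<Rightarrow> real) set"
  where "W11_loc U = {u. \<exists>g. has_weak_derivative U u g}"

text \<open>The weak derivative is unique up to null sets, so the choice does not affect integrals.\<close>

definition weak_deriv :: "real set \<Rightarrow> (real \<Rightarrow> real) \<Rightarrow> real \<Rightarrow> real"
  where "weak_deriv U u = (SOME g. has_weak_derivative U u g)"

definition AC :: "real \<Rightarrow> real \<Rightarrow> (real \<Rightarrow> real) set"
  where "AC a b = {v. \<forall>\<epsilon>>0. \<exists>\<delta>>0. \<forall>D :: (real \<times> real) set.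
    finite D \<and> (\<forall>(s, t)\<in>D. a \<le> s \<and> s < t \<and> t \<le> b) \<and>
    disjoint_family_on (\<lambda>(s, t). {s<..<t}) D \<and> (\<Sum>(s, t)\<in>D. t - s) < \<delta>
    \<longrightarrow> (\<Sum>(s, t)\<in>D. \<bar>v t - v s\<bar>) < \<epsilon>}"

section \<open>Degenerate weights\<close>

text \<open>
  The power \<open>w powr (- 1 / (p - 1))\<close> with value \<open>\<infinity>\<close> where \<open>w = 0\<close>. The value \<open>\<infinity>\<close> is
  also used where \<open>w < 0\<close>, which is a null set for the weights considered.
\<close>

definition inv_weight :: "real \<Rightarrow> (real \<Rightarrow> real) \<Rightarrow> real \<Rightarrow> ennreal"
  where "inv_weight p w x = (if w x > 0 then ennreal (w x powr (- 1 / (p - 1))) else \<infinity>)"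

definition I_set :: "real \<Rightarrow> real set \<Rightarrow> (real \<Rightarrow> real) \<Rightarrow> real set"
  where "I_set p \<Omega> w =
    {x \<in> \<Omega>. \<exists>\<epsilon>>0. (\<integral>\<^sup>+ y \<in> {x - \<epsilon><..<x + \<epsilon>}. inv_weight p w y \<partial>lebesgue) < \<infinity>}"

definition finitely_degenerate :: "real \<Rightarrow> real set \<Rightarrow> (real \<Rightarrow> real) \<Rightarrow> bool"
  where "finitely_degenerate p \<Omega> w \<longleftrightarrow>
    finite (components (I_set p \<Omega> w)) \<and> 1 \<le> card (components (I_set p \<Omega> w))"

text \<open>
  \<open>\<Omega>\<close> is a bounded open interval below, so that the component of a point of \<open>I_set p \<Omega> w\<close> is the
  interval between its infimum and its supremum.
\<close>

lemma I_set_open: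
  assumes "open \<Omega>" shows "open (I_set p \<Omega> w)"
  unfolding open_dist
proof
  fix x assume "x \<in> I_set p \<Omega> w"
  then obtain e where x: "x \<in> \<Omega>" "e > 0"
    and fin: "(\<integral>\<^sup>+ y \<in> {x - e<..<x + e}. inv_weight p w y \<partial>lebesgue) < \<infinity>"
    by (auto simp: I_set_def)
  obtain d where d: "d > 0" "\<And>y. dist y x < d \<Longrightarrow> y \<in> \<Omega>"
    using assms x(1) by (auto simp: open_dist)
  show "\<exists>r>0. \<forall>y. dist y x < r \<longrightarrow> y \<in> I_set p \<Omega> w"
  proof (intro exI[of _ "min d (e/2)"] conjI allI impI)
    show "0 < min d (e/2)" using d x by simp
    fix y assume y: "dist y x < min d (e/2)"
    have "(\<integral>\<^sup>+ z \<in> {y - e/2<..<y + e/2}. inv_weight p w z \<partial>lebesgue)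
        \<le> (\<integral>\<^sup>+ z \<in> {x - e<..<x + e}. inv_weight p w z \<partial>lebesgue)"
      using y by (intro nn_integral_mono mult_left_mono)
        (auto simp: indicator_def dist_real_def abs_if split: if_splits)
    with fin have "(\<integral>\<^sup>+ z \<in> {y - e/2<..<y + e/2}. inv_weight p w z \<partial>lebesgue) < \<infinity>"
      by (rule order.strict_trans1[rotated])
    then show "y \<in> I_set p \<Omega> w"
      using d y x(2) by (auto simp: I_set_def intro!: exI[of _ "e/2"])
  qed
qed

lemma bounded_open_component_eq_interval:
  fixes U C :: "real set"
  assumes "open U" "bounded U" "C \<in> components U"
  shows "C = {Inf C<..<Sup C}"
proof -
  have C: "open C" "connected C" "C \<noteq> {}" "bounded C"
    using assms open_components in_components_connected in_components_nonempty
      in_components_subset bounded_subset by metis+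
  have bdd: "bdd_above C" "bdd_below C"
    using C(4) by (auto simp: bounded_imp_bdd_above bounded_imp_bdd_below)
  have lu: "Inf C < x \<and> x < Sup C" if x: "x \<in> C" for x
  proof -
    obtain e where e: "e > 0" "cball x e \<subseteq> C" using C(1) x open_contains_cball by blast
    then have "x - e \<in> C" "x + e \<in> C" by (auto simp: cball_def dist_real_def subset_iff)
    with bdd have "Inf C \<le> x - e" "x + e \<le> Sup C" by (auto intro: cInf_lower cSup_upper)
    with e(1) show ?thesis by linarith
  qed
  have "x \<in> C" if "Inf C < x" "x < Sup C" for x
  proof -
    obtain y z where "y \<in> C" "y < x" "z \<in> C" "x < z"
      using \<open>Inf C < x\<close> \<open>x < Sup C\<close> bdd C(3) by (auto simp: cInf_less_iff less_cSup_iff)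
    then show ?thesis
      using C(2) unfolding connected_iff_interval by (meson less_imp_le)
  qed
  with lu show ?thesis by (auto simp only: greaterThanLessThan_iff)
qed

definition hat_weight :: "real \<Rightarrow> real set \<Rightarrow> (real \<Rightarrow> real) \<Rightarrow> real \<Rightarrow> real"
  where "hat_weight p \<Omega> w x =
    (if x \<in> I_set p \<Omega> w then
       let C = connected_component_set (I_set p \<Omega> w) x; \<alpha> = Inf C; \<beta> = Sup C;
           J = (\<lambda>s t. enn2real (\<integral>\<^sup>+ y \<in> {s..t}. inv_weight p w y \<partial>lebesgue))
       in if x < (3 * \<alpha> + \<beta>) / 4 then inverse (J x ((\<alpha> + \<beta>) / 2))
          else if x \<le> (\<alpha> + 3 * \<beta>) / 4 then inverse (J ((3 * \<alpha> + \<beta>) / 4) ((\<alpha> + 3 * \<beta>) / 4))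
          else inverse (J ((\<alpha> + \<beta>) / 2) x)
     else 0)"

definition Dom_energy :: "real \<Rightarrow> real set \<Rightarrow> (real \<Rightarrow> real) \<Rightarrow> (real \<Rightarrow> real) \<Rightarrow> ennreal"
  where "Dom_energy p \<Omega> w u =
    (\<integral>\<^sup>+ x \<in> I_set p \<Omega> w. ennreal (\<bar>weak_deriv (I_set p \<Omega> w) u x\<bar> powr p * w x) \<partial>lebesgue)"

definition Dom :: "real \<Rightarrow> real set \<Rightarrow> (real \<Rightarrow> real) \<Rightarrow> (real \<Rightarrow> real) set"
  where "Dom p \<Omega> w =
    {u \<in> borel_measurable (lebesgue_on \<Omega>). u \<in> W11_loc (I_set p \<Omega> w) \<and> Dom_energy p \<Omega> w u < \<infinity>}"

section \<open>The weighted Lebesgue space and its seminorm topology\<close>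

definition Lp_hat_integral :: "real \<Rightarrow> real set \<Rightarrow> (real \<Rightarrow> real) \<Rightarrow> (real \<Rightarrow> real) \<Rightarrow> ennreal"
  where "Lp_hat_integral p \<Omega> w u =
    (\<integral>\<^sup>+ x \<in> \<Omega>. ennreal (\<bar>u x\<bar> powr p * hat_weight p \<Omega> w x powr (p - 1)) \<partial>lebesgue)"

definition Lp_hat :: "real \<Rightarrow> real set \<Rightarrow> (real \<Rightarrow> real) \<Rightarrow> (real \<Rightarrow> real) set"
  where "Lp_hat p \<Omega> w =
    {u \<in> borel_measurable (lebesgue_on \<Omega>). Lp_hat_integral p \<Omega> w u < \<infinity>}"

definition Lp_hat_seminorm :: "real \<Rightarrow> real set \<Rightarrow> (real \<Rightarrow> real) \<Rightarrow> (real \<Rightarrow> real) \<Rightarrow> real"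
  where "Lp_hat_seminorm p \<Omega> w u = enn2real (Lp_hat_integral p \<Omega> w u) powr (1 / p)"

definition Lp_hat_topology :: "real \<Rightarrow> real set \<Rightarrow> (real \<Rightarrow> real) \<Rightarrow> (real \<Rightarrow> real) topology"
  where "Lp_hat_topology p \<Omega> w = topology (\<lambda>U. U \<subseteq> Lp_hat p \<Omega> w \<and>
    (\<forall>u\<in>U. \<exists>e>0. \<forall>v\<in>Lp_hat p \<Omega> w. Lp_hat_seminorm p \<Omega> w (\<lambda>x. v x - u x) < e \<longrightarrow> v \<in> U))"

lemma openin_Lp_hat_topology:
  "openin (Lp_hat_topology p \<Omega> w) U \<longleftrightarrow> U \<subseteq> Lp_hat p \<Omega> w \<and>
    (\<forall>u\<in>U. \<exists>e>0. \<forall>v\<in>Lp_hat p \<Omega> w. Lp_hat_seminorm p \<Omega> w (\<lambda>x. v x - u x) < e \<longrightarrow> v \<in> U)"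
proof -
  let ?X = "Lp_hat p \<Omega> w" and ?d = "\<lambda>v u. Lp_hat_seminorm p \<Omega> w (\<lambda>x. v x - u x)"
  let ?L = "\<lambda>U. U \<subseteq> ?X \<and> (\<forall>u\<in>U. \<exists>e>0. \<forall>v\<in>?X. ?d v u < e \<longrightarrow> v \<in> U)"
  have "istopology ?L"
    unfolding istopology_def
  proof (intro conjI allI impI)
    fix S T assume S: "?L S" and T: "?L T"
    show "S \<inter> T \<subseteq> ?X" using S by blast
    show "\<forall>u\<in>S \<inter> T. \<exists>e>0. \<forall>v\<in>?X. ?d v u < e \<longrightarrow> v \<in> S \<inter> T"
    proof
      fix u assume "u \<in> S \<inter> T"
      then obtain e1 e2 where "e1 > 0" "\<forall>v\<in>?X. ?d v u < e1 \<longrightarrow> v \<in> S"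
        "e2 > 0" "\<forall>v\<in>?X. ?d v u < e2 \<longrightarrow> v \<in> T"
        using S T by blast
      then show "\<exists>e>0. \<forall>v\<in>?X. ?d v u < e \<longrightarrow> v \<in> S \<inter> T"
        by (intro exI[of _ "min e1 e2"]) auto
    qed
  next
    fix \<K> assume K: "\<forall>S\<in>\<K>. ?L S"
    show "\<Union>\<K> \<subseteq> ?X" using K by blast
    show "\<forall>u\<in>\<Union>\<K>. \<exists>e>0. \<forall>v\<in>?X. ?d v u < e \<longrightarrow> v \<in> \<Union>\<K>"
    proof
      fix u assume "u \<in> \<Union>\<K>"
      then obtain S where S: "S \<in> \<K>" "u \<in> S" by blast
      with K obtain e where "e > 0" "\<forall>v\<in>?X. ?d v u < e \<longrightarrow> v \<in> S" by blast
      with S show "\<exists>e>0. \<forall>v\<in>?X. ?d v u < e \<longrightarrow> v \<in> \<Union>\<K>" by blast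
    qed
  qed
  then show ?thesis
    unfolding Lp_hat_topology_def by (simp add: topology_inverse')
qed

lemma topspace_Lp_hat_topology [simp]: "topspace (Lp_hat_topology p \<Omega> w) = Lp_hat p \<Omega> w"
proof -
  have "openin (Lp_hat_topology p \<Omega> w) (Lp_hat p \<Omega> w)"
    by (auto simp: openin_Lp_hat_topology intro: exI[of _ 1])
  then show ?thesis
    by (metis openin_Lp_hat_topology openin_subset openin_topspace subset_antisym)
qed

section \<open>Lower semicontinuous envelopes\<close>

definition lsc_map :: "'a topology \<Rightarrow> ('a \<Rightarrow> ennreal) \<Rightarrow> bool"
  where "lsc_map T G \<longleftrightarrow> (\<forall>c. openin T {u \<in> topspace T. c < G u})"

definition lsc_envelope :: "'a topology \<Rightarrow> ('a \<Rightarrow> ennreal) \<Rightarrow> 'a \<Rightarrow> ennreal"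
  where "lsc_envelope T F u =
    (SUP G \<in> {G. lsc_map T G \<and> (\<forall>v\<in>topspace T. G v \<le> F v)}. G u)"

text \<open>The supremum is attained: the envelope is the largest lower semicontinuous minorant.\<close>

lemma lsc_envelope_largest:
  shows "lsc_map T (lsc_envelope T F)"
    and "u \<in> topspace T \<Longrightarrow> lsc_envelope T F u \<le> F u"
    and "lsc_map T G \<Longrightarrow> (\<And>v. v \<in> topspace T \<Longrightarrow> G v \<le> F v) \<Longrightarrow> G u \<le> lsc_envelope T F u"
proof -
  let ?M = "{G. lsc_map T G \<and> (\<forall>v\<in>topspace T. G v \<le> F v)}"
  show "lsc_map T (lsc_envelope T F)"
    unfolding lsc_map_def
  proof
    fix c
    have "{u \<in> topspace T. c < lsc_envelope T F u} = (\<Union>G\<in>?M. {u \<in> topspace T. c < G u})"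
      by (auto simp: lsc_envelope_def less_SUP_iff)
    moreover have "openin T (\<Union>G\<in>?M. {u \<in> topspace T. c < G u})"
      by (rule openin_Union) (auto simp: lsc_map_def)
    ultimately show "openin T {u \<in> topspace T. c < lsc_envelope T F u}" by simp
  qed
  show "u \<in> topspace T \<Longrightarrow> lsc_envelope T F u \<le> F u"
    by (auto simp: lsc_envelope_def intro: SUP_least)
  show "lsc_map T G \<Longrightarrow> (\<And>v. v \<in> topspace T \<Longrightarrow> G v \<le> F v) \<Longrightarrow> G u \<le> lsc_envelope T F u"
    by (auto simp: lsc_envelope_def intro: SUP_upper)
qed

section \<open>The functional\<close>

text \<open>
  Elements of the weighted Lebesgue space are functions up to Lebesgue-null subsets of \<open>\<Omega>\<close>, so
  membership in \<open>AC([a,b])\<close> means that there is an absolutely continuous representative. It is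
  unique on \<open>[a,b]\<close>, and it is differentiable almost everywhere.
\<close>

definition AC_rep :: "real \<Rightarrow> real \<Rightarrow> (real \<Rightarrow> real) \<Rightarrow> (real \<Rightarrow> real) \<Rightarrow> bool"
  where "AC_rep a b u v \<longleftrightarrow>
    v \<in> AC a b \<and> (AE x in lebesgue. x \<in> {a<..<b} \<longrightarrow> v x = u x)"

definition F_functional :: "real \<Rightarrow> (real \<Rightarrow> real) \<Rightarrow> real \<Rightarrow> real \<Rightarrow> (real \<Rightarrow> real) \<Rightarrow> ennreal"
  where "F_functional p w a b u =
    (if \<exists>v. AC_rep a b u v
     then \<integral>\<^sup>+ x \<in> {a<..<b}. ennreal (\<bar>deriv (SOME v. AC_rep a b u v) x\<bar> powr p * w x) \<partial>lebesgue
     else \<infinity>)"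

definition F_relaxed :: "real \<Rightarrow> (real \<Rightarrow> real) \<Rightarrow> real \<Rightarrow> real \<Rightarrow> (real \<Rightarrow> real) \<Rightarrow> ennreal"
  where "F_relaxed p w a b =
    lsc_envelope (Lp_hat_topology p {a<..<b} w) (F_functional p w a b)"

end

theory Submission
  imports Defs
begin

text \<open>
  Partition sums carry the argument: with \<open>\<sigma> = w powr (- 1 / (p - 1))\<close>, Hoelder's inequality gives
  \<open>\<Sum> \<bar>u(t\<^sub>i) - u(s\<^sub>i)\<bar>\<^sup>p / (\<integral> \<sigma> over (s\<^sub>i,t\<^sub>i))\<^sup>p\<^sup>-\<^sup>1 \<le> \<integral> \<bar>u'\<bar>\<^sup>p w\<close> for all finite families of
  disjoint intervals in the regular set. These sums pass to almost everywhere limits, and conversely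
  (F. Riesz) a bound on all of them makes \<open>u\<close> locally absolutely continuous and, by Fatou's lemma along
  dyadic partitions and Lebesgue differentiation, bounds the energy. So the energy is lower
  semicontinuous without any weak compactness, which gives the lower bound for the relaxation.

  For the upper bound, \<open>u\<close> is frozen near the endpoints of each of the finitely many components, and the
  frozen values are joined across the endpoints. Since \<open>\<sigma>\<close> is not integrable near an interior point
  outside the regular set, a transition whose derivative is proportional to a truncation of \<open>\<sigma>\<close> costs
  arbitrarily little energy. The weight \<open>hat_weight\<close> is the one for which Hoelder's inequality bounds the
  error made by freezing.
\<close>

section \<open>Lebesgue differentiation on the line\<close>

text \<open>The seminorm of \<open>X\<close> ignores values off the regular set, so nothing in it
  ties together limits on different components, and jumps at their endpoints must become free. The
  obstacle: \<open>inv_weight\<close> fails to be integrable only on two-sided neighbourhoods of an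
  endpoint, so a cheap transition may intrude into the component. The energies then add without
  mixed terms, and the energy of \<open>u\<close> keeps the constant 1. The order of choices
  matters: frozen values may blow up as \<open>\<delta>\<close> tends to 0, so
  \<open>\<epsilon>\<close> and the transition energy are fixed after them. At \<open>a\<close> and
  \<open>b\<close> no transition is made, since absolute continuity imposes no boundary values.
  Hoelder's inequality enters in linearised form, as the tangent line of y^p W; with its slope
  optimised it bounds increments by energy, with a large slope it turns a bound on partition sums
  into absolute continuity.\<close>

lemma lebesgue_differentiation_bad_set_negligible:
  fixes f :: "real \<Rightarrow> real"
  assumes f: "f integrable_on {a..b}" and "0 < \<epsilon>"
  shows "negligible {x. \<forall>\<delta>>0. \<exists>s t. a \<le> s \<and> s \<le> x \<and> x \<le> t \<and> t \<le> b \<and> s < t \<and> t - s < \<delta>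
           \<and> \<epsilon> * (t - s) < \<bar>(t - s) * f x - integral {s..t} f\<bar>}" (is "negligible ?B")
  unfolding negligible_outer_le
proof (intro allI impI)
  fix e :: real assume "0 < e"
  \<comment> \<open>The 5 is the constant of Vitali's covering lemma: disjoint bad intervals of
    total length at most \<eta> / \<epsilon> have fivefold enlargements of measure at most
    \<open>e\<close>.\<close>
  define \<eta> where "\<eta> = e * \<epsilon> / 5"
  have "\<eta> > 0" using \<open>0 < e\<close> \<open>0 < \<epsilon>\<close> by (simp add: \<eta>_def)
  have "f integrable_on cbox a b" using f by simp
  from Henstock_lemma[OF this \<open>\<eta> > 0\<close>] obtain \<gamma> where \<gamma>: "gauge \<gamma>"
    and H: "\<And>q. q tagged_partial_division_of (cbox a b) \<Longrightarrow> \<gamma> fine q \<Longrightarrow>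
             (\<Sum>(x,k)\<in>q. norm (measure lborel k *\<^sub>R f x - integral k f)) < \<eta>" by blast
  \<comment> \<open>Bad intervals that are fine for the gauge, tagged by the bad point. By the
    Henstock lemma the defects of a finite disjoint subfamily sum to less than \<eta>, while each
    defect exceeds \<epsilon> times the length of its interval.\<close>
  define K where "K = {(x,s,t). a \<le> s \<and> s \<le> x \<and> x \<le> t \<and> t \<le> b \<and> s < t \<and> t - s < 1
      \<and> {s..t} \<subseteq> \<gamma> x \<and> \<epsilon> * (t - s) < \<bar>(t - s) * f x - integral {s..t} f\<bar>}"
  define c r where "c = (\<lambda>(x::real,s,t). (s+t)/(2::real))" and "r = (\<lambda>(x::real,s,t). (t-s)/(2::real))"
  have cb: "cball (c i) (r i) = {fst (snd i)..snd (snd i)}" for i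
    by (cases i) (auto simp: c_def r_def cball_eq_atLeastAtMost field_simps)
  have "?B \<subseteq> (\<Union>i\<in>K. cball (c i) (r i))"
  proof
    fix x assume x: "x \<in> ?B"
    obtain d where d: "d > 0" "ball x d \<subseteq> \<gamma> x"
      using \<gamma> unfolding gauge_def by (meson openE)
    obtain s t where st: "a \<le> s" "s \<le> x" "x \<le> t" "t \<le> b" "s < t" "t - s < min 1 d"
      "\<epsilon> * (t - s) < \<bar>(t - s) * f x - integral {s..t} f\<bar>"
      using x d(1) by (auto dest!: spec[of _ "min 1 d"])
    have "{s..t} \<subseteq> ball x d" using st by (auto simp: dist_real_def abs_if)
    then have "(x,s,t) \<in> K" using st d by (auto simp: K_def)
    moreover have "x \<in> cball (c (x,s,t)) (r (x,s,t))" unfolding cb using st by auto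
    ultimately show "x \<in> (\<Union>i\<in>K. cball (c i) (r i))" by blast
  qed
  moreover have "0 < r i \<and> r i \<le> 1" if "i \<in> K" for i using that by (auto simp: K_def r_def)
  ultimately obtain C where C: "countable C" "C \<subseteq> K"
     "pairwise (\<lambda>i j. disjnt (cball (c i) (r i)) (cball (c j) (r j))) C"
     "?B \<subseteq> (\<Union>i\<in>C. cball (c i) (5 * r i))"
    by (rule Vitali_covering_lemma_cballs)
  have bound: "measure lebesgue (\<Union>i\<in>J. cball (c i) (5 * r i)) \<le> e" if J: "finite J" "J \<subseteq> C" for J
  proof -
    have inj: "inj_on (\<lambda>(x,s,t). (x,{s..t})) J"
    proof (rule inj_onI)
      fix i j assume ij: "i \<in> J" "j \<in> J" "(case i of (x,s,t) \<Rightarrow> (x,{s..t})) = (case j of (x,s,t) \<Rightarrow> (x,{s..t}))"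
      obtain x s t y u v where [simp]: "i = (x,s,t)" "j = (y,u,v)" by (metis prod_cases3)
      have "i \<in> K" "j \<in> K" using ij J C(2) by blast+
      then have "s \<le> t" "u \<le> v" by (simp_all add: K_def)
      with ij(3) show "i = j" by (simp add: Icc_eq_Icc)
    qed
    have "(\<lambda>(x,s,t). (x,{s..t})) ` J tagged_partial_division_of (cbox a b)"
      unfolding tagged_partial_division_of_def
    proof (intro conjI allI impI)
      show "finite ((\<lambda>(x,s,t). (x,{s..t})) ` J)" using J by simp
    next
      fix x k assume "(x,k) \<in> (\<lambda>(x,s,t). (x,{s..t})) ` J"
      then show "x \<in> k" "k \<subseteq> cbox a b" "\<exists>a b. k = cbox a b"
        using J C(2) by (auto simp: K_def)
    next
      fix x1 k1 x2 k2
      assume A: "(x1,k1) \<in> (\<lambda>(x,s,t). (x,{s..t})) ` J \<and> (x2,k2) \<in> (\<lambda>(x,s,t). (x,{s..t})) ` J \<and> (x1,k1) \<noteq> (x2,k2)"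
      then obtain s1 t1 s2 t2 where "(x1,s1,t1) \<in> J" "(x2,s2,t2) \<in> J" and k: "k1 = {s1..t1}" "k2 = {s2..t2}"
        by auto
      moreover have "(x1,s1,t1) \<noteq> (x2,s2,t2)" using A k by auto
      ultimately have "disjnt (cball (c (x1,s1,t1)) (r (x1,s1,t1))) (cball (c (x2,s2,t2)) (r (x2,s2,t2)))"
        using pairwiseD[OF C(3)] J(2) by (meson subsetD)
      then have "k1 \<inter> k2 = {}" by (simp add: cb k disjnt_def)
      then show "interior k1 \<inter> interior k2 = {}"
        by (metis interior_Int interior_empty)
    qed
    moreover have "\<gamma> fine (\<lambda>(x,s,t). (x,{s..t})) ` J"
      using J C(2) by (auto simp: fine_def K_def)
    ultimately have "(\<Sum>(x,k)\<in>(\<lambda>(x,s,t). (x,{s..t})) ` J. norm (measure lborel k *\<^sub>R f x - integral k f)) < \<eta>"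
      by (rule H)
    then have "(\<Sum>(x,s,t)\<in>J. \<bar>measure lborel {s..t} * f x - integral {s..t} f\<bar>) < \<eta>"
      by (subst (asm) sum.reindex[OF inj]) (auto simp: case_prod_beta o_def)
    moreover have "(\<Sum>(x,s,t)\<in>J. \<epsilon> * (t - s)) \<le> (\<Sum>(x,s,t)\<in>J. \<bar>measure lborel {s..t} * f x - integral {s..t} f\<bar>)"
      using J C(2) by (intro sum_mono) (auto simp: K_def)
    moreover have "(\<Sum>(x,s,t)\<in>J. \<epsilon> * (t - s)) = \<epsilon> * (\<Sum>i\<in>J. 2 * r i)"
      unfolding sum_distrib_left by (intro sum.cong refl) (auto simp: r_def)
    ultimately have *: "\<epsilon> * (\<Sum>i\<in>J. 2 * r i) < \<eta>" by linarith
    have "measure lebesgue (\<Union>i\<in>J. cball (c i) (5 * r i)) \<le> (\<Sum>i\<in>J. measure lebesgue (cball (c i) (5 * r i)))"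
      using J by (intro measure_UNION_le) auto
    also have "\<dots> = (\<Sum>i\<in>J. 5 * (2 * r i))"
      using J C(2) by (intro sum.cong refl) (auto simp: cball_eq_atLeastAtMost K_def r_def)
    also have "\<dots> = 5 * (\<Sum>i\<in>J. 2 * r i)" by (simp add: sum_distrib_left)
    also have "\<dots> \<le> e" using * \<open>0 < \<epsilon>\<close> by (simp add: \<eta>_def field_simps)
    finally show ?thesis .
  qed
  have "(\<Union>i\<in>C. cball (c i) (5 * r i)) \<in> lmeasurable"
    by (rule fmeasurable_UN_bound[OF C(1) _ bound]) auto
  moreover have "measure lebesgue (\<Union>i\<in>C. cball (c i) (5 * r i)) \<le> e"
    by (rule measure_UN_bound[OF C(1) _ bound]) auto
  ultimately show "\<exists>T. ?B \<subseteq> T \<and> T \<in> lmeasurable \<and> measure lebesgue T \<le> e"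
    using C(4) by blast
qed

text \<open>A point outside the bad sets for all \<epsilon> = 1/(n+1) is an endpoint of the interval
  between itself and \<open>y\<close>, and the estimate on that interval is the estimate of the
  difference quotient.\<close>

theorem lebesgue_differentiation:
  fixes f :: "real \<Rightarrow> real"
  assumes f: "f integrable_on {a..b}"
  obtains N where "negligible N"
    "\<forall>x\<in>{a<..<b} - N. ((\<lambda>y. integral {a..y} f) has_real_derivative f x) (at x)"
proof
  define B where "B \<epsilon> = {x. \<forall>\<delta>>0. \<exists>s t. a \<le> s \<and> s \<le> x \<and> x \<le> t \<and> t \<le> b \<and> s < t \<and> t - s < \<delta>
           \<and> \<epsilon> * (t - s) < \<bar>(t - s) * f x - integral {s..t} f\<bar>}" for \<epsilon>
  show "negligible (\<Union>n. B (1 / real (Suc n)))"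
  proof (rule negligible_countable_Union)
    have "negligible (B \<epsilon>)" if "0 < \<epsilon>" for \<epsilon>
      unfolding B_def by (rule lebesgue_differentiation_bad_set_negligible[OF f that])
    then show "negligible X" if "X \<in> range (\<lambda>n. B (1 / real (Suc n)))" for X
      using that by auto
  qed simp
  show "\<forall>x\<in>{a<..<b} - (\<Union>n. B (1 / real (Suc n))). ((\<lambda>y. integral {a..y} f) has_real_derivative f x) (at x)"
  proof
    fix x assume x: "x \<in> {a<..<b} - (\<Union>n. B (1 / real (Suc n)))"
    show "((\<lambda>y. integral {a..y} f) has_real_derivative f x) (at x)"
      unfolding has_field_derivative_def has_derivative_at'
    proof (intro conjI allI impI)
      show "bounded_linear ((*) (f x))" by (rule bounded_linear_mult_right)
      fix e :: real assume "0 < e"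
      then obtain n where n: "1 / real (Suc n) < e" by (metis nat_approx_posE)
      have "x \<notin> B (1 / real (Suc n))" using x by blast
      then obtain \<delta> where \<delta>: "\<delta> > 0" and no: "\<not> (\<exists>s t. a \<le> s \<and> s \<le> x \<and> x \<le> t \<and> t \<le> b
          \<and> s < t \<and> t - s < \<delta> \<and> 1 / real (Suc n) * (t - s) < \<bar>(t - s) * f x - integral {s..t} f\<bar>)"
        unfolding B_def mem_Collect_eq by blast
      have *: "\<bar>(t - s) * f x - integral {s..t} f\<bar> \<le> 1 / real (Suc n) * (t - s)"
        if "a \<le> s" "s \<le> x" "x \<le> t" "t \<le> b" "s < t" "t - s < \<delta>" for s t
        using no that not_less by blast
      define d where "d = min \<delta> (min (x - a) (b - x))"
      have "d > 0" using \<delta> x by (auto simp: d_def)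
      moreover have "norm (integral {a..y} f - integral {a..x} f - f x * (y - x)) / norm (y - x) < e"
        if y: "0 < norm (y - x) \<and> norm (y - x) < d" for y
      proof -
        have yb: "a \<le> y" "y \<le> b" using y x by (auto simp: d_def)
        have split: "integral {a..u} f + integral {u..v} f = integral {a..v} f" if "a \<le> u" "u \<le> v" "v \<le> b" for u v
          using that by (intro Henstock_Kurzweil_Integration.integral_combine)
            (auto intro: integrable_on_subinterval[OF f])
        have "\<bar>integral {a..y} f - integral {a..x} f - f x * (y - x)\<bar> \<le> 1 / real (Suc n) * \<bar>y - x\<bar>"
        proof (cases "x < y")
          case True
          then show ?thesis using *[of x y] split[of x y] y yb x by (simp add: d_def algebra_simps abs_minus_commute)
        next
          case False
          then show ?thesis using *[of y x] split[of y x] y yb x by (simp add: d_def algebra_simps abs_minus_commute)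
        qed
        also have "\<dots> < e * \<bar>y - x\<bar>" using n y by (intro mult_strict_right_mono) auto
        finally show ?thesis using y by (simp add: divide_simps)
      qed
      ultimately show "\<exists>d>0. \<forall>y. 0 < norm (y - x) \<and> norm (y - x) < d \<longrightarrow>
        norm (integral {a..y} f - integral {a..x} f - f x * (y - x)) / norm (y - x) < e" by blast
    qed
  qed
qed

text \<open>Because \<open>x\<close> lies in every interval, the two endpoint errors e/2 (t - x) and
  e/2 (x - s) add up to e/2 (t - s), however unevenly \<open>x\<close> divides the interval.\<close>

lemma straddled_difference_quotient:
  fixes f :: "real \<Rightarrow> real"
  assumes f: "(f has_real_derivative D) (at x)"
    and st: "\<And>n. s n \<le> x" "\<And>n. x \<le> t n" "\<And>n. s n < t n" "s \<longlonglongrightarrow> x" "t \<longlonglongrightarrow> x"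
  shows "(\<lambda>n. (f (t n) - f (s n)) / (t n - s n)) \<longlonglongrightarrow> D"
proof (rule LIMSEQ_I)
  fix e :: real assume "0 < e"
  then have e2: "e / 2 > 0" by simp
  obtain d where d: "d > 0" and D: "\<And>y. norm (y - x) < d \<Longrightarrow> norm (f y - f x - D * (y - x)) \<le> e / 2 * norm (y - x)"
    using f[unfolded has_field_derivative_def has_derivative_at_alt] e2 by blast
  obtain n1 where n1: "\<And>n. n \<ge> n1 \<Longrightarrow> norm (s n - x) < d" using LIMSEQ_D[OF st(4) d] by blast
  obtain n2 where n2: "\<And>n. n \<ge> n2 \<Longrightarrow> norm (t n - x) < d" using LIMSEQ_D[OF st(5) d] by blast
  have "norm ((f (t n) - f (s n)) / (t n - s n) - D) < e" if n: "n \<ge> max n1 n2" for n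
  proof -
    have "\<bar>f (t n) - f x - D * (t n - x)\<bar> \<le> e / 2 * (t n - x)"
      using D[OF n2, of n] n st(2)[of n] by simp
    moreover have "\<bar>f (s n) - f x - D * (s n - x)\<bar> \<le> e / 2 * (x - s n)"
      using D[OF n1, of n] n st(1)[of n] by (simp add: abs_minus_commute)
    ultimately have "\<bar>(f (t n) - f x - D * (t n - x)) - (f (s n) - f x - D * (s n - x))\<bar>
        \<le> e / 2 * (t n - x) + e / 2 * (x - s n)"
      by linarith
    moreover have "(f (t n) - f x - D * (t n - x)) - (f (s n) - f x - D * (s n - x)) = f (t n) - f (s n) - D * (t n - s n)"
      by (simp add: algebra_simps)
    moreover have "e / 2 * (t n - x) + e / 2 * (x - s n) = e / 2 * (t n - s n)"
      by (simp flip: distrib_left)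
    ultimately have "\<bar>f (t n) - f (s n) - D * (t n - s n)\<bar> \<le> e / 2 * (t n - s n)" by simp
    moreover have "(f (t n) - f (s n)) / (t n - s n) - D = (f (t n) - f (s n) - D * (t n - s n)) / (t n - s n)"
      using st(3)[of n] by (simp add: field_simps)
    ultimately have "\<bar>(f (t n) - f (s n)) / (t n - s n) - D\<bar> \<le> e / 2"
      using st(3)[of n] by (simp add: pos_divide_le_eq)
    then show ?thesis using \<open>0 < e\<close> by simp
  qed
  then show "\<exists>no. \<forall>n\<ge>no. norm ((f (t n) - f (s n)) / (t n - s n) - D) < e" by blast
qed

section \<open>Absolutely continuous functions\<close>

text \<open>Families are indexed and may contain degenerate intervals, so that clamping endpoints
  and merging families stay within the notion; the sets of pairs in \<open>AC\<close> would lose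
  repeated intervals under such operations.\<close>

definition nonoverlapping :: "real \<Rightarrow> real \<Rightarrow> 'i set \<Rightarrow> ('i \<Rightarrow> real) \<Rightarrow> ('i \<Rightarrow> real) \<Rightarrow> bool"
  where "nonoverlapping a b I s t \<longleftrightarrow> finite I \<and> (\<forall>i\<in>I. a \<le> s i \<and> s i \<le> t i \<and> t i \<le> b)
    \<and> disjoint_family_on (\<lambda>i. {s i<..<t i}) I"

lemma nonoverlapping_length:
  assumes "nonoverlapping a b I s t" "a \<le> b"
  shows "(\<Sum>i\<in>I. t i - s i) \<le> b - a"
proof -
  have "(\<Sum>i\<in>I. t i - s i) = (\<Sum>i\<in>I. measure lborel {s i<..<t i})"
    using assms by (intro sum.cong) (auto simp: nonoverlapping_def)
  also have "\<dots> = measure lborel (\<Union>i\<in>I. {s i<..<t i})"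
    using assms by (intro measure_finite_Union[symmetric]) (auto simp: nonoverlapping_def)
  also have "\<dots> \<le> measure lborel {a..b}"
    using assms unfolding nonoverlapping_def
    by (intro measure_mono_fmeasurable) (force intro: sets.finite_UN fmeasurableI)+
  finally show ?thesis using assms by simp
qed

text \<open>Indexed families reduce to sets of pairs: degenerate intervals contribute nothing and
  are dropped, and two equal nondegenerate intervals would share their midpoint, so the remaining
  indices inject into pairs.\<close>

lemma AC_D:
  assumes v: "v \<in> AC a b" and "0 < \<epsilon>"
  obtains \<delta> where "0 < \<delta>" "\<And>I s t. nonoverlapping a b (I :: 'i set) s t \<Longrightarrow> (\<Sum>i\<in>I. t i - s i) < \<delta>
    \<Longrightarrow> (\<Sum>i\<in>I. \<bar>v (t i) - v (s i)\<bar>) < \<epsilon>"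
proof -
  obtain \<delta> where \<delta>: "\<delta> > 0" and *: "\<forall>D :: (real \<times> real) set.
    finite D \<and> (\<forall>(s, t)\<in>D. a \<le> s \<and> s < t \<and> t \<le> b) \<and>
    disjoint_family_on (\<lambda>(s, t). {s<..<t}) D \<and> (\<Sum>(s, t)\<in>D. t - s) < \<delta>
    \<longrightarrow> (\<Sum>(s, t)\<in>D. \<bar>v t - v s\<bar>) < \<epsilon>"
    using v \<open>0 < \<epsilon>\<close> unfolding AC_def by blast
  show thesis
  proof (rule that[OF \<delta>])
    fix I :: "'i set" and s t
    assume I: "nonoverlapping a b I s t" and len: "(\<Sum>i\<in>I. t i - s i) < \<delta>"
    define J where "J = {i\<in>I. s i < t i}"
    have J: "finite J" "J \<subseteq> I" using I by (auto simp: J_def nonoverlapping_def)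
    have dis: "{s i<..<t i} \<inter> {s j<..<t j} = {}" if "i \<in> I" "j \<in> I" "i \<noteq> j" for i j
      using I that by (auto simp: nonoverlapping_def disjoint_family_on_def)
    have inj: "inj_on (\<lambda>i. (s i, t i)) J"
    proof (rule inj_onI)
      fix i j assume ij: "i \<in> J" "j \<in> J" "(s i, t i) = (s j, t j)"
      then have "(s i + t i) / 2 \<in> {s i<..<t i} \<inter> {s j<..<t j}" by (auto simp: J_def)
      then show "i = j" using dis[of i j] ij J by blast
    qed
    have "(\<Sum>i\<in>J. f (s i) (t i)) = (\<Sum>i\<in>I. f (s i) (t i))" if "\<And>x. f x x = 0" for f :: "real \<Rightarrow> real \<Rightarrow> real"
    proof (rule sum.mono_neutral_left)
      show "finite I" "J \<subseteq> I" using I J by (auto simp: nonoverlapping_def)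
      show "\<forall>i\<in>I - J. f (s i) (t i) = 0"
        using I that by (auto simp: J_def nonoverlapping_def) (metis less_eq_real_def)
    qed
    then have eq: "(\<Sum>(x,y)\<in>(\<lambda>i. (s i, t i)) ` J. f x y) = (\<Sum>i\<in>I. f (s i) (t i))"
      if "\<And>x. f x x = 0" for f :: "real \<Rightarrow> real \<Rightarrow> real"
      using that by (simp add: sum.reindex[OF inj] o_def)
    have "(\<Sum>(x,y)\<in>(\<lambda>i. (s i, t i)) ` J. \<bar>v y - v x\<bar>) < \<epsilon>"
    proof (intro *[rule_format] conjI)
      show "finite ((\<lambda>i. (s i, t i)) ` J)" using J by simp
      show "\<forall>(x, y)\<in>(\<lambda>i. (s i, t i)) ` J. a \<le> x \<and> x < y \<and> y \<le> b"
        using I by (auto simp: J_def nonoverlapping_def)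
      show "disjoint_family_on (\<lambda>(x, y). {x<..<y}) ((\<lambda>i. (s i, t i)) ` J)"
        unfolding disjoint_family_on_def
      proof (intro ballI impI)
        fix p q assume "p \<in> (\<lambda>i. (s i, t i)) ` J" "q \<in> (\<lambda>i. (s i, t i)) ` J" "p \<noteq> q"
        then obtain i j where "i \<in> I" "j \<in> I" "p = (s i, t i)" "q = (s j, t j)" "i \<noteq> j"
          using J by blast
        then show "(case p of (x, y) \<Rightarrow> {x<..<y}) \<inter> (case q of (x, y) \<Rightarrow> {x<..<y}) = {}"
          using dis by simp
      qed
      show "(\<Sum>(x,y)\<in>(\<lambda>i. (s i, t i)) ` J. y - x) < \<delta>" using len by (subst eq) auto
    qed
    then show "(\<Sum>i\<in>I. \<bar>v (t i) - v (s i)\<bar>) < \<epsilon>" by (subst (asm) eq) auto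
  qed
qed

text \<open>The index type \<open>real \<times> real\<close> suffices because a set of pairs indexes
  itself through \<open>fst\<close> and \<open>snd\<close>.\<close>

lemma AC_I:
  assumes "\<And>\<epsilon>. 0 < \<epsilon> \<Longrightarrow> \<exists>\<delta>>0. \<forall>(I :: (real \<times> real) set) s t. nonoverlapping a b I s t \<and> (\<Sum>i\<in>I. t i - s i) < \<delta>
    \<longrightarrow> (\<Sum>i\<in>I. \<bar>v (t i) - v (s i)\<bar>) < \<epsilon>"
  shows "v \<in> AC a b"
  unfolding AC_def mem_Collect_eq
proof (intro allI impI)
  fix \<epsilon> :: real assume "0 < \<epsilon>"
  then obtain \<delta> where \<delta>: "\<delta> > 0" and *: "\<And>(I :: (real \<times> real) set) s t. nonoverlapping a b I s t \<Longrightarrow> (\<Sum>i\<in>I. t i - s i) < \<delta>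
    \<Longrightarrow> (\<Sum>i\<in>I. \<bar>v (t i) - v (s i)\<bar>) < \<epsilon>" using assms by meson
  show "\<exists>\<delta>>0. \<forall>D :: (real \<times> real) set.
    finite D \<and> (\<forall>(s, t)\<in>D. a \<le> s \<and> s < t \<and> t \<le> b) \<and>
    disjoint_family_on (\<lambda>(s, t). {s<..<t}) D \<and> (\<Sum>(s, t)\<in>D. t - s) < \<delta>
    \<longrightarrow> (\<Sum>(s, t)\<in>D. \<bar>v t - v s\<bar>) < \<epsilon>"
  proof (intro exI[of _ \<delta>] conjI \<delta> allI impI)
    fix D :: "(real \<times> real) set"
    assume D: "finite D \<and> (\<forall>(s, t)\<in>D. a \<le> s \<and> s < t \<and> t \<le> b) \<and>
      disjoint_family_on (\<lambda>(s, t). {s<..<t}) D \<and> (\<Sum>(s, t)\<in>D. t - s) < \<delta>"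
    have "nonoverlapping a b D fst snd"
      using D by (auto simp: nonoverlapping_def case_prod_beta')
    then show "(\<Sum>(s, t)\<in>D. \<bar>v t - v s\<bar>) < \<epsilon>"
      using *[of D fst snd] D by (simp add: case_prod_beta)
  qed
qed

lemma AC_subinterval: "v \<in> AC a b \<Longrightarrow> a \<le> c \<Longrightarrow> d \<le> b \<Longrightarrow> v \<in> AC c d"
proof (rule AC_I)
  fix \<epsilon> :: real assume v: "v \<in> AC a b" and "a \<le> c" "d \<le> b" "0 < \<epsilon>"
  obtain \<delta> where "0 < \<delta>" and *: "\<And>(I :: (real \<times> real) set) s t. nonoverlapping a b I s t
    \<Longrightarrow> (\<Sum>i\<in>I. t i - s i) < \<delta> \<Longrightarrow> (\<Sum>i\<in>I. \<bar>v (t i) - v (s i)\<bar>) < \<epsilon>"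
    by (rule AC_D[OF v \<open>0 < \<epsilon>\<close>]) (rule that; blast)
  moreover have "nonoverlapping a b I s t" if "nonoverlapping c d I s t" for I :: "(real \<times> real) set" and s t
    using that \<open>a \<le> c\<close> \<open>d \<le> b\<close> by (fastforce simp: nonoverlapping_def)
  ultimately show "\<exists>\<delta>>0. \<forall>(I :: (real \<times> real) set) s t. nonoverlapping c d I s t \<and> (\<Sum>i\<in>I. t i - s i) < \<delta>
    \<longrightarrow> (\<Sum>i\<in>I. \<bar>v (t i) - v (s i)\<bar>) < \<epsilon>" by blast
qed

lemma AC_imp_continuous_on:
  assumes v: "v \<in> AC a b" shows "continuous_on {a..b} v"
  unfolding continuous_on_iff
proof (intro ballI allI impI)
  fix x and \<epsilon> :: real assume x: "x \<in> {a..b}" and "0 < \<epsilon>"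
  obtain \<delta> where \<delta>: "0 < \<delta>" and *: "\<And>(I :: unit set) s t. nonoverlapping a b I s t
    \<Longrightarrow> (\<Sum>i\<in>I. t i - s i) < \<delta> \<Longrightarrow> (\<Sum>i\<in>I. \<bar>v (t i) - v (s i)\<bar>) < \<epsilon>"
    by (rule AC_D[OF v \<open>0 < \<epsilon>\<close>]) (rule that; blast)
  have *: "dist (v y) (v z) < \<epsilon>" if "a \<le> y" "y \<le> z" "z \<le> b" "z - y < \<delta>" for y z
    using *[of UNIV "\<lambda>_. y" "\<lambda>_. z"] that
    by (auto simp: nonoverlapping_def disjoint_family_on_def dist_real_def abs_minus_commute)
  have "dist (v y) (v x) < \<epsilon>" if "y \<in> {a..b}" "dist y x < \<delta>" for y
    using *[of x y] *[of y x] that x by (cases "x \<le> y") (auto simp: dist_commute dist_real_def)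
  with \<delta> show "\<exists>d>0. \<forall>y\<in>{a..b}. dist y x < d \<longrightarrow> dist (v y) (v x) < \<epsilon>" by blast
qed

section \<open>Variation sums and total variation\<close>

definition variation_sums :: "(real \<Rightarrow> real) \<Rightarrow> real \<Rightarrow> real \<Rightarrow> real set"
  where "variation_sums v a b = {\<Sum>i\<in>I. \<bar>v (t i) - v (s i)\<bar> | (I :: nat set) s t. nonoverlapping a b I s t}"

text \<open>The definition fixes the index type \<open>nat\<close>, since a set cannot range over
  types; any finite family can be renumbered.\<close>

lemma variation_sums_I:
  assumes "nonoverlapping a b (I :: 'i set) s t"
  shows "(\<Sum>i\<in>I. \<bar>v (t i) - v (s i)\<bar>) \<in> variation_sums v a b"
proof -
  have "finite I" using assms by (simp add: nonoverlapping_def)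
  then obtain h where h: "bij_betw h {0..<card I} I" using ex_bij_betw_nat_finite by blast
  then have hI: "\<And>i. i < card I \<Longrightarrow> h i \<in> I" and inj: "inj_on h {0..<card I}"
    by (auto simp: bij_betw_def)
  have "nonoverlapping a b {0..<card I} (s \<circ> h) (t \<circ> h)"
    using assms hI inj unfolding nonoverlapping_def disjoint_family_on_def
    by (auto simp: inj_on_def disjoint_iff) (metis atLeastLessThan_iff greaterThanLessThan_iff zero_le)
  moreover have "(\<Sum>i\<in>I. \<bar>v (t i) - v (s i)\<bar>) = (\<Sum>i\<in>{0..<card I}. \<bar>v ((t \<circ> h) i) - v ((s \<circ> h) i)\<bar>)"
    using sum.reindex_bij_betw[OF h, of "\<lambda>i. \<bar>v (t i) - v (s i)\<bar>"] by simp
  ultimately show ?thesis unfolding variation_sums_def by blast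
qed

lemma variation_sums_0: "0 \<in> variation_sums v a b"
  using variation_sums_I[of a b "{} :: nat set"] by (simp add: nonoverlapping_def disjoint_family_on_def)

lemma variation_sums_increment:
  "a \<le> b \<Longrightarrow> \<bar>v b - v a\<bar> \<in> variation_sums v a b"
  using variation_sums_I[of a b "{0::nat}" "\<lambda>_. a" "\<lambda>_. b" v]
  by (simp add: nonoverlapping_def disjoint_family_on_def)

lemma variation_sums_add:
  assumes "p \<in> variation_sums v a b" "q \<in> variation_sums v b c" "a \<le> b" "b \<le> c"
  shows "p + q \<in> variation_sums v a c"
proof -
  obtain I J :: "nat set" and s t s' t' where I: "nonoverlapping a b I s t" "p = (\<Sum>i\<in>I. \<bar>v (t i) - v (s i)\<bar>)"
    and J: "nonoverlapping b c J s' t'" "q = (\<Sum>i\<in>J. \<bar>v (t' i) - v (s' i)\<bar>)"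
    using assms unfolding variation_sums_def by blast
  have "nonoverlapping a c (I <+> J) (case_sum s s') (case_sum t t')"
    unfolding nonoverlapping_def disjoint_family_on_def
  proof (intro conjI ballI impI)
    show "finite (I <+> J)" using I J by (simp add: nonoverlapping_def)
    fix i assume "i \<in> I <+> J"
    then show "a \<le> case_sum s s' i" "case_sum s s' i \<le> case_sum t t' i" "case_sum t t' i \<le> c"
      using I J assms(3,4) by (fastforce simp: nonoverlapping_def)+
    fix j assume j: "j \<in> I <+> J" "i \<noteq> j"
    have less: "t k \<le> s' l" if "k \<in> I" "l \<in> J" for k l
    proof -
      have "t k \<le> b" "b \<le> s' l" using I J that by (auto simp: nonoverlapping_def)
      then show ?thesis by simp
    qed
    show "{case_sum s s' i<..<case_sum t t' i} \<inter> {case_sum s s' j<..<case_sum t t' j} = {}"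
      using \<open>i \<in> I <+> J\<close> j I J
      by (elim PlusE) (auto simp: nonoverlapping_def disjoint_family_on_def disjoint_iff; smt (verit) less)+
  qed
  from variation_sums_I[OF this, of v] show ?thesis
    using I J by (simp add: sum.Plus nonoverlapping_def)
qed

text \<open>Each interval is cut at \<open>b\<close> by clamping its endpoints with
  \<open>min\<close> and \<open>max\<close>; an interval on one side becomes degenerate on the
  other, and the triangle inequality holds term by term.\<close>

lemma variation_sums_split:
  assumes "r \<in> variation_sums v a c" "a \<le> b" "b \<le> c"
  obtains p q where "p \<in> variation_sums v a b" "q \<in> variation_sums v b c" "r \<le> p + q"
proof -
  obtain I :: "nat set" and s t where I: "nonoverlapping a c I s t" "r = (\<Sum>i\<in>I. \<bar>v (t i) - v (s i)\<bar>)"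
    using assms unfolding variation_sums_def by blast
  show thesis
  proof
    have "nonoverlapping a b I (\<lambda>i. min (s i) b) (\<lambda>i. min (t i) b)"
      using I(1) assms unfolding nonoverlapping_def disjoint_family_on_def disjoint_iff
      by (auto simp: min_less_iff_disj)
    then show "(\<Sum>i\<in>I. \<bar>v (min (t i) b) - v (min (s i) b)\<bar>) \<in> variation_sums v a b"
      by (rule variation_sums_I)
    have "nonoverlapping b c I (\<lambda>i. max (s i) b) (\<lambda>i. max (t i) b)"
      using I(1) assms unfolding nonoverlapping_def disjoint_family_on_def disjoint_iff
      by (auto simp: less_max_iff_disj)
    then show "(\<Sum>i\<in>I. \<bar>v (max (t i) b) - v (max (s i) b)\<bar>) \<in> variation_sums v b c"
      by (rule variation_sums_I)
    show "r \<le> (\<Sum>i\<in>I. \<bar>v (min (t i) b) - v (min (s i) b)\<bar>) + (\<Sum>i\<in>I. \<bar>v (max (t i) b) - v (max (s i) b)\<bar>)"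
      unfolding I(2) sum.distrib[symmetric]
      by (intro sum_mono) (auto simp: min_def max_def)
  qed
qed

text \<open>Absolute continuity with tolerance 1 bounds the variation over any piece shorter than
  \<delta>, so \<open>k\<close> consecutive pieces of length \<delta>/2 carry variation at most
  \<open>k\<close>. The cap \<open>min b\<close> lets the last piece be shorter.\<close>

lemma AC_bounded_variation:
  assumes v: "v \<in> AC a b" and "a \<le> b"
  shows "bdd_above (variation_sums v a b)"
proof -
  obtain \<delta> where "0 < \<delta>" and \<delta>: "\<And>(I :: nat set) s t. nonoverlapping a b I s t \<Longrightarrow> (\<Sum>i\<in>I. t i - s i) < \<delta>
    \<Longrightarrow> (\<Sum>i\<in>I. \<bar>v (t i) - v (s i)\<bar>) < 1"
    by (rule AC_D[OF v zero_less_one]) (rule that; blast)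
  define h where "h = \<delta> / 2"
  have h: "0 < h" "h < \<delta>" using \<open>0 < \<delta>\<close> by (auto simp: h_def)
  have "\<forall>r\<in>variation_sums v a (min b (a + real k * h)). r \<le> real k" for k
  proof (induction k)
    case 0
    { fix I :: "nat set" and s t assume I: "nonoverlapping a a I s t"
      then have "\<forall>i\<in>I. t i = s i" unfolding nonoverlapping_def by (metis order_antisym order_trans)
      then have "(\<Sum>i\<in>I. \<bar>v (t i) - v (s i)\<bar>) = 0" by simp }
    then show ?case using \<open>a \<le> b\<close> by (auto simp: variation_sums_def min_def)
  next
    case (Suc k)
    show ?case
    proof
      fix r assume r: "r \<in> variation_sums v a (min b (a + real (Suc k) * h))"
      have le: "a \<le> min b (a + real k * h)" "min b (a + real k * h) \<le> min b (a + real (Suc k) * h)"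
        using \<open>a \<le> b\<close> h by (auto simp: algebra_simps min_def)
      obtain p q where p: "p \<in> variation_sums v a (min b (a + real k * h))"
        and q: "q \<in> variation_sums v (min b (a + real k * h)) (min b (a + real (Suc k) * h))" and "r \<le> p + q"
        using variation_sums_split[OF r le] .
      obtain I :: "nat set" and s t where I: "nonoverlapping (min b (a + real k * h)) (min b (a + real (Suc k) * h)) I s t"
        "q = (\<Sum>i\<in>I. \<bar>v (t i) - v (s i)\<bar>)" using q unfolding variation_sums_def by blast
      have "(\<Sum>i\<in>I. t i - s i) \<le> min b (a + real (Suc k) * h) - min b (a + real k * h)"
        using nonoverlapping_length[OF I(1) le(2)] .
      also have "\<dots> \<le> h" using h by (auto simp: min_def algebra_simps)
      finally have "(\<Sum>i\<in>I. t i - s i) < \<delta>" using h by simp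
      moreover have "nonoverlapping a b I s t"
        using I(1) le unfolding nonoverlapping_def by (meson min.bounded_iff order_trans)
      ultimately have "q < 1" using \<delta> I(2) by blast
      then show "r \<le> real (Suc k)" using Suc p \<open>r \<le> p + q\<close> by force
    qed
  qed
  moreover obtain k :: nat where "b - a < real k * h" using reals_Archimedean3[OF h(1)] by blast
  then have "min b (a + real k * h) = b" by simp
  ultimately show ?thesis by (metis bdd_aboveI)
qed

definition total_variation :: "(real \<Rightarrow> real) \<Rightarrow> real \<Rightarrow> real \<Rightarrow> real"
  where "total_variation v a x = Sup (variation_sums v a x)"

text \<open>The two inequalities behind additivity of the variation. The second is stated with a
  witness because \<open>AC_total_variation\<close> works with an actual subpartition.\<close>

lemma
  assumes v: "v \<in> AC a b" and xy: "a \<le> x" "x \<le> y" "y \<le> b"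
  shows total_variation_ge: "q \<in> variation_sums v x y \<Longrightarrow> total_variation v a x + q \<le> total_variation v a y"
    and total_variation_approx: "0 < \<eta> \<Longrightarrow> \<exists>q\<in>variation_sums v x y. total_variation v a y - total_variation v a x < q + \<eta>"
proof -
  have bdd: "bdd_above (variation_sums v a x)" "bdd_above (variation_sums v a y)"
    using v xy by (auto intro!: AC_bounded_variation AC_subinterval[OF v])
  { assume q: "q \<in> variation_sums v x y"
    have "p \<le> total_variation v a y - q" if "p \<in> variation_sums v a x" for p
      using cSup_upper[OF variation_sums_add[OF that q] bdd(2)] xy by (simp add: total_variation_def)
    then have "total_variation v a x \<le> total_variation v a y - q"
      unfolding total_variation_def using variation_sums_0[of v a x] by (intro cSup_least) auto
    then show "total_variation v a x + q \<le> total_variation v a y" by simp }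
  { assume "0 < \<eta>"
    then have "total_variation v a y - \<eta> < Sup (variation_sums v a y)" by (simp add: total_variation_def)
    then obtain r where "r \<in> variation_sums v a y" and r: "total_variation v a y - \<eta> < r"
      using less_cSup_iff[OF _ bdd(2)] variation_sums_0[of v a y] by (metis empty_iff)
    then obtain p q where p: "p \<in> variation_sums v a x" and q: "q \<in> variation_sums v x y" and "r \<le> p + q"
      using variation_sums_split[OF _ xy(1,2)] by blast
    moreover have "p \<le> total_variation v a x" unfolding total_variation_def using cSup_upper[OF p bdd(1)] .
    ultimately show "\<exists>q\<in>variation_sums v x y. total_variation v a y - total_variation v a x < q + \<eta>"
      using r by (intro bexI[OF _ q]) simp }
qed

text \<open>Each increment of the variation is replaced by a subpartition that attains it up to
  \<eta>. All subpartitions together form one family no longer than the original, to which absolute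
  continuity of \<open>v\<close> applies.\<close>

lemma AC_total_variation:
  assumes v: "v \<in> AC a b"
  shows "total_variation v a \<in> AC a b"
proof (rule AC_I)
  fix \<epsilon> :: real assume "0 < \<epsilon>"
  then have "0 < \<epsilon> / 2" by simp
  obtain \<delta> where "0 < \<delta>" and \<delta>: "\<And>(I :: ((real \<times> real) \<times> nat) set) s t.
    nonoverlapping a b I s t \<Longrightarrow> (\<Sum>i\<in>I. t i - s i) < \<delta>
    \<Longrightarrow> (\<Sum>i\<in>I. \<bar>v (t i) - v (s i)\<bar>) < \<epsilon> / 2"
    by (rule AC_D[OF v \<open>0 < \<epsilon> / 2\<close>]) (rule that; blast)
  have "(\<Sum>i\<in>I. \<bar>total_variation v a (t i) - total_variation v a (s i)\<bar>) < \<epsilon>"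
    if I: "nonoverlapping a b I s t" and len: "(\<Sum>i\<in>I. t i - s i) < \<delta>" for I :: "(real \<times> real) set" and s t
  proof -
    \<comment> \<open>Chosen so that \<open>card I\<close> errors add up to at most \<epsilon>/2;
      the summand 1 covers the empty family.\<close>
    define \<eta> where "\<eta> = \<epsilon> / (2 * (real (card I) + 1))"
    have \<eta>: "\<eta> > 0" using \<open>0 < \<epsilon>\<close> by (simp add: \<eta>_def)
    have st: "a \<le> s i" "s i \<le> t i" "t i \<le> b" if "i \<in> I" for i
      using I that by (auto simp: nonoverlapping_def)
    have "\<exists>(J :: nat set) s' t'. nonoverlapping (s i) (t i) J s' t' \<and>
        total_variation v a (t i) - total_variation v a (s i) < (\<Sum>j\<in>J. \<bar>v (t' j) - v (s' j)\<bar>) + \<eta>" if "i \<in> I" for i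
      using total_variation_approx[OF v st[OF that] \<eta>] unfolding variation_sums_def by blast
    then have "\<exists>q :: nat set \<times> (nat \<Rightarrow> real) \<times> (nat \<Rightarrow> real). nonoverlapping (s i) (t i) (fst q) (fst (snd q)) (snd (snd q)) \<and>
        total_variation v a (t i) - total_variation v a (s i) < (\<Sum>j\<in>fst q. \<bar>v (snd (snd q) j) - v (fst (snd q) j)\<bar>) + \<eta>"
      if "i \<in> I" for i using that by fastforce
    then have "\<forall>i\<in>I. \<exists>q :: nat set \<times> (nat \<Rightarrow> real) \<times> (nat \<Rightarrow> real). nonoverlapping (s i) (t i) (fst q) (fst (snd q)) (snd (snd q)) \<and>
        total_variation v a (t i) - total_variation v a (s i) < (\<Sum>j\<in>fst q. \<bar>v (snd (snd q) j) - v (fst (snd q) j)\<bar>) + \<eta>"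
      by blast
    from bchoice[OF this] obtain q :: "real \<times> real \<Rightarrow> nat set \<times> (nat \<Rightarrow> real) \<times> (nat \<Rightarrow> real)" where
      q: "\<forall>i\<in>I. nonoverlapping (s i) (t i) (fst (q i)) (fst (snd (q i))) (snd (snd (q i))) \<and>
        total_variation v a (t i) - total_variation v a (s i) < (\<Sum>j\<in>fst (q i). \<bar>v (snd (snd (q i)) j) - v (fst (snd (q i)) j)\<bar>) + \<eta>" ..
    define J s' t' where "J = (\<lambda>i. fst (q i))" and "s' = (\<lambda>i. fst (snd (q i)))" and "t' = (\<lambda>i. snd (snd (q i)))"
    have J: "nonoverlapping (s i) (t i) (J i) (s' i) (t' i)"
      and TV: "total_variation v a (t i) - total_variation v a (s i) < (\<Sum>j\<in>J i. \<bar>v (t' i j) - v (s' i j)\<bar>) + \<eta>"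
      if "i \<in> I" for i using q that by (auto simp: J_def s'_def t'_def)
    define T S where "T = (\<lambda>(i,j). t' i j)" and "S = (\<lambda>(i,j). s' i j)"
    have fin: "finite I" "\<And>i. i \<in> I \<Longrightarrow> finite (J i)" using I J by (auto simp: nonoverlapping_def)
    have b: "s i \<le> s' i j" "s' i j \<le> t' i j" "t' i j \<le> t i" if "i \<in> I" "j \<in> J i" for i j
      using J[OF that(1)] that(2) by (auto simp: nonoverlapping_def)
    have "nonoverlapping a b (Sigma I J) S T"
      unfolding nonoverlapping_def disjoint_family_on_def
    proof (intro conjI ballI impI)
      show "finite (Sigma I J)" using fin by auto
      fix p assume p: "p \<in> Sigma I J"
      obtain i j where pij: "p = (i,j)" "i \<in> I" "j \<in> J i" using p by blast
      show "a \<le> S p" "S p \<le> T p" "T p \<le> b"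
        using b[OF pij(2,3)] st[OF pij(2)] by (auto simp: S_def T_def pij)
      fix q assume q: "q \<in> Sigma I J" "p \<noteq> q"
      obtain k l where qkl: "q = (k,l)" "k \<in> I" "l \<in> J k" using q by blast
      show "{S p<..<T p} \<inter> {S q<..<T q} = {}"
      proof (cases "i = k")
        case True
        then show ?thesis using J[OF pij(2)] pij qkl q
          by (auto simp: nonoverlapping_def disjoint_family_on_def S_def T_def)
      next
        case False
        then have "{s i<..<t i} \<inter> {s k<..<t k} = {}"
          using I pij qkl by (auto simp: nonoverlapping_def disjoint_family_on_def)
        moreover have "{S p<..<T p} \<subseteq> {s i<..<t i}" "{S q<..<T q} \<subseteq> {s k<..<t k}"
          using b[OF pij(2,3)] b[OF qkl(2,3)] by (auto simp: S_def T_def pij qkl)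
        ultimately show ?thesis by blast
      qed
    qed
    moreover have "(\<Sum>p\<in>Sigma I J. T p - S p) < \<delta>"
    proof -
      have "(\<Sum>p\<in>Sigma I J. T p - S p) = (\<Sum>i\<in>I. \<Sum>j\<in>J i. t' i j - s' i j)"
        using fin by (subst sum.Sigma) (auto simp: S_def T_def case_prod_beta)
      also have "\<dots> \<le> (\<Sum>i\<in>I. t i - s i)"
        by (intro sum_mono nonoverlapping_length J st)
      finally show ?thesis using len by simp
    qed
    ultimately have "(\<Sum>p\<in>Sigma I J. \<bar>v (T p) - v (S p)\<bar>) < \<epsilon> / 2" by (rule \<delta>)
    also have "(\<Sum>p\<in>Sigma I J. \<bar>v (T p) - v (S p)\<bar>) = (\<Sum>i\<in>I. \<Sum>j\<in>J i. \<bar>v (t' i j) - v (s' i j)\<bar>)"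
      using fin by (subst sum.Sigma) (auto simp: S_def T_def case_prod_beta)
    finally have *: "(\<Sum>i\<in>I. \<Sum>j\<in>J i. \<bar>v (t' i j) - v (s' i j)\<bar>) < \<epsilon> / 2" .
    have "(\<Sum>i\<in>I. \<bar>total_variation v a (t i) - total_variation v a (s i)\<bar>)
        \<le> (\<Sum>i\<in>I. (\<Sum>j\<in>J i. \<bar>v (t' i j) - v (s' i j)\<bar>) + \<eta>)"
    proof (rule sum_mono)
      fix i assume i: "i \<in> I"
      have "total_variation v a (s i) + \<bar>v (t i) - v (s i)\<bar> \<le> total_variation v a (t i)"
        using total_variation_ge[OF v st[OF i] variation_sums_increment[OF st(2)[OF i]]] .
      then show "\<bar>total_variation v a (t i) - total_variation v a (s i)\<bar> \<le> (\<Sum>j\<in>J i. \<bar>v (t' i j) - v (s' i j)\<bar>) + \<eta>"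
        using TV[OF i] by simp
    qed
    also have "\<dots> = (\<Sum>i\<in>I. \<Sum>j\<in>J i. \<bar>v (t' i j) - v (s' i j)\<bar>) + real (card I) * \<eta>"
      by (simp add: sum.distrib)
    also have "\<dots> < \<epsilon> / 2 + \<epsilon> / 2"
    proof (rule add_less_le_mono[OF *])
      show "real (card I) * \<eta> \<le> \<epsilon> / 2" using \<open>0 < \<epsilon>\<close> by (simp add: \<eta>_def field_simps)
    qed
    finally show ?thesis by simp
  qed
  then show "\<exists>\<delta>>0. \<forall>(I :: (real \<times> real) set) s t. nonoverlapping a b I s t \<and> (\<Sum>i\<in>I. t i - s i) < \<delta>
    \<longrightarrow> (\<Sum>i\<in>I. \<bar>total_variation v a (t i) - total_variation v a (s i)\<bar>) < \<epsilon>"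
    using \<open>0 < \<delta>\<close> by blast
qed

lemma AC_diff:
  assumes u: "u \<in> AC a b" and v: "v \<in> AC a b" shows "(\<lambda>x. u x - v x) \<in> AC a b"
proof (rule AC_I)
  fix \<epsilon> :: real assume "0 < \<epsilon>"
  then have e2: "0 < \<epsilon> / 2" by simp
  obtain d where d: "0 < d" "\<And>(I :: (real \<times> real) set) s t. nonoverlapping a b I s t
    \<Longrightarrow> (\<Sum>i\<in>I. t i - s i) < d \<Longrightarrow> (\<Sum>i\<in>I. \<bar>u (t i) - u (s i)\<bar>) < \<epsilon> / 2"
    by (rule AC_D[OF u e2]) (rule that; blast)
  obtain d' where d': "0 < d'" "\<And>(I :: (real \<times> real) set) s t. nonoverlapping a b I s t
    \<Longrightarrow> (\<Sum>i\<in>I. t i - s i) < d' \<Longrightarrow> (\<Sum>i\<in>I. \<bar>v (t i) - v (s i)\<bar>) < \<epsilon> / 2"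
    by (rule AC_D[OF v e2]) (rule that; blast)
  have "(\<Sum>i\<in>I. \<bar>u (t i) - v (t i) - (u (s i) - v (s i))\<bar>) < \<epsilon>"
    if "nonoverlapping a b I s t" "(\<Sum>i\<in>I. t i - s i) < min d d'" for I :: "(real \<times> real) set" and s t
  proof -
    have "(\<Sum>i\<in>I. \<bar>u (t i) - v (t i) - (u (s i) - v (s i))\<bar>) \<le> (\<Sum>i\<in>I. \<bar>u (t i) - u (s i)\<bar> + \<bar>v (t i) - v (s i)\<bar>)"
    proof (rule sum_mono)
      show "\<bar>u (t i) - v (t i) - (u (s i) - v (s i))\<bar> \<le> \<bar>u (t i) - u (s i)\<bar> + \<bar>v (t i) - v (s i)\<bar>" for i
        by linarith
    qed
    also have "\<dots> < \<epsilon> / 2 + \<epsilon> / 2"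
      using d(2)[OF that(1)] d'(2)[OF that(1)] that(2) by (simp add: sum.distrib)
    finally show ?thesis by simp
  qed
  then show "\<exists>\<delta>>0. \<forall>(I :: (real \<times> real) set) s t. nonoverlapping a b I s t \<and> (\<Sum>i\<in>I. t i - s i) < \<delta>
    \<longrightarrow> (\<Sum>i\<in>I. \<bar>u (t i) - v (t i) - (u (s i) - v (s i))\<bar>) < \<epsilon>"
    using d(1) d'(1) by (intro exI[of _ "min d d'"]) auto
qed

section \<open>The fundamental theorem for absolutely continuous functions\<close>

text \<open>At each point at most one of the functions cut off to the open intervals is nonzero, so
  their sum stays below \<open>h\<close>.\<close>

lemma nonoverlapping_integral_le:
  fixes h :: "real \<Rightarrow> real"
  assumes I: "nonoverlapping a b I s t" and h: "h integrable_on {a..b}" and nonneg: "\<And>x. 0 \<le> h x"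
  shows "(\<Sum>i\<in>I. integral {s i..t i} h) \<le> integral {a..b} h"
proof -
  have fin: "finite I" and st: "\<And>i. i \<in> I \<Longrightarrow> {s i..t i} \<subseteq> {a..b}"
    and dis: "disjoint_family_on (\<lambda>i. {s i<..<t i}) I"
    using I by (auto simp: nonoverlapping_def)
  have hi: "h integrable_on {s i..t i}" if "i \<in> I" for i
    using h st[OF that] by (rule integrable_on_subinterval)
  have int: "((\<lambda>x. if x \<in> {s i<..<t i} then h x else 0) has_integral integral {s i..t i} h) {a..b}" if "i \<in> I" for i
  proof -
    have "{s i<..<t i} \<subseteq> {a..b}" using st[OF that] greaterThanLessThan_subseteq_atLeastAtMost_iff by fastforce
    moreover have "(h has_integral integral {s i..t i} h) {s i<..<t i}"
      using integrable_integral[OF hi[OF that]] has_integral_Icc_iff_Ioo by blast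
    ultimately show ?thesis by (simp only: has_integral_restrict)
  qed
  have "((\<lambda>x. \<Sum>i\<in>I. if x \<in> {s i<..<t i} then h x else 0) has_integral (\<Sum>i\<in>I. integral {s i..t i} h)) {a..b}"
    using fin int by (rule has_integral_sum)
  moreover have "(h has_integral integral {a..b} h) {a..b}" using h by (rule integrable_integral)
  moreover have "(\<Sum>i\<in>I. if x \<in> {s i<..<t i} then h x else 0) \<le> h x" for x
  proof (cases "\<exists>j\<in>I. x \<in> {s j<..<t j}")
    case True
    then obtain j where j: "j \<in> I" "x \<in> {s j<..<t j}" by blast
    then have "x \<notin> {s i<..<t i}" if "i \<in> I" "i \<noteq> j" for i
      using dis that j unfolding disjoint_family_on_def by blast
    then have "(\<Sum>i\<in>I. if x \<in> {s i<..<t i} then h x else 0) = (\<Sum>i\<in>I. if i = j then h x else 0)"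
      using j by (intro sum.cong) auto
    then show ?thesis using fin j by simp
  next
    case False
    then have "(\<Sum>i\<in>I. if x \<in> {s i<..<t i} then h x else 0) = 0" by (intro sum.neutral) auto
    then show ?thesis using nonneg by simp
  qed
  ultimately show ?thesis by (rule has_integral_le)
qed

text \<open>Truncation: |g| is at most \<open>k\<close> plus its excess over \<open>k\<close>, whose
  integral tends to 0 by dominated convergence. The excess is small over every family at once, and
  the bounded part is small over families of short total length.\<close>

lemma AC_indefinite_integral:
  assumes g: "g absolutely_integrable_on {a..b}"
    and v: "\<And>x. x \<in> {a..b} \<Longrightarrow> v x = c + integral {a..x} g"
  shows "v \<in> AC a b"
proof (rule AC_I)
  fix \<epsilon> :: real assume "0 < \<epsilon>"
  define h where "h k x = max 0 (\<bar>g x\<bar> - real k)" for k x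
  have absg: "(\<lambda>x. \<bar>g x\<bar>) integrable_on {a..b}"
    using g by (simp add: absolutely_integrable_on_def)
  have hint: "h k integrable_on {a..b}" for k
  proof -
    have "(\<lambda>x. \<bar>g x\<bar> - real k) absolutely_integrable_on {a..b}"
      using set_integral_diff(1)[OF absolutely_integrable_abs[OF g], of "\<lambda>_. real k"] by simp
    then have "(\<lambda>x. max 0 (\<bar>g x\<bar> - real k)) absolutely_integrable_on {a..b}"
      by (intro absolutely_integrable_max_1) auto
    then show ?thesis unfolding h_def by (rule set_lebesgue_integral_eq_integral(1))
  qed
  have "(\<lambda>k. integral {a..b} (h k)) \<longlonglongrightarrow> integral {a..b} (\<lambda>_. 0 :: real)"
  proof (rule dominated_convergence(2)[OF hint absg])
    show "norm (h k x) \<le> \<bar>g x\<bar>" for k x by (auto simp: h_def)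
    show "(\<lambda>k. h k x) \<longlonglongrightarrow> 0" for x
    proof (rule tendsto_eventually)
      obtain K :: nat where "\<bar>g x\<bar> \<le> real K" using real_arch_simple by blast
      then show "\<forall>\<^sub>F k in sequentially. h k x = 0"
        by (auto simp: h_def eventually_sequentially intro!: exI[of _ K])
    qed
  qed
  then have "(\<lambda>k. integral {a..b} (h k)) \<longlonglongrightarrow> 0" by simp
  moreover have "0 < \<epsilon> / 2" using \<open>0 < \<epsilon>\<close> by simp
  ultimately obtain k where k: "norm (integral {a..b} (h k) - 0) < \<epsilon> / 2"
    using LIMSEQ_D by blast
  define \<delta> where "\<delta> = \<epsilon> / (2 * (real k + 1))"
  have "0 < \<delta>" using \<open>0 < \<epsilon>\<close> by (simp add: \<delta>_def)
  have "(\<Sum>i\<in>I. \<bar>v (t i) - v (s i)\<bar>) < \<epsilon>"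
    if I: "nonoverlapping a b I s t" and len: "(\<Sum>i\<in>I. t i - s i) < \<delta>" for I :: "(real \<times> real) set" and s t
  proof -
    have "\<bar>v (t i) - v (s i)\<bar> \<le> real k * (t i - s i) + integral {s i..t i} (h k)" if "i \<in> I" for i
    proof -
      have i: "a \<le> s i" "s i \<le> t i" "t i \<le> b" using I that by (auto simp: nonoverlapping_def)
      have gi: "g absolutely_integrable_on {s i..t i}"
        using g i by (intro absolutely_integrable_on_subinterval[OF g]) auto
      have "g integrable_on {a..t i}"
        using g i by (intro integrable_on_subinterval[OF set_lebesgue_integral_eq_integral(1)[OF g]]) auto
      then have "integral {a..s i} g + integral {s i..t i} g = integral {a..t i} g"
        using i by (intro Henstock_Kurzweil_Integration.integral_combine) auto
      then have "\<bar>v (t i) - v (s i)\<bar> = norm (integral {s i..t i} g)" using v i by simp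
      also have "\<dots> \<le> integral {s i..t i} (\<lambda>x. real k + h k x)"
      proof (rule integral_norm_bound_integral)
        show "g integrable_on {s i..t i}" using gi by (rule set_lebesgue_integral_eq_integral(1))
        show "(\<lambda>x. real k + h k x) integrable_on {s i..t i}"
          using i by (intro integrable_add integrable_on_subinterval[OF hint]) auto
        show "norm (g x) \<le> real k + h k x" for x by (auto simp: h_def)
      qed
      also have "\<dots> = real k * (t i - s i) + integral {s i..t i} (h k)"
        using i by (subst Henstock_Kurzweil_Integration.integral_add) (auto intro: integrable_on_subinterval[OF hint])
      finally show ?thesis .
    qed
    then have "(\<Sum>i\<in>I. \<bar>v (t i) - v (s i)\<bar>) \<le> real k * (\<Sum>i\<in>I. t i - s i) + (\<Sum>i\<in>I. integral {s i..t i} (h k))"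
      unfolding sum_distrib_left sum.distrib[symmetric] by (rule sum_mono)
    also have "\<dots> < \<epsilon> / 2 + \<epsilon> / 2"
    proof (rule add_le_less_mono)
      have "real k * (\<Sum>i\<in>I. t i - s i) \<le> real k * \<delta>" using len by (intro mult_left_mono) auto
      also have "\<dots> \<le> \<epsilon> / 2" using \<open>0 < \<epsilon>\<close> by (simp add: \<delta>_def field_simps)
      finally show "real k * (\<Sum>i\<in>I. t i - s i) \<le> \<epsilon> / 2" .
      have "(\<Sum>i\<in>I. integral {s i..t i} (h k)) \<le> integral {a..b} (h k)"
        by (rule nonoverlapping_integral_le[OF I hint]) (simp add: h_def)
      then show "(\<Sum>i\<in>I. integral {s i..t i} (h k)) < \<epsilon> / 2" using k by simp
    qed
    finally show ?thesis by simp
  qed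
  then show "\<exists>\<delta>>0. \<forall>(I :: (real \<times> real) set) s t. nonoverlapping a b I s t \<and> (\<Sum>i\<in>I. t i - s i) < \<delta>
    \<longrightarrow> (\<Sum>i\<in>I. \<bar>v (t i) - v (s i)\<bar>) < \<epsilon>"
    using \<open>0 < \<delta>\<close> by blast
qed

text \<open>\<open>G\<close> extends \<open>F\<close> by constants outside [a,b]. A null set lies in
  an open set of length below \<delta>; the Stieltjes measure of each component of it is at most the
  increment of \<open>G\<close>, so absolute continuity of \<open>F\<close> bounds every finite
  union of components by \<epsilon>, hence also the open set.\<close>

lemma monotone_AC_interval_measure_absolutely_continuous:
  fixes F :: "real \<Rightarrow> real" and a b :: real
  defines "G \<equiv> (\<lambda>x. F (max a (min b x)))"
  assumes F: "F \<in> AC a b" and mono: "\<And>x y. a \<le> x \<Longrightarrow> x \<le> y \<Longrightarrow> y \<le> b \<Longrightarrow> F x \<le> F y" and "a \<le> b"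
  shows "continuous_on UNIV G" "mono G" "absolutely_continuous lborel (interval_measure G)"
proof -
  have "continuous_on UNIV (F \<circ> (\<lambda>x. max a (min b x)))"
    by (rule continuous_on_compose[OF _ continuous_on_subset[OF AC_imp_continuous_on[OF F]]])
      (use \<open>a \<le> b\<close> in \<open>auto intro!: continuous_intros\<close>)
  then show contG: "continuous_on UNIV G" by (simp add: G_def o_def)
  show "mono G" unfolding G_def
    by (rule monoI, rule mono) (use \<open>a \<le> b\<close> in auto)
  then have monoG: "\<And>x y. x \<le> y \<Longrightarrow> G x \<le> G y" by (rule monoD)
  have rc: "\<And>x. continuous (at_right x) G"
    using contG by (auto simp: continuous_on_eq_continuous_within intro: continuous_within_subset)
  let ?\<mu> = "interval_measure G"
  \<comment> \<open>Boundedness makes every component an interval with finite endpoints; a general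
    null set is exhausted by bounded pieces at the end.\<close>
  have null_bounded: "emeasure ?\<mu> N = 0" if N: "N \<in> null_sets lborel" and bd: "N \<subseteq> {- real n<..<real n}" for N n
  proof -
    have *: "emeasure ?\<mu> N \<le> 0 + ennreal \<epsilon>" if "0 < \<epsilon>" for \<epsilon>
    proof -
      obtain \<delta> where "0 < \<delta>" and \<delta>: "\<And>(I :: real set set) s t. nonoverlapping a b I s t \<Longrightarrow> (\<Sum>i\<in>I. t i - s i) < \<delta>
        \<Longrightarrow> (\<Sum>i\<in>I. \<bar>F (t i) - F (s i)\<bar>) < \<epsilon>"
        by (rule AC_D[OF F \<open>0 < \<epsilon>\<close>]) (rule that; blast)
      have Nb: "N \<in> sets borel" using N by auto
      obtain U0 where U0: "open U0" "N \<subseteq> U0" "emeasure lborel (U0 - N) < \<delta>"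
        using outer_regular_lborel[OF Nb \<open>0 < \<delta>\<close>] .
      define U where "U = U0 \<inter> {- real n<..<real n}"
      have U: "open U" "bounded U" "N \<subseteq> U"
        using U0 bd by (auto simp: U_def intro!: bounded_Int)
      have "emeasure lborel U \<le> emeasure lborel ((U0 - N) \<union> N)"
        using U0(1) Nb by (intro emeasure_mono) (auto simp: U_def)
      also have "\<dots> \<le> emeasure lborel (U0 - N) + emeasure lborel N"
        using U0(1) Nb by (intro emeasure_subadditive) auto
      also have "\<dots> < \<delta>" using U0(3) N by (simp add: null_setsD1)
      finally have emU: "emeasure lborel U < \<delta>" .
      have Ufm: "U \<in> fmeasurable lborel"
        using U emU by (intro fmeasurableI) (auto intro: less_trans)
      have mU: "measure lborel U < \<delta>"
        using emU \<open>0 < \<delta>\<close> by (simp add: emeasure_eq_measure2[OF Ufm] ennreal_less_iff)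
      have C: "C = {Inf C<..<Sup C}" "Inf C < Sup C" if "C \<in> components U" for C
      proof -
        show *: "C = {Inf C<..<Sup C}" by (rule bounded_open_component_eq_interval[OF U(1,2) that])
        show "Inf C < Sup C" using * in_components_nonempty[OF that] by (metis greaterThanLessThan_empty_iff not_le)
      qed
      have open_C: "open C" if "C \<in> components U" for C using C(1)[OF that] by (metis open_greaterThanLessThan)
      have disj: "C \<inter> D = {}" if "C \<in> components U" "D \<in> components U" "C \<noteq> D" for C D
        using components_nonoverlap[OF that(1,2)] that(3) by blast
      have count: "countable (components U)"
        by (rule countable_disjoint_open_subsets) (auto simp: open_C disjoint_def disj)
      have Cfm: "C \<in> fmeasurable ?\<mu>" and mC: "measure ?\<mu> C \<le> G (Sup C) - G (Inf C)" if "C \<in> components U" for C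
      proof -
        have sub: "C \<subseteq> {Inf C<..Sup C}" by (subst C(1)[OF that]) auto
        have em: "emeasure ?\<mu> {Inf C<..Sup C} = ennreal (G (Sup C) - G (Inf C))"
          using C(2)[OF that] by (intro emeasure_interval_measure_Ioc monoG rc) simp
        have fm: "{Inf C<..Sup C} \<in> fmeasurable ?\<mu>" by (rule fmeasurableI) (auto simp: em)
        show "C \<in> fmeasurable ?\<mu>"
          using open_C[OF that] by (intro fmeasurableI2[OF fm sub]) auto
        have "measure ?\<mu> C \<le> measure ?\<mu> {Inf C<..Sup C}"
          using open_C[OF that] by (intro measure_mono_fmeasurable sub fm) auto
        also have "\<dots> = G (Sup C) - G (Inf C)"
          using C(2)[OF that] by (intro measure_interval_measure_Ioc monoG rc) simp
        finally show "measure ?\<mu> C \<le> G (Sup C) - G (Inf C)" .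
      qed
      have bound: "measure ?\<mu> (\<Union>C\<in>J. C) \<le> \<epsilon>" if J: "finite J" "J \<subseteq> components U" for J
      proof -
        \<comment> \<open>Clamping to [a,b] is monotone and contracts lengths, so the clamped
          components still do not overlap and are no longer than before; \<open>G\<close> is
          \<open>F\<close> composed with this map.\<close>
        define c where "c x = max a (min b x)" for x
        have c_bd: "a \<le> c x" "c x \<le> b" for x using \<open>a \<le> b\<close> by (auto simp: c_def)
        have c_mono: "x \<le> y \<Longrightarrow> c x \<le> c y" and c_lip: "x \<le> y \<Longrightarrow> c y - c x \<le> y - x" for x y
          using \<open>a \<le> b\<close> by (auto simp: c_def min_def max_def)
        have c_in: "x \<in> {p<..<q}" if "x \<in> {c p<..<c q}" for x p q
          using that by (auto simp: c_def max_def min_def split: if_splits)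
        have no: "nonoverlapping a b J (\<lambda>C. c (Inf C)) (\<lambda>C. c (Sup C))"
          unfolding nonoverlapping_def disjoint_family_on_def
        proof (intro conjI ballI impI J(1) c_bd)
          fix C assume CJ: "C \<in> J"
          then show "c (Inf C) \<le> c (Sup C)" using J C(2) by (intro c_mono) (auto intro: less_imp_le)
          fix D assume "D \<in> J" "C \<noteq> D"
          then have "C \<inter> D = {}" using CJ J(2) disj by blast
          moreover have "{c (Inf C)<..<c (Sup C)} \<subseteq> C" using c_in C(1) CJ J(2) by blast
          moreover have "{c (Inf D)<..<c (Sup D)} \<subseteq> D" using c_in C(1) \<open>D \<in> J\<close> J(2) by blast
          ultimately show "{c (Inf C)<..<c (Sup C)} \<inter> {c (Inf D)<..<c (Sup D)} = {}" by blast
        qed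
        have "(\<Sum>C\<in>J. c (Sup C) - c (Inf C)) \<le> (\<Sum>C\<in>J. measure lborel C)"
        proof (rule sum_mono)
          fix C assume "C \<in> J"
          then have CU: "C \<in> components U" using J by blast
          have "measure lborel C = Sup C - Inf C"
            using C(2)[OF CU] by (subst C(1)[OF CU]) simp
          then show "c (Sup C) - c (Inf C) \<le> measure lborel C" using c_lip C(2)[OF CU] by simp
        qed
        also have "\<dots> = measure lborel (\<Union>C\<in>J. C)"
        proof (rule measure_finite_Union[symmetric])
          show "finite J" by fact
          show "(\<lambda>C. C) ` J \<subseteq> sets lborel" using J open_C by auto
          show "disjoint_family_on (\<lambda>C. C) J" using J disj by (auto simp: disjoint_family_on_def)
          show "emeasure lborel C \<noteq> \<infinity>" if "C \<in> J" for C
          proof -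
            have "C \<in> components U" using that J by blast
            then have "C = {Inf C<..<Sup C}" "Inf C \<le> Sup C" using C[of C] by auto
            then show ?thesis by (metis emeasure_lborel_Ioo ennreal_neq_top infinity_ennreal_def)
          qed
        qed
        also have "\<dots> \<le> measure lborel U"
        proof (rule measure_mono_fmeasurable[OF _ _ Ufm])
          show "(\<Union>C\<in>J. C) \<subseteq> U" using J(2) in_components_subset by blast
          show "(\<Union>C\<in>J. C) \<in> sets lborel" using J open_C by (intro sets.finite_UN) auto
        qed
        finally have "(\<Sum>C\<in>J. c (Sup C) - c (Inf C)) < \<delta>" using mU by simp
        from \<delta>[OF no this] have "(\<Sum>C\<in>J. \<bar>G (Sup C) - G (Inf C)\<bar>) < \<epsilon>" by (simp add: G_def c_def)
        moreover have "measure ?\<mu> (\<Union>C\<in>J. C) \<le> (\<Sum>C\<in>J. measure ?\<mu> C)"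
          using J(2) Cfm by (intro measure_UNION_le J(1) fmeasurableD) blast
        moreover have "(\<Sum>C\<in>J. measure ?\<mu> C) \<le> (\<Sum>C\<in>J. \<bar>G (Sup C) - G (Inf C)\<bar>)"
          using J mC by (intro sum_mono) (meson abs_ge_self order_trans subsetD)
        ultimately show ?thesis by linarith
      qed
      have UU: "(\<Union>C\<in>components U. C) = U" using Union_components[of U] by simp
      have "U \<in> fmeasurable ?\<mu>"
        using fmeasurable_UN_bound[OF count, of "\<lambda>C. C" ?\<mu> \<epsilon>] Cfm bound by (simp only: UU)
      moreover have "measure ?\<mu> U \<le> \<epsilon>"
        using measure_UN_bound[OF count, of "\<lambda>C. C" ?\<mu> \<epsilon>] Cfm bound by (simp only: UU)
      ultimately have "emeasure ?\<mu> U \<le> \<epsilon>" by (simp add: emeasure_eq_measure2 ennreal_leI)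
      moreover have "emeasure ?\<mu> N \<le> emeasure ?\<mu> U" using U by (intro emeasure_mono) auto
      ultimately show ?thesis by simp
    qed
    have "emeasure ?\<mu> N \<le> 0" by (rule ennreal_le_epsilon) (rule *)
    then show ?thesis by simp
  qed
  show "absolutely_continuous lborel ?\<mu>"
    unfolding absolutely_continuous_def
  proof
    fix N :: "real set" assume N: "N \<in> null_sets lborel"
    have "(\<Union>n. N \<inter> {- real n<..<real n}) \<in> null_sets ?\<mu>"
    proof (rule null_sets_UN)
      fix n
      have "N \<inter> {- real n<..<real n} \<in> null_sets lborel" using N by (rule null_set_Int2) auto
      then show "N \<inter> {- real n<..<real n} \<in> null_sets ?\<mu>"
        using null_bounded[of "N \<inter> {- real n<..<real n}" n] by (auto intro!: null_setsI)
    qed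
    moreover have "N = (\<Union>n. N \<inter> {- real n<..<real n})"
    proof -
      have "\<exists>n. - real n < x \<and> x < real n" for x
      proof -
        obtain n where "\<bar>x\<bar> < real n" using reals_Archimedean2 by blast
        then have "- real n < x \<and> x < real n" by linarith
        then show ?thesis by blast
      qed
      then show ?thesis by auto
    qed
    ultimately show "N \<in> null_sets ?\<mu>" by simp
  qed
qed

text \<open>The Radon-Nikodym density takes values in \<open>ennreal\<close>. Its integral over
  [a,b] is F b - F a, so it is finite almost everywhere there, and \<open>enn2real\<close> preserves
  its integrals over subintervals.\<close>

lemma monotone_AC_eq_integral:
  fixes F :: "real \<Rightarrow> real"
  assumes F: "F \<in> AC a b" and mono: "\<And>x y. a \<le> x \<Longrightarrow> x \<le> y \<Longrightarrow> y \<le> b \<Longrightarrow> F x \<le> F y" and "a \<le> b"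
  obtains g where "g absolutely_integrable_on {a..b}"
    "\<And>x y. a \<le> x \<Longrightarrow> x \<le> y \<Longrightarrow> y \<le> b \<Longrightarrow> (g has_integral F y - F x) {x..y}"
proof -
  define G where "G = (\<lambda>x. F (max a (min b x)))"
  have G: "continuous_on UNIV G" "mono G" "absolutely_continuous lborel (interval_measure G)"
    unfolding G_def by (rule monotone_AC_interval_measure_absolutely_continuous[OF F mono \<open>a \<le> b\<close>]; assumption)+
  obtain f where f: "f \<in> borel_measurable lborel" "density lborel f = interval_measure G"
    using sigma_finite_measure.Radon_Nikodym[OF sigma_finite_lborel G(3)] by auto
  have eq: "(\<integral>\<^sup>+ z. f z * indicator {x..y} z \<partial>lborel) = ennreal (F y - F x)" if "a \<le> x" "x \<le> y" "y \<le> b" for x y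
  proof -
    have "(\<integral>\<^sup>+ z. f z * indicator {x..y} z \<partial>lborel) = emeasure (density lborel f) {x..y}"
      by (rule emeasure_density[symmetric]) (use f(1) in auto)
    also have "\<dots> = ennreal (G y - G x)"
      unfolding f(2) using G that by (intro emeasure_interval_measure_Icc) (auto dest: monoD)
    finally show ?thesis using that by (simp add: G_def)
  qed
  have "(\<integral>\<^sup>+ z. f z * indicator {a..b} z \<partial>lborel) \<noteq> \<infinity>"
    using eq[of a b] \<open>a \<le> b\<close> by simp
  then have fin: "AE z in lborel. f z * indicator {a..b} z \<noteq> \<infinity>"
    using f by (intro nn_integral_noteq_infinite) auto
  define g where "g z = enn2real (f z)" for z
  have int: "(g has_integral F y - F x) {x..y}" if xy: "a \<le> x" "x \<le> y" "y \<le> b" for x y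
  proof -
    have "((\<lambda>z. g z * indicator {x..y} z) has_integral F y - F x) UNIV"
    proof (rule nn_integral_has_integral)
      have "f \<in> borel_measurable borel" using f(1) by simp
      then show "(\<lambda>z. g z * indicator {x..y} z) \<in> borel_measurable borel" unfolding g_def by measurable
      show "0 \<le> g z * indicator {x..y} z" for z by (simp add: g_def)
      show "0 \<le> F y - F x" using mono[OF xy] by simp
      have "(\<integral>\<^sup>+ z. ennreal (g z * indicator {x..y} z) \<partial>lborel) = (\<integral>\<^sup>+ z. f z * indicator {x..y} z \<partial>lborel)"
        using fin by (intro nn_integral_cong_AE) (use xy in \<open>auto simp: g_def indicator_def less_top elim!: eventually_mono\<close>)
      then show "(\<integral>\<^sup>+ z. ennreal (g z * indicator {x..y} z) \<partial>lborel) = ennreal (F y - F x)"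
        using eq[OF xy] by simp
    qed
    moreover have "(\<lambda>z. g z * indicator {x..y} z) = (\<lambda>z. if z \<in> {x..y} then g z else 0)" by (auto simp: indicator_def)
    ultimately show ?thesis by (simp only: has_integral_restrict_UNIV)
  qed
  show thesis
  proof
    show "g absolutely_integrable_on {a..b}"
      using int[of a b] \<open>a \<le> b\<close> by (intro nonnegative_absolutely_integrable_1) (auto simp: g_def integrable_on_def)
  qed (use int in blast)
qed

text \<open>\<open>v\<close> is its total variation minus the nondecreasing difference of the
  variation and \<open>v\<close>; both are indefinite integrals. Lebesgue differentiation identifies
  the difference of the densities with \<open>deriv v\<close> off a null set. The endpoints are
  added to it, since the values of \<open>v\<close> outside [a,b] are arbitrary and
  \<open>deriv\<close> looks at both sides.\<close>

theorem AC_fundamental_theorem: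
  assumes v: "v \<in> AC a b" and "a \<le> b"
  shows "deriv v absolutely_integrable_on {a..b}"
    and "a \<le> x \<Longrightarrow> x \<le> y \<Longrightarrow> y \<le> b \<Longrightarrow> (deriv v has_integral v y - v x) {x..y}"
    and "\<exists>N. negligible N \<and> (\<forall>x\<in>{a<..<b} - N. (v has_real_derivative deriv v x) (at x))"
proof -
  let ?V = "total_variation v a"
  have inc: "\<bar>v y - v x\<bar> \<le> ?V y - ?V x" if "a \<le> x" "x \<le> y" "y \<le> b" for x y
    using total_variation_ge[OF v that variation_sums_increment[OF that(2)]] by simp
  obtain g1 where g1: "g1 absolutely_integrable_on {a..b}"
    "\<And>x y. a \<le> x \<Longrightarrow> x \<le> y \<Longrightarrow> y \<le> b \<Longrightarrow> (g1 has_integral ?V y - ?V x) {x..y}"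
  proof (rule monotone_AC_eq_integral[OF AC_total_variation[OF v] _ \<open>a \<le> b\<close>])
    show "?V x \<le> ?V y" if "a \<le> x" "x \<le> y" "y \<le> b" for x y using inc[OF that] by simp
  qed blast
  obtain g2 where g2: "g2 absolutely_integrable_on {a..b}"
    "\<And>x y. a \<le> x \<Longrightarrow> x \<le> y \<Longrightarrow> y \<le> b \<Longrightarrow> (g2 has_integral (?V y - v y) - (?V x - v x)) {x..y}"
  proof (rule monotone_AC_eq_integral[OF AC_diff[OF AC_total_variation[OF v] v] _ \<open>a \<le> b\<close>])
    show "?V x - v x \<le> ?V y - v y" if "a \<le> x" "x \<le> y" "y \<le> b" for x y using inc[OF that] by simp
  qed blast
  define g where "g x = g1 x - g2 x" for x
  have g: "g absolutely_integrable_on {a..b}" unfolding g_def by (rule set_integral_diff(1)[OF g1(1) g2(1)])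
  have gi: "(g has_integral v y - v x) {x..y}" if "a \<le> x" "x \<le> y" "y \<le> b" for x y
    unfolding g_def using has_integral_diff[OF g1(2)[OF that] g2(2)[OF that]] by simp
  obtain N where N: "negligible N"
    "\<forall>x\<in>{a<..<b} - N. ((\<lambda>y. integral {a..y} g) has_real_derivative g x) (at x)"
    using lebesgue_differentiation[OF set_lebesgue_integral_eq_integral(1)[OF g]] .
  have der: "(v has_real_derivative g x) (at x)" if x: "x \<in> {a<..<b} - N" for x
  proof -
    have "((\<lambda>y. v a + integral {a..y} g) has_real_derivative g x) (at x)"
      by (rule derivative_eq_intros N(2)[rule_format, OF x] refl | simp)+
    then show ?thesis
    proof (rule has_field_derivative_transform_within_open)
      show "open {a<..<b}" "x \<in> {a<..<b}" using x by auto
      show "v a + integral {a..y} g = v y" if "y \<in> {a<..<b}" for y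
        using integral_unique[OF gi[of a y]] that by simp
    qed
  qed
  have N': "negligible (N \<union> {a, b})" using N(1) by (simp add: negligible_Un)
  have eq: "deriv v x = g x" if "x \<in> {a..b} - (N \<union> {a, b})" for x
    using that by (intro DERIV_imp_deriv der) auto
  show "deriv v absolutely_integrable_on {a..b}"
    by (rule absolutely_integrable_spike[OF g N' eq])
  show "(deriv v has_integral v y - v x) {x..y}" if "a \<le> x" "x \<le> y" "y \<le> b"
    using that by (intro has_integral_spike[OF N' _ gi] eq) auto
  have "(v has_real_derivative deriv v x) (at x)" if x: "x \<in> {a<..<b} - N" for x
    using der[OF x] DERIV_imp_deriv by metis
  then show "\<exists>N. negligible N \<and> (\<forall>x\<in>{a<..<b} - N. (v has_real_derivative deriv v x) (at x))"
    using N(1) by blast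
qed

section \<open>Smooth bumps\<close>

text \<open>With y = 1/x these are the functions P(y) exp(-y), continued by 0. Differentiation
  replaces P by y^2 (P - P'), so the class is closed under derivatives and smoothness of all orders
  rests on one computation.\<close>

definition flat :: "real poly \<Rightarrow> real \<Rightarrow> real"
  where "flat P x = (if 0 < x then poly P (1 / x) * exp (- (1 / x)) else 0)"

text \<open>The extra power \<open>k\<close> carries the induction over the coefficients: it absorbs
  the shift of degree in \<open>pCons\<close>.\<close>

lemma power_times_poly_times_exp_tendsto_0: "((\<lambda>y. y ^ k * poly P y * exp (- y)) \<longlongrightarrow> (0::real)) at_top"
proof (induction P arbitrary: k)
  case 0
  then show ?case by simp
next
  case (pCons a P)
  have "((\<lambda>y. a * (y ^ k / exp y) + y ^ Suc k * poly P y * exp (- y)) \<longlongrightarrow> a * 0 + 0) at_top"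
    by (intro tendsto_intros tendsto_power_div_exp_0 pCons)
  then show ?case by (simp add: exp_minus field_simps)
qed

text \<open>At 0 the right difference quotient is y P(y) exp(-y) with y = 1/h, which tends to 0 as y
  grows.\<close>

lemma flat_has_derivative:
  "(flat P has_real_derivative flat (monom 1 2 * (P - pderiv P)) x) (at x)"
proof -
  consider "x < 0" | "0 < x" | "x = 0" by linarith
  then show ?thesis
  proof cases
    case 1
    then have "flat (monom 1 2 * (P - pderiv P)) x = 0" by (simp add: flat_def)
    moreover have "(flat P has_real_derivative 0) (at x)"
      by (rule has_field_derivative_transform_within_open[of "\<lambda>_. 0" _ _ "{..<0}"]) (use 1 in \<open>auto simp: flat_def\<close>)
    ultimately show ?thesis by simp
  next
    case 2
    have "((\<lambda>x. poly P (1 / x) * exp (- (1 / x))) has_real_derivative flat (monom 1 2 * (P - pderiv P)) x) (at x)"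
      using 2 by (auto intro!: derivative_eq_intros poly_DERIV[THEN DERIV_chain2]
        simp: flat_def poly_monom field_simps power2_eq_square)
    then show ?thesis
      by (rule has_field_derivative_transform_within_open[of _ _ _ "{0<..}"]) (use 2 in \<open>auto simp: flat_def\<close>)
  next
    case 3
    have "((\<lambda>h. flat P h / h) \<longlongrightarrow> 0) (at 0)"
    proof (rule filterlim_split_at)
      have "\<forall>\<^sub>F h in at_left 0. flat P h / h = 0"
        by (auto simp: flat_def eventually_at_left_field intro!: exI[of _ "-1"])
      then show "((\<lambda>h. flat P h / h) \<longlongrightarrow> 0) (at_left 0)" by (rule tendsto_eventually)
      have "((\<lambda>h. inverse h ^ 1 * poly P (inverse h) * exp (- inverse h)) \<longlongrightarrow> 0) (at_right 0)"
        by (rule filterlim_compose[OF power_times_poly_times_exp_tendsto_0 filterlim_inverse_at_top_right])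
      moreover have "\<forall>\<^sub>F h in at_right 0. inverse h ^ 1 * poly P (inverse h) * exp (- inverse h) = flat P h / h"
        unfolding eventually_at_right_field by (intro exI[of _ 1]) (auto simp: flat_def field_simps)
      ultimately show "((\<lambda>h. flat P h / h) \<longlongrightarrow> 0) (at_right 0)" by (rule Lim_transform_eventually)
    qed
    then show ?thesis using 3 by (simp add: DERIV_def flat_def)
  qed
qed

text \<open>A family closed under differentiation that contains the bumps and their differences.
  Closedness takes the place of a formula for the n-th derivative of a product.\<close>

inductive_set bump_span :: "(real \<Rightarrow> real) set" where
  product: "(\<lambda>x. flat P (c * (x - s)) * flat Q (c * (t - x))) \<in> bump_span"
| add: "f \<in> bump_span \<Longrightarrow> g \<in> bump_span \<Longrightarrow> (\<lambda>x. f x + g x) \<in> bump_span"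
| uminus: "f \<in> bump_span \<Longrightarrow> (\<lambda>x. - f x) \<in> bump_span"

lemma bump_span_has_derivative:
  "f \<in> bump_span \<Longrightarrow> \<exists>f'\<in>bump_span. \<forall>x. (f has_real_derivative f' x) (at x)"
proof (induction rule: bump_span.induct)
  case (product P c s Q t)
  let ?D = "\<lambda>P. monom 1 2 * (P - pderiv P)"
  have s: "flat (smult r P) y = r * flat P y" for r P y by (simp add: flat_def)
  show ?case
  proof (intro bexI allI)
    show "((\<lambda>x. flat P (c * (x - s)) * flat Q (c * (t - x))) has_real_derivative
      flat (smult c (?D P)) (c * (x - s)) * flat Q (c * (t - x)) + flat P (c * (x - s)) * flat (smult (- c) (?D Q)) (c * (t - x))) (at x)" for x
      unfolding s by (auto intro!: derivative_eq_intros flat_has_derivative[THEN DERIV_chain2])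
  qed (intro bump_span.intros)
next
  case (add f g)
  then obtain f' g' where "f' \<in> bump_span" "g' \<in> bump_span"
    "\<forall>x. (f has_real_derivative f' x) (at x)" "\<forall>x. (g has_real_derivative g' x) (at x)" by blast
  then show ?case by (intro bexI[of _ "\<lambda>x. f' x + g' x"]) (auto intro!: derivative_eq_intros bump_span.add)
next
  case (uminus f)
  then obtain f' where "f' \<in> bump_span" "\<forall>x. (f has_real_derivative f' x) (at x)" by blast
  then show ?case by (intro bexI[of _ "\<lambda>x. - f' x"]) (auto intro!: derivative_eq_intros bump_span.uminus)
qed

text \<open>Adding one primitive to the span keeps it closed under \<open>deriv\<close>, so all
  iterated derivatives stay inside and are differentiable.\<close>

lemma primitive_of_bump_span_smooth:
  assumes \<rho>: "\<rho> \<in> bump_span" and \<Phi>: "\<And>x. (\<Phi> has_real_derivative \<rho> x) (at x)"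
  shows "(deriv ^^ n) \<Phi> differentiable (at x)"
proof -
  have d: "\<exists>f'\<in>insert \<Phi> bump_span. \<forall>x. (f has_real_derivative f' x) (at x)" if "f \<in> insert \<Phi> bump_span" for f
    using that \<rho> \<Phi> bump_span_has_derivative by blast
  have "deriv f \<in> insert \<Phi> bump_span" if f: "f \<in> insert \<Phi> bump_span" for f
  proof -
    obtain f' where f': "f' \<in> insert \<Phi> bump_span" "\<And>x. (f has_real_derivative f' x) (at x)"
      using d[OF f] by blast
    have "deriv f = f'" using DERIV_imp_deriv[OF f'(2)] by (rule ext)
    then show ?thesis using f'(1) by simp
  qed
  then have "(deriv ^^ n) \<Phi> \<in> insert \<Phi> bump_span" by (induction n) auto
  from d[OF this] show ?thesis using real_differentiable_def by blast
qed

text \<open>The factor \<open>n\<close> stretches the two flat functions, so that both tend to 1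
  inside (s,t): a smooth approximation of the indicator from below that vanishes outside (s,t) for
  every \<open>n\<close>.\<close>

definition bump :: "real \<Rightarrow> real \<Rightarrow> nat \<Rightarrow> real \<Rightarrow> real"
  where "bump s t n x = flat 1 (real n * (x - s)) * flat 1 (real n * (t - x))"

lemma bump_bounds: "0 \<le> bump s t n x" "bump s t n x \<le> 1"
  by (auto simp: bump_def flat_def mult_le_one)

lemma bump_outside: "x \<le> s \<or> t \<le> x \<Longrightarrow> bump s t n x = 0"
  by (auto simp: bump_def flat_def mult_le_0_iff not_less zero_less_mult_iff)

lemma bump_tendsto: "(\<lambda>n. bump s t n x) \<longlonglongrightarrow> indicator {s<..<t} x"
proof (cases "x \<in> {s<..<t}")
  case True
  have "(\<lambda>n. exp (- (inverse (real n) * (1 / (x - s)))) * exp (- (inverse (real n) * (1 / (t - x)))))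
      \<longlonglongrightarrow> exp (- (0 * (1 / (x - s)))) * exp (- (0 * (1 / (t - x))))"
    by (intro tendsto_intros LIMSEQ_inverse_real_of_nat lim_inverse_n)
  then have "(\<lambda>n. exp (- (inverse (real n) * (1 / (x - s)))) * exp (- (inverse (real n) * (1 / (t - x))))) \<longlonglongrightarrow> 1"
    by simp
  moreover have "\<forall>\<^sub>F n in sequentially. exp (- (inverse (real n) * (1 / (x - s)))) * exp (- (inverse (real n) * (1 / (t - x)))) = bump s t n x"
    unfolding eventually_sequentially
    by (intro exI[of _ 1]) (use True in \<open>auto simp: bump_def flat_def field_simps\<close>)
  ultimately have "(\<lambda>n. bump s t n x) \<longlonglongrightarrow> 1" by (rule Lim_transform_eventually)
  then show ?thesis using True by simp
next
  case False
  then show ?thesis using bump_outside[of x s t] by (auto simp: not_less)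
qed

lemma bump_in_bump_span: "bump s t n \<in> bump_span"
  unfolding bump_def by (rule bump_span.product)

lemma bump_continuous_on: "continuous_on S (bump s t n)"
  using bump_span_has_derivative[OF bump_in_bump_span] DERIV_isCont continuous_at_imp_continuous_on by metis

lemma bump_translate: "bump s t n (x - \<tau>) = bump (s + \<tau>) (t + \<tau>) n x"
  by (simp add: bump_def algebra_simps)

lemma integral_eq_zero: "(\<And>x. x \<in> S \<Longrightarrow> f x = 0) \<Longrightarrow> integral S f = (0 :: real)" for S :: "real set"
  by (subst integral_cong[of S f "\<lambda>_. 0"]) auto

text \<open>Starting at \<open>s - 1\<close> makes \<open>s\<close> an interior point of the
  interval of integration, so the derivative obtained at \<open>s\<close> is two-sided.\<close>

definition bump_primitive :: "real \<Rightarrow> real \<Rightarrow> nat \<Rightarrow> real \<Rightarrow> real"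
  where "bump_primitive s t n x = integral {s - 1..x} (bump s t n)"

lemma bump_primitive_has_derivative: "(bump_primitive s t n has_real_derivative bump s t n x) (at x)"
proof (cases "x < s")
  case True
  have "bump_primitive s t n y = 0" if "y < s" for y
    unfolding bump_primitive_def using that by (intro integral_eq_zero) (auto simp: bump_outside)
  note zero = this
  have "(bump_primitive s t n has_real_derivative 0) (at x)"
    by (rule has_field_derivative_transform_within_open[of "\<lambda>_. 0" _ _ "{..<s}"]) (use True in \<open>simp_all add: zero\<close>)
  then show ?thesis using True by (simp add: bump_outside)
next
  case False
  have "((\<lambda>y. integral {s - 1..y} (bump s t n)) has_real_derivative bump s t n x) (at x within {s - 1..x + 1})"
    using False by (intro integral_has_real_derivative bump_continuous_on) auto
  moreover have "at x within {s - 1..x + 1} = at x"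
    using False by (intro at_within_interior) (auto simp: interior_atLeastAtMost_real)
  ultimately show ?thesis by (simp add: bump_primitive_def[abs_def])
qed

lemma bump_primitive_below: "x \<le> s \<Longrightarrow> bump_primitive s t n x = 0"
  unfolding bump_primitive_def by (intro integral_eq_zero) (auto simp: bump_outside)

lemma bump_integrable: "bump s t n integrable_on {p..q}"
  by (intro integrable_continuous_real bump_continuous_on)

lemma bump_primitive_above:
  assumes "s \<le> t" "t \<le> x" shows "bump_primitive s t n x = bump_primitive s t n t"
proof -
  have "integral {s - 1..t} (bump s t n) + integral {t..x} (bump s t n) = integral {s - 1..x} (bump s t n)"
    using assms by (intro Henstock_Kurzweil_Integration.integral_combine bump_integrable) auto
  moreover have "integral {t..x} (bump s t n) = 0"
    by (intro integral_eq_zero) (auto simp: bump_outside)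
  ultimately show ?thesis by (simp add: bump_primitive_def)
qed

lemma bump_primitive_bounds:
  assumes "s \<le> t" shows "0 \<le> bump_primitive s t n x" "bump_primitive s t n x \<le> t - s"
proof -
  show "0 \<le> bump_primitive s t n x"
    unfolding bump_primitive_def by (intro integral_nonneg bump_integrable bump_bounds)
  have le: "bump_primitive s t n y \<le> t - s" if "s \<le> y" "y \<le> t" for y
  proof -
    have "integral {s - 1..s} (bump s t n) + integral {s..y} (bump s t n) = integral {s - 1..y} (bump s t n)"
      using that by (intro Henstock_Kurzweil_Integration.integral_combine bump_integrable) auto
    moreover have "integral {s - 1..s} (bump s t n) = 0" by (intro integral_eq_zero) (auto simp: bump_outside)
    moreover have "integral {s..y} (bump s t n) \<le> integral {s..y} (\<lambda>_. 1)"
      by (intro integral_le bump_integrable bump_bounds) auto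
    ultimately show ?thesis using that by (simp add: bump_primitive_def)
  qed
  show "bump_primitive s t n x \<le> t - s"
    using le[of x] le[of t] bump_primitive_above[OF assms, of x n] bump_primitive_below[of x s t n] assms by force
qed

lemma bump_primitive_tendsto:
  assumes "s \<le> t"
  shows "(\<lambda>n. bump_primitive s t n x) \<longlonglongrightarrow> max 0 (min (t - s) (x - s))"
proof -
  have lim: "(\<lambda>n. bump_primitive s t n y) \<longlonglongrightarrow> y - s" if y: "s \<le> y" "y \<le> t" for y
  proof -
    have "(\<lambda>n. integral {s - 1..y} (bump s t n)) \<longlonglongrightarrow> integral {s - 1..y} (indicator {s<..<t})"
    proof (rule dominated_convergence(2))
      show "bump s t n integrable_on {s - 1..y}" for n by (rule bump_integrable)
      show "(\<lambda>_. 1 :: real) integrable_on {s - 1..y}" by (intro integrable_continuous_real continuous_on_const)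
      show "norm (bump s t n z) \<le> 1" for n z using bump_bounds[of s t n z] by simp
      show "(\<lambda>n. bump s t n z) \<longlonglongrightarrow> indicator {s<..<t} z" for z by (rule bump_tendsto)
    qed
    also have "integral {s - 1..y} (indicator {s<..<t}) = integral {s - 1..y} (\<lambda>z. if z \<in> {s..y} then 1 else 0 :: real)"
      by (rule integral_spike[of "{s, t}"]) (use y in \<open>auto simp: indicator_def\<close>)
    also have "\<dots> = integral {s..y} (\<lambda>_. 1 :: real)"
      using y by (subst Henstock_Kurzweil_Integration.integral_restrict_Int) (simp add: Int_absorb1)
    also have "\<dots> = y - s" using y by simp
    finally show ?thesis by (simp add: bump_primitive_def)
  qed
  consider "x \<le> s" | "s \<le> x" "x \<le> t" | "t \<le> x" using assms by linarith
  then show ?thesis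
  proof cases
    case 1
    then have "max 0 (min (t - s) (x - s)) = 0" by auto
    then show ?thesis by (simp add: bump_primitive_below[OF 1])
  next
    case 2
    then have "max 0 (min (t - s) (x - s)) = x - s" by auto
    then show ?thesis using lim[OF 2] by simp
  next
    case 3
    then have "max 0 (min (t - s) (x - s)) = t - s" using assms by auto
    then show ?thesis using lim[of t] assms by (simp add: bump_primitive_above[OF assms 3])
  qed
qed

section \<open>Weak derivatives on open subsets of the line\<close>

text \<open>The working form of a weak derivative on an open set, by
  \<open>has_weak_derivative_iff_ae_primitive\<close>. The null set makes it stable under changes of
  \<open>u\<close> on null sets, and only points joined by a segment inside \<open>U\<close> are
  compared.\<close>

definition ae_primitive_on :: "real set \<Rightarrow> (real \<Rightarrow> real) \<Rightarrow> (real \<Rightarrow> real) \<Rightarrow> bool"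
  where "ae_primitive_on U u g \<longleftrightarrow> (\<exists>N. negligible N \<and>
    (\<forall>x y. x \<notin> N \<longrightarrow> y \<notin> N \<longrightarrow> x \<le> y \<longrightarrow> {x..y} \<subseteq> U \<longrightarrow> u y - u x = integral {x..y} g))"

lemma locally_integrable_on_Icc:
  "f locally_integrable_on U \<Longrightarrow> {x..y} \<subseteq> U \<Longrightarrow> f absolutely_integrable_on {x..y}"
  by (auto simp: locally_integrable_on_def)

lemma locally_integrable_on_imp_integrable:
  "f locally_integrable_on U \<Longrightarrow> {x..y} \<subseteq> U \<Longrightarrow> f integrable_on {x..y}"
  using locally_integrable_on_Icc set_lebesgue_integral_eq_integral(1) by blast

lemma absolutely_integrable_times_continuous:
  fixes f h :: "real \<Rightarrow> real"
  assumes "f absolutely_integrable_on K" "compact K" "continuous_on K h"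
  shows "(\<lambda>x. f x * h x) absolutely_integrable_on K"
proof -
  have "(\<lambda>x. h x * f x) absolutely_integrable_on K"
  proof (rule absolutely_integrable_bounded_measurable_product_real)
    show "h \<in> borel_measurable (lebesgue_on K)"
      using assms by (intro continuous_imp_measurable_on_sets_lebesgue) (auto intro: lmeasurable_compact fmeasurableD)
    show "bounded (h ` K)" using assms by (intro compact_imp_bounded compact_continuous_image)
  qed (use assms in \<open>auto intro: lmeasurable_compact fmeasurableD\<close>)
  then show ?thesis by (simp add: mult.commute)
qed

lemma set_integral_against_test_function:
  assumes f: "f locally_integrable_on U" and K: "compact K" "K \<subseteq> U" and h: "continuous_on K h"
    and 0: "\<And>x. x \<notin> K \<Longrightarrow> h x = 0"
  shows "(LINT x:U|lebesgue. f x * h x) = integral K (\<lambda>x. f x * h x)"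
proof -
  have "(LINT x:U|lebesgue. f x * h x) = (LINT x:K|lebesgue. f x * h x)"
    unfolding set_lebesgue_integral_def
    by (intro Bochner_Integration.integral_cong refl) (use assms in \<open>auto simp: indicator_def\<close>)
  also have "\<dots> = integral K (\<lambda>x. f x * h x)"
    using f K by (intro set_lebesgue_integral_eq_integral absolutely_integrable_times_continuous h)
      (auto simp: locally_integrable_on_def)
  finally show ?thesis .
qed

text \<open>The limit of testing with smooth trapezoids that rise on [x,x+h] and fall on [y,y+h]:
  their derivatives tend to the difference of two indicators, the trapezoids themselves to the
  difference of two ramps.\<close>

lemma weak_derivative_trapezoid:
  assumes wd: "has_weak_derivative U u g" and xy: "0 < h" "x + h \<le> y" "{x..y + h} \<subseteq> U"
  shows "integral {x..x + h} u - integral {y..y + h} u =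
    - integral {x..y + h} (\<lambda>z. g z * (max 0 (min h (z - x)) - max 0 (min h (z - y))))"
proof -
  have u: "u locally_integrable_on U" and g: "g locally_integrable_on U"
    and test: "\<And>\<phi>. test_function U \<phi> \<Longrightarrow> (LINT x:U|lebesgue. u x * deriv \<phi> x) = - (LINT x:U|lebesgue. g x * \<phi> x)"
    using wd by (auto simp: has_weak_derivative_def)
  have ui: "u absolutely_integrable_on {x..y + h}" and gi: "g absolutely_integrable_on {x..y + h}"
    using locally_integrable_on_Icc xy u g by blast+
  define \<rho> where "\<rho> n z = bump x (x + h) n z + - bump y (y + h) n z" for n z
  \<comment> \<open>Subtracting a translate by \<open>y - x\<close> makes the fall exactly as high
    as the rise, so that the function returns to 0 and has compact support.\<close>
  define \<Phi> where "\<Phi> n z = bump_primitive x (x + h) n z - bump_primitive x (x + h) n (z - (y - x))" for n z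
  have \<Phi>_deriv: "(\<Phi> n has_real_derivative \<rho> n z) (at z)" for n z
  proof -
    have "bump x (x + h) n (z - (y - x)) = bump y (y + h) n z" by (simp add: bump_translate add.commute)
    then show ?thesis unfolding \<Phi>_def[abs_def] \<rho>_def
      by (auto intro!: derivative_eq_intros bump_primitive_has_derivative[THEN DERIV_chain2] bump_primitive_has_derivative)
  qed
  have \<rho>_span: "\<rho> n \<in> bump_span" for n
    unfolding \<rho>_def[abs_def] by (intro bump_span.intros bump_in_bump_span)
  have \<Phi>_out: "\<Phi> n z = 0" if "z \<notin> {x..y + h}" for n z
  proof (cases "z < x")
    case True
    then show ?thesis using xy by (simp add: \<Phi>_def bump_primitive_below)
  next
    case False
    then have "y + h < z" using that by auto
    then show ?thesis using xy bump_primitive_above[of x "x + h" z n] bump_primitive_above[of x "x + h" "z - (y - x)" n]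
      by (simp add: \<Phi>_def)
  qed
  have \<rho>_out: "\<rho> n z = 0" if "z \<notin> {x..y + h}" for n z
    using that xy by (auto simp: \<rho>_def bump_outside)
  have \<Phi>_cont: "continuous_on S (\<Phi> n)" for S n
    by (intro continuous_at_imp_continuous_on ballI DERIV_isCont[OF \<Phi>_deriv])
  have \<rho>_cont: "continuous_on S (\<rho> n)" for S n
    unfolding \<rho>_def[abs_def] by (intro continuous_intros bump_continuous_on)
  have eq: "integral {x..y + h} (\<lambda>z. u z * \<rho> n z) = - integral {x..y + h} (\<lambda>z. g z * \<Phi> n z)" for n
  proof -
    have cl: "closure {z. \<Phi> n z \<noteq> 0} \<subseteq> {x..y + h}"
      using \<Phi>_out by (intro closure_minimal) blast+
    then have "compact (closure {z. \<Phi> n z \<noteq> 0})"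
      by (metis bounded_closed_interval bounded_subset closed_closure compact_eq_bounded_closed)
    then have "test_function U (\<Phi> n)"
      unfolding test_function_def using cl xy(3) primitive_of_bump_span_smooth[OF \<rho>_span \<Phi>_deriv] by blast
    from test[OF this] have "(LINT x:U|lebesgue. u x * \<rho> n x) = - (LINT x:U|lebesgue. g x * \<Phi> n x)"
      using DERIV_imp_deriv[OF \<Phi>_deriv] by simp
    moreover have "(LINT x:U|lebesgue. u x * \<rho> n x) = integral {x..y + h} (\<lambda>z. u z * \<rho> n z)"
      using \<rho>_out by (intro set_integral_against_test_function[OF u compact_Icc xy(3) \<rho>_cont]) blast
    moreover have "(LINT x:U|lebesgue. g x * \<Phi> n x) = integral {x..y + h} (\<lambda>z. g z * \<Phi> n z)"
      using \<Phi>_out by (intro set_integral_against_test_function[OF g compact_Icc xy(3) \<Phi>_cont]) blast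
    ultimately show ?thesis by simp
  qed
  have lim1: "(\<lambda>n. integral {x..y + h} (\<lambda>z. u z * \<rho> n z)) \<longlonglongrightarrow>
    integral {x..y + h} (\<lambda>z. u z * (indicator {x<..<x + h} z - indicator {y<..<y + h} z))"
  proof (rule dominated_convergence(2))
    show "(\<lambda>z. u z * \<rho> n z) integrable_on {x..y + h}" for n
      by (intro set_lebesgue_integral_eq_integral(1) absolutely_integrable_times_continuous ui \<rho>_cont) simp
    show "(\<lambda>z. \<bar>u z\<bar>) integrable_on {x..y + h}" using ui by (simp add: absolutely_integrable_on_def)
    have "\<bar>\<rho> n z\<bar> \<le> 1" for n z
      using bump_bounds[of x "x + h" n z] bump_bounds[of y "y + h" n z] by (simp add: \<rho>_def abs_le_iff)
    then show "norm (u z * \<rho> n z) \<le> \<bar>u z\<bar>" for n z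
      by (simp add: abs_mult mult_left_le)
    show "(\<lambda>n. u z * \<rho> n z) \<longlonglongrightarrow> u z * (indicator {x<..<x + h} z - indicator {y<..<y + h} z)" for z
      unfolding \<rho>_def add_uminus_conv_diff by (intro tendsto_intros bump_tendsto)
  qed
  have lim2: "(\<lambda>n. integral {x..y + h} (\<lambda>z. g z * \<Phi> n z)) \<longlonglongrightarrow>
    integral {x..y + h} (\<lambda>z. g z * (max 0 (min h (z - x)) - max 0 (min h (z - y))))"
  proof (rule dominated_convergence(2))
    show "(\<lambda>z. g z * \<Phi> n z) integrable_on {x..y + h}" for n
      by (intro set_lebesgue_integral_eq_integral(1) absolutely_integrable_times_continuous gi \<Phi>_cont) simp
    show "(\<lambda>z. \<bar>g z\<bar> * h) integrable_on {x..y + h}"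
      using gi by (intro integrable_on_mult_left) (simp add: absolutely_integrable_on_def)
    have "\<bar>\<Phi> n z\<bar> \<le> h" for n z
      using bump_primitive_bounds[of x "x + h" n z] bump_primitive_bounds[of x "x + h" n "z - (y - x)"] xy
      by (simp add: \<Phi>_def abs_le_iff)
    then show "norm (g z * \<Phi> n z) \<le> \<bar>g z\<bar> * h" for n z
      by (simp add: abs_mult mult_left_mono)
    show "(\<lambda>n. g z * \<Phi> n z) \<longlonglongrightarrow> g z * (max 0 (min h (z - x)) - max 0 (min h (z - y)))" for z
      unfolding \<Phi>_def
      using bump_primitive_tendsto[of x "x + h" z] bump_primitive_tendsto[of x "x + h" "z - (y - x)"] xy
      by (intro tendsto_intros) simp_all
  qed
  have "integral {x..y + h} (\<lambda>z. u z * (indicator {x<..<x + h} z - indicator {y<..<y + h} z)) =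
    - integral {x..y + h} (\<lambda>z. g z * (max 0 (min h (z - x)) - max 0 (min h (z - y))))"
    using LIMSEQ_unique[OF lim1] tendsto_minus[OF lim2] by (simp add: eq)
  moreover have "integral {x..y + h} (\<lambda>z. u z * (indicator {x<..<x + h} z - indicator {y<..<y + h} z))
    = integral {x..x + h} u - integral {y..y + h} u"
  proof -
    have i: "((\<lambda>z. if z \<in> {s<..<t} then u z else 0) has_integral integral {s..t} u) {x..y + h}"
      if "{s..t} \<subseteq> {x..y + h}" for s t
    proof -
      have "(u has_integral integral {s..t} u) {s..t}"
        using integrable_on_subinterval[OF set_lebesgue_integral_eq_integral(1)[OF ui] that] by (rule integrable_integral)
      then have "(u has_integral integral {s..t} u) {s<..<t}" using has_integral_Icc_iff_Ioo by blast
      moreover have "{s<..<t} \<subseteq> {x..y + h}" using that greaterThanLessThan_subseteq_atLeastAtMost_iff by fastforce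
      ultimately show ?thesis by (simp only: has_integral_restrict)
    qed
    have "((\<lambda>z. (if z \<in> {x<..<x + h} then u z else 0) - (if z \<in> {y<..<y + h} then u z else 0))
      has_integral integral {x..x + h} u - integral {y..y + h} u) {x..y + h}"
      using xy by (intro has_integral_diff i) auto
    moreover have "(\<lambda>z. (if z \<in> {x<..<x + h} then u z else 0) - (if z \<in> {y<..<y + h} then u z else 0))
      = (\<lambda>z. u z * (indicator {x<..<x + h} z - indicator {y<..<y + h} z))" by (auto simp: indicator_def)
    ultimately show ?thesis by (simp add: integral_unique)
  qed
  ultimately show ?thesis by simp
qed

text \<open>Lebesgue differentiation on the countably many rational intervals inside
  \<open>U\<close> gives one null set for all points, and intervals shrinking to a point are
  eventually inside a fixed rational interval around it.\<close>

lemma straddled_averages_tendsto: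
  assumes u: "u locally_integrable_on U" and "open U"
  obtains N where "negligible N"
    "\<forall>x s t. x \<in> U - N \<longrightarrow> (\<forall>n. s n \<le> x \<and> x \<le> t n \<and> s n < t n) \<longrightarrow> s \<longlonglongrightarrow> x \<longrightarrow> t \<longlonglongrightarrow> x
      \<longrightarrow> (\<lambda>n::nat. integral {s n..t n} u / (t n - s n)) \<longlonglongrightarrow> u x"
proof -
  have "\<exists>M. negligible M \<and> (\<forall>x\<in>{q<..<r} - M. ((\<lambda>y. integral {q..y} u) has_real_derivative u x) (at x))"
    if "{q..r} \<subseteq> U" for q r
    by (rule lebesgue_differentiation[OF locally_integrable_on_imp_integrable[OF u that]]) blast
  then obtain M where M: "\<And>q r. {q..r} \<subseteq> U \<Longrightarrow> negligible (M q r)"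
    "\<And>q r x. {q..r} \<subseteq> U \<Longrightarrow> x \<in> {q<..<r} - M q r \<Longrightarrow> ((\<lambda>y. integral {q..y} u) has_real_derivative u x) (at x)"
    by metis
  define N where "N = (\<Union>(q,r)\<in>{(q,r). q \<in> \<rat> \<and> r \<in> \<rat> \<and> {q..r} \<subseteq> U}. M q r)"
  show thesis
  proof
    show "negligible N"
      unfolding N_def
    proof (rule negligible_countable_Union)
      have "countable (\<rat> \<times> \<rat> :: (real \<times> real) set)" by (intro countable_SIGMA countable_rat)
      then have "countable {(q,r). q \<in> \<rat> \<and> r \<in> (\<rat> :: real set) \<and> {q..r} \<subseteq> U}"
        by (rule countable_subset[rotated]) auto
      then show "countable ((\<lambda>(q, r). M q r) ` {(q, r). q \<in> \<rat> \<and> r \<in> \<rat> \<and> {q..r} \<subseteq> U})" by (rule countable_image)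
    qed (auto intro: M(1))
    show "\<forall>x s t. x \<in> U - N \<longrightarrow> (\<forall>n. s n \<le> x \<and> x \<le> t n \<and> s n < t n) \<longrightarrow> s \<longlonglongrightarrow> x \<longrightarrow> t \<longlonglongrightarrow> x
      \<longrightarrow> (\<lambda>n::nat. integral {s n..t n} u / (t n - s n)) \<longlonglongrightarrow> u x"
    proof (intro allI impI)
      fix x and s t :: "nat \<Rightarrow> real"
      assume x: "x \<in> U - N" and st: "\<forall>n. s n \<le> x \<and> x \<le> t n \<and> s n < t n" and lim: "s \<longlonglongrightarrow> x" "t \<longlonglongrightarrow> x"
      have xU: "x \<in> U" using x by simp
      obtain d where d: "d > 0" "ball x d \<subseteq> U" using openE[OF \<open>open U\<close> xU] .
      obtain q where q: "q \<in> \<rat>" "x - d < q" "q < x" using Rats_dense_in_real[of "x - d" x] d by auto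
      obtain r where r: "r \<in> \<rat>" "x < r" "r < x + d" using Rats_dense_in_real[of x "x + d"] d by auto
      have qr: "{q..r} \<subseteq> U" using d q r by (auto simp: subset_iff dist_real_def)
      then have "x \<in> {q<..<r} - M q r" using x q r by (auto simp: N_def)
      from M(2)[OF qr this] have "((\<lambda>y. integral {q..y} u) has_real_derivative u x) (at x)" .
      then have "(\<lambda>n. (integral {q..t n} u - integral {q..s n} u) / (t n - s n)) \<longlonglongrightarrow> u x"
        using st lim by (intro straddled_difference_quotient) auto
      moreover have "\<forall>\<^sub>F n in sequentially. (integral {q..t n} u - integral {q..s n} u) / (t n - s n) = integral {s n..t n} u / (t n - s n)"
      proof -
        have "\<forall>\<^sub>F n in sequentially. q < s n \<and> t n < r"
          using order_tendstoD(1)[OF lim(1) q(3)] order_tendstoD(2)[OF lim(2) r(2)] by (rule eventually_conj)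
        then show ?thesis
        proof (rule eventually_mono)
          fix n assume n: "q < s n \<and> t n < r"
          have "{q..t n} \<subseteq> {q..r}" using n by auto
          then have "u integrable_on {q..t n}"
            using locally_integrable_on_imp_integrable[OF u] qr by (meson order_trans)
          then have "integral {q..s n} u + integral {s n..t n} u = integral {q..t n} u"
            using n st by (intro Henstock_Kurzweil_Integration.integral_combine) (auto intro: less_imp_le)
          then show "(integral {q..t n} u - integral {q..s n} u) / (t n - s n) = integral {s n..t n} u / (t n - s n)" by simp
        qed
      qed
      ultimately show "(\<lambda>n. integral {s n..t n} u / (t n - s n)) \<longlonglongrightarrow> u x"
        by (rule Lim_transform_eventually)
    qed
  qed
qed

lemma one_sided_averages_tendsto:
  assumes u: "u locally_integrable_on U" and "open U"
  obtains N where "negligible N"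
    "\<forall>x h. x \<in> U - N \<longrightarrow> (\<forall>k. 0 < h k) \<longrightarrow> h \<longlonglongrightarrow> 0 \<longrightarrow> (\<lambda>k::nat. integral {x..x + h k} u / h k) \<longlonglongrightarrow> u x"
proof -
  obtain N where N: "negligible N"
    "\<forall>x s t. x \<in> U - N \<longrightarrow> (\<forall>n. s n \<le> x \<and> x \<le> t n \<and> s n < t n) \<longrightarrow> s \<longlonglongrightarrow> x \<longrightarrow> t \<longlonglongrightarrow> x
      \<longrightarrow> (\<lambda>n::nat. integral {s n..t n} u / (t n - s n)) \<longlonglongrightarrow> u x"
    using straddled_averages_tendsto[OF assms] .
  show thesis
  proof
    show "negligible N" by fact
    show "\<forall>x h. x \<in> U - N \<longrightarrow> (\<forall>k. 0 < h k) \<longrightarrow> h \<longlonglongrightarrow> 0 \<longrightarrow> (\<lambda>k::nat. integral {x..x + h k} u / h k) \<longlonglongrightarrow> u x"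
    proof (intro allI impI)
      fix x and h :: "nat \<Rightarrow> real" assume x: "x \<in> U - N" and h: "\<forall>k. 0 < h k" "h \<longlonglongrightarrow> 0"
      have "(\<lambda>k. x + h k) \<longlonglongrightarrow> x" using tendsto_add[OF tendsto_const h(2), of x] by simp
      then show "(\<lambda>k. integral {x..x + h k} u / h k) \<longlonglongrightarrow> u x"
        using N(2)[rule_format, of x "\<lambda>_. x" "\<lambda>k. x + h k"] x h(1) by (simp add: less_imp_le)
    qed
  qed
qed

text \<open>The trapezoid identity divided by \<open>h\<close>, in the limit: the averages tend to
  u(x) and u(y) off the null set, and the scaled differences of ramps, bounded by 1, tend to the
  indicator of (x,y].\<close>

lemma weak_derivative_imp_ae_primitive:
  assumes wd: "has_weak_derivative U u g" and "open U"
  shows "ae_primitive_on U u g"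
proof -
  have u: "u locally_integrable_on U" and g: "g locally_integrable_on U"
    using wd by (auto simp: has_weak_derivative_def)
  obtain N where "negligible N" and N: "\<forall>x h. x \<in> U - N \<longrightarrow> (\<forall>k. 0 < h k) \<longrightarrow> h \<longlonglongrightarrow> 0 \<longrightarrow> (\<lambda>k::nat. integral {x..x + h k} u / h k) \<longlonglongrightarrow> u x"
    using one_sided_averages_tendsto[OF u \<open>open U\<close>] .
  have "u y - u x = integral {x..y} g" if xy: "x \<notin> N" "y \<notin> N" "x < y" "{x..y} \<subseteq> U" for x y
  proof -
    have "y \<in> U" using xy by auto
    then obtain d where d: "d > 0" "ball y d \<subseteq> U" using \<open>open U\<close> openE by blast
    \<comment> \<open>Room to the right of \<open>y\<close> for the falling ramp, and at most
      \<open>y - x\<close> so that the two ramps do not overlap.\<close>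
    define c where "c = min (d / 2) (y - x)"
    have c: "0 < c" "c \<le> y - x" "c < d" using d xy by (auto simp: c_def)
    have sub: "{x..y + c} \<subseteq> U"
    proof
      fix z assume "z \<in> {x..y + c}"
      then have "z \<in> {x..y} \<or> z \<in> ball y d" using c by (auto simp: dist_real_def)
      then show "z \<in> U" using xy d by blast
    qed
    define h where "h k = c / real (Suc k)" for k
    have h: "0 < h k" "h k \<le> c" for k using c by (auto simp: h_def divide_le_eq mult_le_cancel_left1)
    have h0: "h \<longlonglongrightarrow> 0" unfolding h_def using LIMSEQ_Suc[OF lim_const_over_n[of c]] by simp
    define \<Phi> where "\<Phi> k z = max 0 (min (h k) (z - x)) - max 0 (min (h k) (z - y))" for k z
    have gi: "g absolutely_integrable_on {x..y + c}" by (rule locally_integrable_on_Icc[OF g sub])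
    have \<Phi>_cont: "continuous_on S (\<Phi> k)" for S k unfolding \<Phi>_def[abs_def] by (intro continuous_intros)
    have g\<Phi>: "(\<lambda>z. g z * \<Phi> k z) integrable_on {x..y + c}" for k
      by (intro set_lebesgue_integral_eq_integral(1) absolutely_integrable_times_continuous gi \<Phi>_cont) simp
    have eq: "integral {x..x + h k} u / h k - integral {y..y + h k} u / h k = - integral {x..y + c} (\<lambda>z. g z * (\<Phi> k z / h k))" for k
    proof -
      have "integral {x..x + h k} u - integral {y..y + h k} u = - integral {x..y + h k} (\<lambda>z. g z * \<Phi> k z)"
        unfolding \<Phi>_def using h[of k] c sub by (intro weak_derivative_trapezoid[OF wd]) auto
      also have "integral {x..y + h k} (\<lambda>z. g z * \<Phi> k z) = integral {x..y + c} (\<lambda>z. g z * \<Phi> k z)"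
      proof -
        have "integral {x..y + h k} (\<lambda>z. g z * \<Phi> k z) + integral {y + h k..y + c} (\<lambda>z. g z * \<Phi> k z)
            = integral {x..y + c} (\<lambda>z. g z * \<Phi> k z)"
          using h[of k] c g\<Phi> xy by (intro Henstock_Kurzweil_Integration.integral_combine) auto
        moreover have "integral {y + h k..y + c} (\<lambda>z. g z * \<Phi> k z) = 0"
          using h[of k] xy by (intro integral_eq_zero) (auto simp: \<Phi>_def min_absorb1)
        ultimately show ?thesis by simp
      qed
      finally have "(integral {x..x + h k} u - integral {y..y + h k} u) / h k = - (integral {x..y + c} (\<lambda>z. g z * \<Phi> k z) / h k)"
        by simp
      also have "integral {x..y + c} (\<lambda>z. g z * \<Phi> k z) / h k = integral {x..y + c} (\<lambda>z. g z * (\<Phi> k z / h k))"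
        by (simp flip: integral_divide)
      finally show ?thesis by (simp add: diff_divide_distrib)
    qed
    have "(\<lambda>k. integral {x..x + h k} u / h k - integral {y..y + h k} u / h k) \<longlonglongrightarrow> u x - u y"
    proof (rule tendsto_diff)
      have "x \<in> U - N" "y \<in> U - N" using xy by auto
      then show "(\<lambda>k. integral {x..x + h k} u / h k) \<longlonglongrightarrow> u x" "(\<lambda>k. integral {y..y + h k} u / h k) \<longlonglongrightarrow> u y"
        using N h(1) h0 by blast+
    qed
    moreover have "(\<lambda>k. integral {x..y + c} (\<lambda>z. g z * (\<Phi> k z / h k))) \<longlonglongrightarrow>
      integral {x..y + c} (\<lambda>z. g z * indicator {x<..y} z)"
    proof (rule dominated_convergence(2))
      show "(\<lambda>z. g z * (\<Phi> k z / h k)) integrable_on {x..y + c}" for k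
        using integrable_on_mult_left[OF g\<Phi>, of k "inverse (h k)"] by (simp add: divide_inverse mult.assoc)
      show "(\<lambda>z. \<bar>g z\<bar>) integrable_on {x..y + c}" using gi by (simp add: absolutely_integrable_on_def)
      have "\<bar>\<Phi> k z\<bar> \<le> h k" for k z using h(1)[of k] by (auto simp: \<Phi>_def abs_le_iff min_def max_def)
      then have "\<bar>\<Phi> k z\<bar> / h k \<le> 1" for k z using h(1)[of k] by simp
      then show "norm (g z * (\<Phi> k z / h k)) \<le> \<bar>g z\<bar>" for k z
        using h(1)[of k] mult_left_mono[of "\<bar>\<Phi> k z\<bar> / h k" 1 "\<bar>g z\<bar>"] by (simp add: abs_mult)
      have "(\<lambda>k. \<Phi> k z / h k) \<longlonglongrightarrow> indicator {x<..y} z" for z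
      proof (rule tendsto_eventually)
        consider "z \<le> x" | "x < z" "z \<le> y" | "y < z" by linarith
        then show "\<forall>\<^sub>F k in sequentially. \<Phi> k z / h k = indicator {x<..y} z"
        proof cases
          case 1
          have "\<Phi> k z = 0" for k using 1 h(1)[of k] xy by (auto simp: \<Phi>_def min_def max_def)
          then show ?thesis using 1 by simp
        next
          case 2
          have "\<forall>\<^sub>F k in sequentially. h k < z - x" using order_tendstoD(2)[OF h0] 2 by simp
          then show ?thesis
          proof (rule eventually_mono)
            fix k assume "h k < z - x"
            then have "\<Phi> k z = h k" using 2 h(1)[of k] by (auto simp: \<Phi>_def min_def max_def)
            then show "\<Phi> k z / h k = indicator {x<..y} z" using 2 h(1)[of k] by simp
          qed
        next
          case 3
          have "\<forall>\<^sub>F k in sequentially. h k < z - y" using order_tendstoD(2)[OF h0] 3 by simp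
          then show ?thesis
          proof (rule eventually_mono)
            fix k assume "h k < z - y"
            then have "\<Phi> k z = 0" using 3 xy h(1)[of k] by (auto simp: \<Phi>_def min_def max_def)
            then show "\<Phi> k z / h k = indicator {x<..y} z" using 3 by simp
          qed
        qed
      qed
      then show "(\<lambda>k. g z * (\<Phi> k z / h k)) \<longlonglongrightarrow> g z * indicator {x<..y} z" for z
        by (rule tendsto_mult_left)
    qed
    ultimately have "u x - u y = - integral {x..y + c} (\<lambda>z. g z * indicator {x<..y} z)"
      unfolding eq using LIMSEQ_unique tendsto_minus by blast
    also have "integral {x..y + c} (\<lambda>z. g z * indicator {x<..y} z) = integral {x..y + c} (\<lambda>z. if z \<in> {x..y} then g z else 0)"
      by (rule integral_spike[of "{x}"]) (auto simp: indicator_def)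
    also have "\<dots> = integral {x..y} g"
      using c by (subst Henstock_Kurzweil_Integration.integral_restrict_Int) (simp add: Int_absorb1)
    finally show ?thesis by simp
  qed
  then have "u y - u x = integral {x..y} g" if "x \<notin> N" "y \<notin> N" "x \<le> y" "{x..y} \<subseteq> U" for x y
    using that by (cases "x = y") auto
  then show ?thesis unfolding ae_primitive_on_def using \<open>negligible N\<close> by blast
qed

lemma integral_Icc_diff:
  fixes g :: "real \<Rightarrow> real"
  assumes "g integrable_on {c..d}" "c \<le> p" "p \<le> q" "q \<le> d"
  shows "integral {p..q} g = integral {c..q} g - integral {c..p} g"
proof -
  have "g integrable_on {c..q}" using assms by (intro integrable_on_subinterval[OF assms(1)]) auto
  then have "integral {c..p} g + integral {p..q} g = integral {c..q} g"
    using assms by (intro Henstock_Kurzweil_Integration.integral_combine) auto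
  then show ?thesis by simp
qed

lemma not_negligible_ball:
  assumes "negligible N" "0 < (d :: real)"
  obtains z where "z \<notin> N" "dist (x :: real) z < d"
proof -
  have "\<not> ball x d \<subseteq> N"
    using assms open_not_negligible[of "ball x d"] negligible_subset by auto
  then show ?thesis using that by (auto simp: subset_iff)
qed

text \<open>\<open>U\<close> may have many components, so there is no common base point. Each
  \<open>x\<close> gets its own \<open>b x\<close> off the null set, joined to it inside
  \<open>U\<close>; the choice does not matter because \<open>u\<close> itself satisfies the
  identity off the null set.\<close>

lemma ae_primitive_representative:
  assumes "ae_primitive_on U u g" "open U" and g: "g locally_integrable_on U"
  obtains v N where "negligible N" "\<forall>x\<in>U - N. v x = u x"
    "\<forall>x y. x \<le> y \<longrightarrow> {x..y} \<subseteq> U \<longrightarrow> v y - v x = integral {x..y} g"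
proof -
  obtain N where "negligible N" and N: "\<And>x y. \<lbrakk>x \<notin> N; y \<notin> N; x \<le> y; {x..y} \<subseteq> U\<rbrakk> \<Longrightarrow> u y - u x = integral {x..y} g"
    using assms unfolding ae_primitive_on_def by blast
  have "\<exists>z. z \<notin> N \<and> {min x z..max x z} \<subseteq> U" if xU: "x \<in> U" for x
  proof -
    obtain d where d: "d > 0" "ball x d \<subseteq> U" using openE[OF \<open>open U\<close> xU] .
    obtain z where z: "z \<notin> N" "dist x z < d" using not_negligible_ball[OF \<open>negligible N\<close> d(1)] .
    have "{min x z..max x z} \<subseteq> ball x d" using z by (auto simp: dist_real_def)
    then show ?thesis using z d by blast
  qed
  then obtain b where b: "\<And>x. x \<in> U \<Longrightarrow> b x \<notin> N" "\<And>x. x \<in> U \<Longrightarrow> {min x (b x)..max x (b x)} \<subseteq> U" by metis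
  define v where "v x = u (b x) + (if b x \<le> x then integral {b x..x} g else - integral {x..b x} g)" for x
  have v_eq: "v x = u (b x) + (integral {c..x} g - integral {c..b x} g)"
    if "{c..d} \<subseteq> U" "c \<le> x" "c \<le> b x" "x \<le> d" "b x \<le> d" for x c d
  proof (cases "b x \<le> x")
    case True
    then show ?thesis
      using that integral_Icc_diff[OF locally_integrable_on_imp_integrable[OF g that(1)], of "b x" x] by (simp add: v_def)
  next
    case False
    then show ?thesis
      using that integral_Icc_diff[OF locally_integrable_on_imp_integrable[OF g that(1)], of x "b x"] by (simp add: v_def)
  qed
  have u_eq: "u q - u p = integral {c..q} g - integral {c..p} g"
    if "{c..d} \<subseteq> U" "c \<le> p" "c \<le> q" "p \<le> d" "q \<le> d" "p \<notin> N" "q \<notin> N" for p q c d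
  proof (cases "p \<le> q")
    case True
    have "{p..q} \<subseteq> U" using that by (meson atLeastatMost_subset_iff order_trans)
    then show ?thesis using N[of p q] that True
      integral_Icc_diff[OF locally_integrable_on_imp_integrable[OF g that(1)], of p q] by simp
  next
    case False
    have "{q..p} \<subseteq> U" using that by (meson atLeastatMost_subset_iff order_trans)
    then show ?thesis using N[of q p] that False
      integral_Icc_diff[OF locally_integrable_on_imp_integrable[OF g that(1)], of q p] by simp
  qed
  show thesis
  proof
    show "negligible N" by fact
    show "\<forall>x\<in>U - N. v x = u x"
    proof
      fix x assume x: "x \<in> U - N"
      then have "x \<in> U" "x \<notin> N" by auto
      then show "v x = u x"
        using v_eq[OF b(2), of x x] u_eq[OF b(2), of x "b x" x] b(1)[of x] by simp
    qed
    show "\<forall>x y. x \<le> y \<longrightarrow> {x..y} \<subseteq> U \<longrightarrow> v y - v x = integral {x..y} g"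
    proof (intro allI impI)
      fix x y assume xy: "x \<le> y" "{x..y} \<subseteq> U"
      have xU: "x \<in> U" and yU: "y \<in> U" using xy by auto
      \<comment> \<open>One interval inside \<open>U\<close> containing both points and both base
        points, so that all increments become differences of a single indefinite integral.\<close>
      define c d where "c = min (min x (b x)) (min y (b y))" and "d = max (max x (b x)) (max y (b y))"
      have "{c..d} \<subseteq> {min x (b x)..max x (b x)} \<union> {x..y} \<union> {min y (b y)..max y (b y)}"
        using xy(1) by (auto simp: c_def d_def)
      then have cd: "{c..d} \<subseteq> U" using b(2)[OF xU] b(2)[OF yU] xy(2) by blast
      have bd: "c \<le> x" "c \<le> b x" "x \<le> d" "b x \<le> d" "c \<le> y" "c \<le> b y" "y \<le> d" "b y \<le> d"
        by (auto simp: c_def d_def)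
      show "v y - v x = integral {x..y} g"
        using v_eq[OF cd bd(1-4)] v_eq[OF cd bd(5-8)] u_eq[OF cd bd(2) bd(6) bd(4) bd(8) b(1)[OF xU] b(1)[OF yU]]
          integral_Icc_diff[OF locally_integrable_on_imp_integrable[OF g cd] bd(1) xy(1) bd(7)] by simp
    qed
  qed
qed

lemma AC_mult:
  assumes u: "u \<in> AC a b" and v: "v \<in> AC a b" shows "(\<lambda>x. u x * v x) \<in> AC a b"
proof -
  have "bounded (u ` {a..b})" "bounded (v ` {a..b})"
    using u v by (auto intro!: compact_imp_bounded compact_continuous_image AC_imp_continuous_on)
  then obtain K L where K: "\<forall>y\<in>u ` {a..b}. norm y \<le> K" and L: "\<forall>y\<in>v ` {a..b}. norm y \<le> L"
    unfolding bounded_iff by blast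
  define M where "M = max 1 (max K L)"
  have M: "0 < M" "\<bar>u x\<bar> \<le> M" "\<bar>v x\<bar> \<le> M" if "x \<in> {a..b}" for x
    using K L that by (auto simp: M_def le_max_iff_disj)
  have M0: "0 < M" by (simp add: M_def)
  show ?thesis
  proof (rule AC_I)
    fix \<epsilon> :: real assume "0 < \<epsilon>"
    then have e2: "0 < \<epsilon> / (2 * M)" using M0 by simp
    obtain d where d: "0 < d" "\<And>(I :: (real \<times> real) set) s t. nonoverlapping a b I s t
      \<Longrightarrow> (\<Sum>i\<in>I. t i - s i) < d \<Longrightarrow> (\<Sum>i\<in>I. \<bar>u (t i) - u (s i)\<bar>) < \<epsilon> / (2 * M)"
      by (rule AC_D[OF u e2]) (rule that; blast)
    obtain d' where d': "0 < d'" "\<And>(I :: (real \<times> real) set) s t. nonoverlapping a b I s t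
      \<Longrightarrow> (\<Sum>i\<in>I. t i - s i) < d' \<Longrightarrow> (\<Sum>i\<in>I. \<bar>v (t i) - v (s i)\<bar>) < \<epsilon> / (2 * M)"
      by (rule AC_D[OF v e2]) (rule that; blast)
    have "(\<Sum>i\<in>I. \<bar>u (t i) * v (t i) - u (s i) * v (s i)\<bar>) < \<epsilon>"
      if I: "nonoverlapping a b I s t" "(\<Sum>i\<in>I. t i - s i) < min d d'" for I :: "(real \<times> real) set" and s t
    proof -
      have "(\<Sum>i\<in>I. \<bar>u (t i) * v (t i) - u (s i) * v (s i)\<bar>)
        \<le> (\<Sum>i\<in>I. M * \<bar>u (t i) - u (s i)\<bar> + M * \<bar>v (t i) - v (s i)\<bar>)"
      proof (rule sum_mono)
        fix i assume "i \<in> I"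
        then have st: "s i \<in> {a..b}" "t i \<in> {a..b}" using I(1) by (auto simp: nonoverlapping_def)
        have "u (t i) * v (t i) - u (s i) * v (s i) = v (t i) * (u (t i) - u (s i)) + u (s i) * (v (t i) - v (s i))"
          by (simp add: algebra_simps)
        also have "\<bar>\<dots>\<bar> \<le> \<bar>v (t i)\<bar> * \<bar>u (t i) - u (s i)\<bar> + \<bar>u (s i)\<bar> * \<bar>v (t i) - v (s i)\<bar>"
          by (metis abs_mult abs_triangle_ineq)
        also have "\<dots> \<le> M * \<bar>u (t i) - u (s i)\<bar> + M * \<bar>v (t i) - v (s i)\<bar>"
          using M st by (intro add_mono mult_right_mono) auto
        finally show "\<bar>u (t i) * v (t i) - u (s i) * v (s i)\<bar> \<le> M * \<bar>u (t i) - u (s i)\<bar> + M * \<bar>v (t i) - v (s i)\<bar>" .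
      qed
      also have "\<dots> = M * (\<Sum>i\<in>I. \<bar>u (t i) - u (s i)\<bar>) + M * (\<Sum>i\<in>I. \<bar>v (t i) - v (s i)\<bar>)"
        by (simp add: sum.distrib sum_distrib_left)
      also have "\<dots> < M * (\<epsilon> / (2 * M)) + M * (\<epsilon> / (2 * M))"
        using d(2)[OF I(1)] d'(2)[OF I(1)] I(2) M0 by (intro add_strict_mono mult_strict_left_mono) auto
      finally show ?thesis using M0 by (simp add: field_simps)
    qed
    then show "\<exists>\<delta>>0. \<forall>(I :: (real \<times> real) set) s t. nonoverlapping a b I s t \<and> (\<Sum>i\<in>I. t i - s i) < \<delta>
      \<longrightarrow> (\<Sum>i\<in>I. \<bar>u (t i) * v (t i) - u (s i) * v (s i)\<bar>) < \<epsilon>"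
      using d(1) d'(1) by (intro exI[of _ "min d d'"]) auto
  qed
qed

text \<open>The product is absolutely continuous, hence the integral of its derivative, which the
  product rule computes almost everywhere.\<close>

lemma integration_by_parts_indefinite_integral:
  fixes g v \<phi> \<phi>' :: "real \<Rightarrow> real"
  assumes "p \<le> q" and g: "g absolutely_integrable_on {p..q}"
    and v: "\<And>x. x \<in> {p..q} \<Longrightarrow> v x - v p = integral {p..x} g"
    and \<phi>: "\<And>x. (\<phi> has_real_derivative \<phi>' x) (at x)" "continuous_on {p..q} \<phi>'"
  shows "((\<lambda>z. g z * \<phi> z + v z * \<phi>' z) has_integral v q * \<phi> q - v p * \<phi> p) {p..q}"
proof -
  have vAC: "v \<in> AC p q"
  proof (rule AC_indefinite_integral[OF g])
    show "v x = v p + integral {p..x} g" if "x \<in> {p..q}" for x using v[OF that] by simp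
  qed
  have "\<phi> \<in> AC p q"
  proof (rule AC_indefinite_integral)
    show "\<phi>' absolutely_integrable_on {p..q}" using \<phi>(2) by (rule absolutely_integrable_continuous_real)
    fix x assume "x \<in> {p..q}"
    then have "(\<phi>' has_integral \<phi> x - \<phi> p) {p..x}"
      by (intro fundamental_theorem_of_calculus) (auto intro: \<phi>(1)[THEN has_field_derivative_at_within, THEN has_real_derivative_iff_has_vector_derivative[THEN iffD1]])
    then show "\<phi> x = \<phi> p + integral {p..x} \<phi>'" by (simp add: integral_unique)
  qed
  from AC_fundamental_theorem(2)[OF AC_mult[OF vAC this] \<open>p \<le> q\<close>, of p q]
  have D: "(deriv (\<lambda>x. v x * \<phi> x) has_integral v q * \<phi> q - v p * \<phi> p) {p..q}" using \<open>p \<le> q\<close> by simp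
  obtain N where N: "negligible N"
    "\<forall>x\<in>{p<..<q} - N. ((\<lambda>y. integral {p..y} g) has_real_derivative g x) (at x)"
    using lebesgue_differentiation[OF set_lebesgue_integral_eq_integral(1)[OF g]] .
  have N': "negligible (N \<union> {p, q})" using N(1) by (simp add: negligible_Un)
  have "g x * \<phi> x + v x * \<phi>' x = deriv (\<lambda>x. v x * \<phi> x) x" if x: "x \<in> {p..q} - (N \<union> {p, q})" for x
  proof -
    have "((\<lambda>y. v p + integral {p..y} g) has_real_derivative g x) (at x)"
      using x by (auto intro!: derivative_eq_intros N(2)[rule_format])
    then have "(v has_real_derivative g x) (at x)"
    proof (rule has_field_derivative_transform_within_open)
      show "open {p<..<q}" "x \<in> {p<..<q}" using x by auto
      show "v p + integral {p..y} g = v y" if "y \<in> {p<..<q}" for y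
        using v[of y] that by simp
    qed
    then have "((\<lambda>x. v x * \<phi> x) has_real_derivative g x * \<phi> x + v x * \<phi>' x) (at x)"
      by (auto intro!: derivative_eq_intros \<phi>(1))
    then show ?thesis by (simp add: DERIV_imp_deriv)
  qed
  then show ?thesis by (rule has_integral_spike[OF N' _ D])
qed

lemma continuous_on_ae_primitive:
  assumes v: "\<And>x y. x \<le> y \<Longrightarrow> {x..y} \<subseteq> U \<Longrightarrow> v y - v x = integral {x..y} g"
    and "open U" and g: "g locally_integrable_on U"
  shows "continuous_on U v"
  unfolding continuous_on_eq_continuous_at[OF \<open>open U\<close>]
proof
  fix x assume "x \<in> U"
  then obtain d where d: "d > 0" "cball x d \<subseteq> U" using \<open>open U\<close> open_contains_cball by blast
  have sub: "{x - d..x + d} \<subseteq> U" using d by (simp add: cball_eq_atLeastAtMost)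
  have "continuous_on {x - d..x + d} (\<lambda>y. v (x - d) + integral {x - d..y} g)"
    by (intro continuous_intros indefinite_integral_continuous_1 locally_integrable_on_imp_integrable[OF g sub])
  moreover have "v (x - d) + integral {x - d..y} g = v y" if "y \<in> {x - d..x + d}" for y
  proof -
    have "{x - d..y} \<subseteq> U" using that sub by auto
    then show ?thesis using v[of "x - d" y] that by simp
  qed
  ultimately have "continuous_on {x - d..x + d} v" by (rule continuous_on_eq)
  then show "isCont v x" by (rule continuous_on_interior) (use d in \<open>simp add: interior_atLeastAtMost_real\<close>)
qed

text \<open>The support of a test function may meet several components of \<open>U\<close>, where
  \<open>v\<close> has unrelated additive constants. Rather than splitting the support, the argument
  shows a defect function to be locally constant on a large interval: around points of the support
  by parts, elsewhere because everything vanishes. Connectedness of the interval finishes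
  it.\<close>

lemma ae_primitive_imp_weak_derivative:
  assumes prim: "ae_primitive_on U u g" and "open U" and g: "g locally_integrable_on U"
    and u: "u \<in> borel_measurable (lebesgue_on U)"
  shows "has_weak_derivative U u g"
proof -
  obtain v N where N: "negligible N" and vu: "\<forall>x\<in>U - N. v x = u x"
    and v_all: "\<forall>x y. x \<le> y \<longrightarrow> {x..y} \<subseteq> U \<longrightarrow> v y - v x = integral {x..y} g"
    using ae_primitive_representative[OF prim \<open>open U\<close> g] .
  then have v: "\<And>x y. x \<le> y \<Longrightarrow> {x..y} \<subseteq> U \<Longrightarrow> v y - v x = integral {x..y} g" by blast
  have vcont: "continuous_on U v" by (rule continuous_on_ae_primitive[OF v \<open>open U\<close> g])
  have v_int: "v absolutely_integrable_on K" if "compact K" "K \<subseteq> U" for K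
  proof -
    have "(\<lambda>_. 1 :: real) absolutely_integrable_on K"
      using absolutely_integrable_on_const[OF lmeasurable_compact[OF that(1)]] by blast
    then have "(\<lambda>x. 1 * v x) absolutely_integrable_on K"
      by (rule absolutely_integrable_times_continuous) (use that vcont continuous_on_subset in auto)
    then show ?thesis by simp
  qed
  have uloc: "u locally_integrable_on U"
    unfolding locally_integrable_on_def
  proof (intro conjI u allI impI)
    fix K assume K: "compact K \<and> K \<subseteq> U"
    show "u absolutely_integrable_on K"
      by (rule absolutely_integrable_spike[OF v_int N]) (use K vu in auto)
  qed
  have "(LINT x:U|lebesgue. u x * deriv \<phi> x) = - (LINT x:U|lebesgue. g x * \<phi> x)" if \<phi>: "test_function U \<phi>" for \<phi>
  proof -
    define K where "K = closure {x. \<phi> x \<noteq> 0}"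
    have K: "compact K" "K \<subseteq> U" using \<phi> by (auto simp: test_function_def K_def)
    have diff: "(deriv ^^ n) \<phi> differentiable (at x)" for n x using \<phi> by (simp add: test_function_def)
    have d\<phi>: "(\<phi> has_real_derivative deriv \<phi> x) (at x)" for x
      using diff[of 0 x] DERIV_deriv_iff_real_differentiable by simp
    have c\<phi>: "continuous_on S \<phi>" for S by (intro continuous_at_imp_continuous_on ballI DERIV_isCont[OF d\<phi>])
    have cd\<phi>: "continuous_on S (deriv \<phi>)" for S
      using diff[of 1] by (intro continuous_at_imp_continuous_on ballI differentiable_imp_continuous_within) simp
    have \<phi>0: "\<phi> x = 0" if "x \<notin> K" for x using that closure_subset[of "{x. \<phi> x \<noteq> 0}"] by (auto simp: K_def)
    have d\<phi>0: "deriv \<phi> x = 0" if "x \<notin> K" for x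
    proof (rule DERIV_imp_deriv)
      show "(\<phi> has_real_derivative 0) (at x)"
        by (rule has_field_derivative_transform_within_open[of "\<lambda>_. 0" _ _ "- K"])
          (use that K(1) in \<open>auto simp: \<phi>0 compact_imp_closed open_Compl\<close>)
    qed
    obtain M where M: "K \<subseteq> {-M<..<M}"
    proof -
      obtain B where "\<And>x. x \<in> K \<Longrightarrow> \<bar>x\<bar> \<le> B" using compact_imp_bounded[OF K(1)] by (auto simp: bounded_iff)
      then have "K \<subseteq> {-(B+1)<..<B+1}" by fastforce
      then show thesis by (rule that)
    qed
    have g_int: "g absolutely_integrable_on K" using g K by (auto simp: locally_integrable_on_def)
    have i1: "(\<lambda>z. g z * \<phi> z) absolutely_integrable_on K" and i2: "(\<lambda>z. v z * deriv \<phi> z) absolutely_integrable_on K"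
      by (intro absolutely_integrable_times_continuous g_int v_int K c\<phi> cd\<phi>)+
    define f where "f z = (if z \<in> K then g z * \<phi> z + v z * deriv \<phi> z else 0)" for z
    have "(\<lambda>z. g z * \<phi> z + v z * deriv \<phi> z) absolutely_integrable_on K" by (rule set_integral_add(1)[OF i1 i2])
    then have "f absolutely_integrable_on UNIV" unfolding f_def by (subst absolutely_integrable_restrict_UNIV)
    then have f_int: "f integrable_on {x..y}" for x y
      by (meson integrable_on_subinterval set_lebesgue_integral_eq_integral(1) subset_UNIV)
    have f_eq: "f z = g z * \<phi> z + v z * deriv \<phi> z" for z by (simp add: f_def \<phi>0 d\<phi>0)
    \<comment> \<open>The defect of integration by parts up to \<open>x\<close>: its value is 0 at
      \<open>- M\<close>, and at \<open>M\<close> it is the integral that has to vanish.\<close>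
    define W where "W x = integral {-M..x} f - v x * \<phi> x" for x
    have "W constant_on {-M..M}"
    proof (rule locally_constant_imp_constant)
      show "connected {-M..M}" by simp
      fix x assume x: "x \<in> {-M..M}"
      obtain d where d: "d > 0" "ball x d \<inter> K = {} \<or> ball x d \<subseteq> U"
      proof (cases "x \<in> K")
        case True
        then have "x \<in> U" using K(2) by blast
        then obtain d where "d > 0" "ball x d \<subseteq> U" using openE[OF \<open>open U\<close>] by metis
        then show thesis using that by blast
      next
        case False
        then obtain d where "d > 0" "ball x d \<subseteq> - K" using K(1) compact_imp_closed open_Compl openE by (metis ComplI)
        then show thesis using that by blast
      qed
      have W_eq: "W p = W q" if pq: "p \<le> q" "p \<in> ball x d" "q \<in> ball x d" "-M \<le> p" for p q
      proof -
        have sub: "{p..q} \<subseteq> ball x d" using pq by (auto simp: dist_real_def)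
        have "integral {p..q} f = integral {-M..q} f - integral {-M..p} f"
          using pq by (intro integral_Icc_diff f_int) auto
        moreover have "integral {p..q} f = v q * \<phi> q - v p * \<phi> p"
        proof (cases "ball x d \<inter> K = {}")
          case True
          then have "z \<notin> K" if "z \<in> {p..q}" for z using that sub by blast
          then have "integral {p..q} f = 0" "\<phi> p = 0" "\<phi> q = 0"
            using pq(1) \<phi>0 by (auto intro!: integral_eq_zero simp: f_def)
          then show ?thesis by simp
        next
          case False
          then have U: "{p..q} \<subseteq> U" using sub d by blast
          have "((\<lambda>z. g z * \<phi> z + v z * deriv \<phi> z) has_integral v q * \<phi> q - v p * \<phi> p) {p..q}"
          proof (rule integration_by_parts_indefinite_integral[OF pq(1) locally_integrable_on_Icc[OF g U] _ d\<phi> cd\<phi>])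
            fix z assume z: "z \<in> {p..q}"
            then have "{p..z} \<subseteq> U" using U by auto
            then show "v z - v p = integral {p..z} g" using v z by simp
          qed
          then show ?thesis by (simp add: f_eq[abs_def] integral_unique)
        qed
        ultimately show ?thesis by (simp add: W_def)
      qed
      show "\<exists>T. openin (top_of_set {-M..M}) T \<and> x \<in> T \<and> (\<forall>y\<in>T. W y = W x)"
      proof (intro exI[of _ "{-M..M} \<inter> ball x d"] conjI ballI)
        show "openin (top_of_set {-M..M}) ({-M..M} \<inter> ball x d)" by (rule openin_open_Int) simp
        show "x \<in> {-M..M} \<inter> ball x d" using x d by simp
        fix y assume y: "y \<in> {-M..M} \<inter> ball x d"
        then have "y \<in> ball x d" "x \<in> ball x d" "-M \<le> y" "-M \<le> x" using x d by auto
        then show "W y = W x"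
          by (cases "x \<le> y") (blast intro: W_eq W_eq[symmetric], metis W_eq linear)
      qed
    qed
    moreover have "-M \<le> M" "-M \<notin> K" "M \<notin> K" if "K \<noteq> {}" using M that by (auto simp: subset_iff)
    ultimately have "integral {-M..M} f = 0"
    proof (cases "K = {}")
      case True
      then have "f = (\<lambda>_. 0)" by (auto simp: f_def)
      then show ?thesis by simp
    next
      case False
      with M have M': "-M \<le> M" "-M \<notin> K" "M \<notin> K" by (auto simp: subset_iff)
      then have "W M = W (-M)" using \<open>W constant_on {-M..M}\<close> by (auto simp: constant_on_def)
      then show ?thesis using M' by (simp add: W_def \<phi>0)
    qed
    moreover have "integral {-M..M} f = integral K (\<lambda>z. g z * \<phi> z + v z * deriv \<phi> z)"
    proof -
      have "{-M..M} \<inter> K = K" using M by fastforce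
      then show ?thesis unfolding f_def
        by (subst Henstock_Kurzweil_Integration.integral_restrict_Int) (simp add: Int_commute)
    qed
    moreover have "\<dots> = integral K (\<lambda>z. g z * \<phi> z) + integral K (\<lambda>z. v z * deriv \<phi> z)"
      by (intro Henstock_Kurzweil_Integration.integral_add set_lebesgue_integral_eq_integral(1) i1 i2)
    moreover have "integral K (\<lambda>z. v z * deriv \<phi> z) = integral K (\<lambda>z. u z * deriv \<phi> z)"
      by (rule integral_spike[OF N]) (use vu K in auto)
    moreover have "(LINT x:U|lebesgue. u x * deriv \<phi> x) = integral K (\<lambda>z. u z * deriv \<phi> z)"
      by (rule set_integral_against_test_function[OF uloc K cd\<phi> d\<phi>0])
    moreover have "(LINT x:U|lebesgue. g x * \<phi> x) = integral K (\<lambda>z. g z * \<phi> z)"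
      by (rule set_integral_against_test_function[OF g K c\<phi> \<phi>0])
    ultimately show ?thesis by linarith
  qed
  then show ?thesis using uloc g by (simp add: has_weak_derivative_def)
qed

theorem has_weak_derivative_iff_ae_primitive:
  assumes "open U"
  shows "has_weak_derivative U u g \<longleftrightarrow>
    u \<in> borel_measurable (lebesgue_on U) \<and> g locally_integrable_on U \<and> ae_primitive_on U u g"
proof
  assume wd: "has_weak_derivative U u g"
  then have "u locally_integrable_on U" "g locally_integrable_on U" by (simp_all add: has_weak_derivative_def)
  then show "u \<in> borel_measurable (lebesgue_on U) \<and> g locally_integrable_on U \<and> ae_primitive_on U u g"
    using weak_derivative_imp_ae_primitive[OF wd assms] by (simp add: locally_integrable_on_def)
next
  assume "u \<in> borel_measurable (lebesgue_on U) \<and> g locally_integrable_on U \<and> ae_primitive_on U u g"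
  then show "has_weak_derivative U u g" using ae_primitive_imp_weak_derivative assms by blast
qed

text \<open>The continuous representatives agree off a null set, hence everywhere on
  \<open>U\<close>; their equal increments over [x,x+h], divided by \<open>h\<close>, tend to both
  densities almost everywhere.\<close>

lemma ae_primitive_unique:
  assumes f: "ae_primitive_on U u f" "f locally_integrable_on U"
    and g: "ae_primitive_on U u g" "g locally_integrable_on U" and "open U"
  obtains N where "negligible N" "\<forall>x\<in>U - N. f x = g x"
proof -
  obtain v N1 where N1: "negligible N1" and vu: "\<forall>x\<in>U - N1. v x = u x"
    and v_all: "\<forall>x y. x \<le> y \<longrightarrow> {x..y} \<subseteq> U \<longrightarrow> v y - v x = integral {x..y} f"
    using ae_primitive_representative[OF f(1) \<open>open U\<close> f(2)] .
  then have v: "\<And>x y. x \<le> y \<Longrightarrow> {x..y} \<subseteq> U \<Longrightarrow> v y - v x = integral {x..y} f" by blast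
  obtain w N2 where N2: "negligible N2" and wu: "\<forall>x\<in>U - N2. w x = u x"
    and w_all: "\<forall>x y. x \<le> y \<longrightarrow> {x..y} \<subseteq> U \<longrightarrow> w y - w x = integral {x..y} g"
    using ae_primitive_representative[OF g(1) \<open>open U\<close> g(2)] .
  then have w: "\<And>x y. x \<le> y \<Longrightarrow> {x..y} \<subseteq> U \<Longrightarrow> w y - w x = integral {x..y} g" by blast
  have cv: "continuous_on U v" by (rule continuous_on_ae_primitive[OF v \<open>open U\<close> f(2)])
  have cw: "continuous_on U w" by (rule continuous_on_ae_primitive[OF w \<open>open U\<close> g(2)])
  have vw: "v x = w x" if xU: "x \<in> U" for x
  proof (rule ccontr)
    assume "v x \<noteq> w x"
    have "isCont (\<lambda>y. v y - w y) x" using cv cw xU \<open>open U\<close> by (simp add: continuous_on_eq_continuous_at)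
    then obtain d where d: "d > 0" "\<And>y. dist x y < d \<Longrightarrow> v y - w y \<noteq> 0"
      using continuous_at_avoid[of x "\<lambda>y. v y - w y" 0] \<open>v x \<noteq> w x\<close> by auto
    obtain d' where d': "d' > 0" "ball x d' \<subseteq> U" using openE[OF \<open>open U\<close> xU] .
    obtain z where "z \<notin> N1 \<union> N2" "dist x z < min d d'"
      using not_negligible_ball[of "N1 \<union> N2" "min d d'" x] N1 N2 d d' by (auto simp: negligible_Un)
    then show False using d(2)[of z] vu[rule_format, of z] wu[rule_format, of z] d' by auto
  qed
  obtain M1 where M1: "negligible M1" "\<forall>x h. x \<in> U - M1 \<longrightarrow> (\<forall>k. 0 < h k) \<longrightarrow> h \<longlonglongrightarrow> 0 \<longrightarrow> (\<lambda>k::nat. integral {x..x + h k} f / h k) \<longlonglongrightarrow> f x"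
    using one_sided_averages_tendsto[OF f(2) \<open>open U\<close>] .
  obtain M2 where M2: "negligible M2" "\<forall>x h. x \<in> U - M2 \<longrightarrow> (\<forall>k. 0 < h k) \<longrightarrow> h \<longlonglongrightarrow> 0 \<longrightarrow> (\<lambda>k::nat. integral {x..x + h k} g / h k) \<longlonglongrightarrow> g x"
    using one_sided_averages_tendsto[OF g(2) \<open>open U\<close>] .
  show thesis
  proof
    show "negligible (M1 \<union> M2)" using M1(1) M2(1) by (rule negligible_Un)
    show "\<forall>x\<in>U - (M1 \<union> M2). f x = g x"
    proof
    fix x assume x: "x \<in> U - (M1 \<union> M2)"
    then obtain d where d: "d > 0" "cball x d \<subseteq> U" using \<open>open U\<close> open_contains_cball by blast
    define h where "h k = d / real (Suc k)" for k
    have h: "0 < h k" "h k \<le> d" for k using d by (auto simp: h_def divide_le_eq mult_le_cancel_left1)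
    have h0: "h \<longlonglongrightarrow> 0" unfolding h_def using LIMSEQ_Suc[OF lim_const_over_n[of d]] by simp
    have "integral {x..x + h k} f = integral {x..x + h k} g" for k
    proof -
      have "{x..x + h k} \<subseteq> U" using d h[of k] by (auto simp: cball_def dist_real_def subset_iff)
      then show ?thesis using v[of x "x + h k"] w[of x "x + h k"] vw h[of k] by (auto simp: subset_iff)
    qed
    then have "(\<lambda>k. integral {x..x + h k} f / h k) \<longlonglongrightarrow> g x" using M2(2)[rule_format, OF _ h(1) h0, of x] x by simp
    moreover have "(\<lambda>k. integral {x..x + h k} f / h k) \<longlonglongrightarrow> f x" using M1(2)[rule_format, OF _ h(1) h0, of x] x by simp
    ultimately show "f x = g x" using LIMSEQ_unique by blast
    qed
  qed
qed

text \<open>Finitely many closed balls inside \<open>U\<close> cover a compact subset, so intervals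
  suffice; measurability on \<open>U\<close> comes from a compact exhaustion.\<close>

lemma locally_integrable_onI:
  assumes "open U" and f: "\<And>x y. {x..y} \<subseteq> U \<Longrightarrow> f absolutely_integrable_on {x..y}"
  shows "f locally_integrable_on U"
proof -
  have K: "f absolutely_integrable_on K" if K: "compact K" "K \<subseteq> U" for K
  proof -
    have "\<forall>x\<in>K. \<exists>d>0. cball x d \<subseteq> U" using \<open>open U\<close> K(2) open_contains_cball by blast
    then obtain d where d: "\<And>x. x \<in> K \<Longrightarrow> 0 < d x" "\<And>x. x \<in> K \<Longrightarrow> cball x (d x) \<subseteq> U" by metis
    obtain J where J: "J \<subseteq> K" "finite J" "K \<subseteq> (\<Union>x\<in>J. ball x (d x))"
      by (rule compactE_image[OF K(1), of K "\<lambda>x. ball x (d x)"]) (use d(1) in force)+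
    have "f absolutely_integrable_on (\<Union>x\<in>J. cball x (d x))"
    proof (rule set_integrable_UN[OF J(2)])
      show "f absolutely_integrable_on cball x (d x)" if "x \<in> J" for x
        using d(2) J(1) that f[of "x - d x" "x + d x"] by (auto simp: cball_eq_atLeastAtMost)
    qed auto
    then show ?thesis
    proof (rule set_integrable_subset)
      show "K \<in> sets lebesgue" using K(1) by (auto intro: lmeasurable_compact fmeasurableD)
      show "K \<subseteq> (\<Union>x\<in>J. cball x (d x))" using J(3) ball_subset_cball by blast
    qed
  qed
  obtain C :: "nat \<Rightarrow> real set" where C: "\<And>n. compact (C n)" "\<And>n. C n \<subseteq> U" "\<And>n. C n \<subseteq> interior (C (Suc n))"
    "\<Union>(range C) = U" "\<And>K. compact K \<Longrightarrow> K \<subseteq> U \<Longrightarrow> \<exists>N. \<forall>n\<ge>N. K \<subseteq> C n"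
    using open_Union_compact_subsets[OF \<open>open U\<close>] by metis
  have "(\<lambda>x. if x \<in> U then f x else 0) \<in> borel_measurable lebesgue"
  proof (rule borel_measurable_LIMSEQ_real)
    show "(\<lambda>x. indicator (C n) x * f x) \<in> borel_measurable lebesgue" for n
      using K[OF C(1,2)] by (simp add: set_integrable_def borel_measurable_integrable)
    fix x :: real
    show "(\<lambda>n. indicator (C n) x * f x) \<longlonglongrightarrow> (if x \<in> U then f x else 0)"
    proof (cases "x \<in> U")
      case True
      then obtain N where "\<forall>n\<ge>N. {x} \<subseteq> C n" using C(5)[of "{x}"] by auto
      then have "\<forall>\<^sub>F n in sequentially. indicator (C n) x * f x = f x"
        by (auto simp: eventually_sequentially intro!: exI[of _ N])
      then show ?thesis using True by (auto intro: tendsto_eventually)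
    next
      case False
      then have "x \<notin> C n" for n using C(2) by blast
      then have "(\<lambda>n. indicator (C n) x * f x) = (\<lambda>_. 0)" by simp
      then show ?thesis using False by simp
    qed
  qed
  then have "f \<in> borel_measurable (lebesgue_on U)"
    using borel_measurable_if_D by blast
  then show ?thesis using K by (simp add: locally_integrable_on_def)
qed

section \<open>The weight and Hoelder's inequality\<close>

lemma lebesgue_sets_intervals [measurable, simp]:
  fixes s t :: real
  shows "{s..t} \<in> sets lebesgue" "{s<..<t} \<in> sets lebesgue" "{s..<t} \<in> sets lebesgue"
  by (auto simp: borel_closed borel_open)

lemma AE_on_open:
  fixes U :: "real set"
  assumes "open U" and AE: "\<And>s t. {s..t} \<subseteq> U \<Longrightarrow> AE x in lebesgue. x \<in> {s..t} \<longrightarrow> P x"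
  shows "AE x in lebesgue. x \<in> U \<longrightarrow> P x"
proof -
  let ?Q = "{(q,r). q \<in> \<rat> \<and> r \<in> (\<rat> :: real set) \<and> {q..r} \<subseteq> U}"
  have "countable (\<rat> \<times> \<rat> :: (real \<times> real) set)" by (intro countable_SIGMA countable_rat)
  then have "countable ?Q" by (rule countable_subset[rotated]) auto
  then have "AE x in lebesgue. \<forall>i\<in>?Q. x \<in> {fst i..snd i} \<longrightarrow> P x"
  proof (subst AE_ball_countable, simp, intro ballI)
    fix i assume "i \<in> ?Q"
    then have "{fst i..snd i} \<subseteq> U" by auto
    then show "AE x in lebesgue. x \<in> {fst i..snd i} \<longrightarrow> P x" by (rule AE)
  qed
  then show ?thesis
  proof (rule eventually_mono)
    fix x assume *: "\<forall>i\<in>?Q. x \<in> {fst i..snd i} \<longrightarrow> P x"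
    show "x \<in> U \<longrightarrow> P x"
    proof
      assume xU: "x \<in> U"
      obtain d where d: "d > 0" "ball x d \<subseteq> U" using openE[OF \<open>open U\<close> xU] .
      obtain q where q: "q \<in> \<rat>" "x - d < q" "q < x" using Rats_dense_in_real[of "x - d" x] d by auto
      obtain r where r: "r \<in> \<rat>" "x < r" "r < x + d" using Rats_dense_in_real[of x "x + d"] d by auto
      have "{q..r} \<subseteq> U" using d q r by (auto simp: subset_iff dist_real_def)
      then have "(q,r) \<in> ?Q" using q r by simp
      then have "x \<in> {fst (q,r)..snd (q,r)} \<longrightarrow> P x" using * by blast
      then show "P x" using q r by simp
    qed
  qed
qed

lemma nn_set_integral_eq_integral:
  fixes f :: "real \<Rightarrow> real"
  assumes "f absolutely_integrable_on S" "\<And>x. x \<in> S \<Longrightarrow> 0 \<le> f x"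
  shows "(\<integral>\<^sup>+ x \<in> S. ennreal (f x) \<partial>lebesgue) = ennreal (integral S f)"
proof -
  have "(\<integral>\<^sup>+ x \<in> S. ennreal (f x) \<partial>lebesgue) = (\<integral>\<^sup>+ x. ennreal (indicator S x *\<^sub>R f x) \<partial>lebesgue)"
    by (intro nn_integral_cong) (auto simp: indicator_def)
  also have "\<dots> = ennreal (\<integral>x. indicator S x *\<^sub>R f x \<partial>lebesgue)"
    using assms by (intro nn_integral_eq_integral) (auto simp: set_integrable_def indicator_def)
  also have "(\<integral>x. indicator S x *\<^sub>R f x \<partial>lebesgue) = integral S f"
    using set_lebesgue_integral_eq_integral(2)[OF assms(1)] by (simp add: set_lebesgue_integral_def)
  finally show ?thesis .
qed

text \<open>The left side is the tangent line of the convex function y^p W at y = l W^(-1/(p-1)). It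
  is affine in \<open>y\<close> and in W^(-1/(p-1)), so it can be integrated or summed, with
  \<open>l\<close> chosen afterwards.\<close>

lemma powr_tangent_le:
  fixes p y l W :: real
  assumes "1 < p" "0 \<le> y" "0 < l" "0 < W"
  shows "p * l powr (p - 1) * y - (p - 1) * l powr p * W powr (- 1 / (p - 1)) \<le> y powr p * W"
proof -
  define s where "s = W powr (- 1 / (p - 1))"
  have s: "0 < s" using assms by (simp add: s_def)
  have "- 1 / (p - 1) * (1 - p) = 1" using assms by (simp add: field_simps)
  then have sW: "s powr (1 - p) = W" using assms by (simp add: s_def powr_powr)
  define q where "q = p / (p - 1)"
  have "y / s * l powr (p - 1) \<le> (y / s) powr p / p + (l powr (p - 1)) powr q / q"
    using assms s by (intro Youngs_inequality) (auto simp: q_def divide_simps)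
  moreover have "(l powr (p - 1)) powr q = l powr p" using assms by (simp add: powr_powr q_def)
  moreover have "(y / s) powr p = y powr p * W / s"
  proof -
    have "s powr p = s / W" using sW s assms by (simp add: powr_diff field_simps)
    then show ?thesis using assms s by (simp add: powr_divide)
  qed
  ultimately have "y / s * l powr (p - 1) \<le> y powr p * W / s / p + l powr p / q" by simp
  then have "(p * s) * (y / s * l powr (p - 1)) \<le> (p * s) * (y powr p * W / s / p + l powr p / q)"
    using assms s by (intro mult_left_mono) auto
  also have "\<dots> = y powr p * W + (p - 1) * l powr p * s"
    using assms s by (simp add: q_def field_simps)
  also have "(p * s) * (y / s * l powr (p - 1)) = p * l powr (p - 1) * y" using s by simp
  finally show ?thesis by (simp add: s_def)
qed

locale degenerate_weight =
  fixes p a b :: real and w :: "real \<Rightarrow> real"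
  assumes p_gt_1: "1 < p" and a_less_b: "a < b"
    and w_loc: "w locally_integrable_on UNIV"
begin

abbreviation regular_set ("\<I>") where "\<I> \<equiv> I_set p {a<..<b} w"

text \<open>A real-valued version of \<open>inv_weight\<close>, with 0 in place of \<infinity>. The
  two agree almost everywhere on \<open>\<I>\<close> by \<open>w_pos_AE\<close>; off
  \<open>\<I>\<close> this function may be integrable where \<open>inv_weight\<close> is
  not.\<close>

definition \<sigma> :: "real \<Rightarrow> real"
  where "\<sigma> x = (if 0 < w x then w x powr (- 1 / (p - 1)) else 0)"

definition energy :: "(real \<Rightarrow> real) \<Rightarrow> ennreal"
  where "energy g = (\<integral>\<^sup>+ x \<in> \<I>. ennreal (\<bar>g x\<bar> powr p * w x) \<partial>lebesgue)"

lemma open_I: "open \<I>"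
  by (rule I_set_open) simp

lemma I_subset: "\<I> \<subseteq> {a<..<b}"
  by (auto simp: I_set_def)

lemma I_sets [measurable]: "\<I> \<in> sets lebesgue"
  using open_I by (auto intro: borel_open)

lemma w_measurable [measurable]: "w \<in> borel_measurable lebesgue"
  using w_loc by (simp add: locally_integrable_on_def lebesgue_on_UNIV_eq)

lemma \<sigma>_measurable [measurable]: "\<sigma> \<in> borel_measurable lebesgue"
  unfolding \<sigma>_def[abs_def] by measurable

lemma inv_weight_measurable [measurable]: "inv_weight p w \<in> borel_measurable lebesgue"
  unfolding inv_weight_def[abs_def] by measurable

lemma \<sigma>_nonneg: "0 \<le> \<sigma> x"
  by (simp add: \<sigma>_def)

lemma inv_weight_eq_\<sigma>: "0 < w x \<Longrightarrow> inv_weight p w x = ennreal (\<sigma> x)"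
  by (simp add: inv_weight_def \<sigma>_def)

text \<open>A finite subcover of [s,t] by neighbourhoods of finite integral.\<close>

lemma inv_weight_integral_finite:
  assumes "{s..t} \<subseteq> \<I>"
  shows "(\<integral>\<^sup>+ x \<in> {s..t}. inv_weight p w x \<partial>lebesgue) < \<infinity>"
proof -
  have "\<forall>x\<in>{s..t}. \<exists>e>0. (\<integral>\<^sup>+ y \<in> {x - e<..<x + e}. inv_weight p w y \<partial>lebesgue) < \<infinity>"
    using assms by (auto simp: I_set_def)
  then obtain e where e: "\<And>x. x \<in> {s..t} \<Longrightarrow> 0 < e x"
    "\<And>x. x \<in> {s..t} \<Longrightarrow> (\<integral>\<^sup>+ y \<in> {x - e x<..<x + e x}. inv_weight p w y \<partial>lebesgue) < \<infinity>" by metis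
  obtain J where J: "J \<subseteq> {s..t}" "finite J" "{s..t} \<subseteq> (\<Union>x\<in>J. {x - e x<..<x + e x})"
  proof -
    have "{s..t} \<subseteq> (\<Union>x\<in>{s..t}. {x - e x<..<x + e x})" using e(1) by force
    from compactE_image[OF compact_Icc _ this] show thesis using that by (metis open_greaterThanLessThan)
  qed
  have "(\<integral>\<^sup>+ x \<in> {s..t}. inv_weight p w x \<partial>lebesgue)
      \<le> (\<integral>\<^sup>+ y. (\<Sum>x\<in>J. inv_weight p w y * indicator {x - e x<..<x + e x} y) \<partial>lebesgue)"
  proof (rule nn_integral_mono)
    fix y
    show "inv_weight p w y * indicator {s..t} y \<le> (\<Sum>x\<in>J. inv_weight p w y * indicator {x - e x<..<x + e x} y)"
    proof (cases "y \<in> {s..t}")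
      case True
      then obtain x where x: "x \<in> J" "y \<in> {x - e x<..<x + e x}" using J(3) by blast
      then have "inv_weight p w y * indicator {s..t} y = inv_weight p w y * indicator {x - e x<..<x + e x} y"
        using True by simp
      also have "\<dots> \<le> (\<Sum>x\<in>J. inv_weight p w y * indicator {x - e x<..<x + e x} y)"
        using J(2) x(1) by (intro member_le_sum) auto
      finally show ?thesis .
    qed simp
  qed
  also have "\<dots> = (\<Sum>x\<in>J. \<integral>\<^sup>+ y \<in> {x - e x<..<x + e x}. inv_weight p w y \<partial>lebesgue)"
    by (rule nn_integral_sum) simp
  also have "\<dots> < \<infinity>" using J e(2) by (auto simp: subset_iff)
  finally show ?thesis .
qed

text \<open>\<open>inv_weight\<close> has finite integral over compact intervals in
  \<open>\<I>\<close>, so it is finite almost everywhere, and it is infinite exactly where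
  \<open>w\<close> is not positive.\<close>

lemma w_pos_AE: "AE x in lebesgue. x \<in> \<I> \<longrightarrow> 0 < w x"
proof (rule AE_on_open[OF open_I])
  fix s t assume "{s..t} \<subseteq> \<I>"
  then have "AE x in lebesgue. inv_weight p w x * indicator {s..t} x \<noteq> \<infinity>"
    using inv_weight_integral_finite by (intro nn_integral_PInf_AE) (auto simp: less_top)
  then show "AE x in lebesgue. x \<in> {s..t} \<longrightarrow> 0 < w x"
    by (rule eventually_mono) (auto simp: inv_weight_def split: if_splits)
qed

lemma inv_weight_integral_eq:
  assumes "{s..t} \<subseteq> \<I>"
  shows "(\<integral>\<^sup>+ x \<in> {s..t}. inv_weight p w x \<partial>lebesgue) = (\<integral>\<^sup>+ x \<in> {s..t}. ennreal (\<sigma> x) \<partial>lebesgue)"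
  by (rule nn_integral_cong_AE, use w_pos_AE in eventually_elim) (use assms in \<open>auto simp: indicator_def inv_weight_eq_\<sigma>\<close>)

lemma \<sigma>_absolutely_integrable:
  assumes "{s..t} \<subseteq> \<I>"
  shows "\<sigma> absolutely_integrable_on {s..t}"
  unfolding set_integrable_def
proof (rule integrableI_nonneg)
  show "(\<lambda>x. indicator {s..t} x *\<^sub>R \<sigma> x) \<in> borel_measurable lebesgue" by measurable
  show "AE x in lebesgue. 0 \<le> indicator {s..t} x *\<^sub>R \<sigma> x" by (simp add: \<sigma>_nonneg)
  have "(\<integral>\<^sup>+ x. ennreal (indicator {s..t} x *\<^sub>R \<sigma> x) \<partial>lebesgue) = (\<integral>\<^sup>+ x \<in> {s..t}. ennreal (\<sigma> x) \<partial>lebesgue)"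
    by (intro nn_integral_cong) (auto simp: indicator_def)
  then show "(\<integral>\<^sup>+ x. ennreal (indicator {s..t} x *\<^sub>R \<sigma> x) \<partial>lebesgue) < \<infinity>"
    using inv_weight_integral_finite[OF assms] inv_weight_integral_eq[OF assms] by simp
qed

lemma \<sigma>_locally_integrable: "\<sigma> locally_integrable_on \<I>"
  by (intro locally_integrable_onI open_I \<sigma>_absolutely_integrable)

lemma inv_weight_integral:
  assumes "{s..t} \<subseteq> \<I>"
  shows "(\<integral>\<^sup>+ x \<in> {s..t}. inv_weight p w x \<partial>lebesgue) = ennreal (integral {s..t} \<sigma>)"
  using inv_weight_integral_eq[OF assms] nn_set_integral_eq_integral[OF \<sigma>_absolutely_integrable[OF assms]] \<sigma>_nonneg by simp

lemma \<sigma>_integrable: "{s..t} \<subseteq> \<I> \<Longrightarrow> \<sigma> integrable_on {s..t}"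
  by (rule locally_integrable_on_imp_integrable[OF \<sigma>_locally_integrable])

text \<open>\<open>inv_weight\<close> vanishes nowhere, so a zero integral would make the interval a
  null set.\<close>

lemma \<sigma>_integral_pos:
  assumes "{s..t} \<subseteq> \<I>" "s < t"
  shows "0 < integral {s..t} \<sigma>"
proof (rule ccontr)
  assume "\<not> 0 < integral {s..t} \<sigma>"
  then have "integral {s..t} \<sigma> = 0"
    using integral_nonneg[OF \<sigma>_integrable[OF assms(1)] \<sigma>_nonneg] by linarith
  then have "(\<integral>\<^sup>+ x \<in> {s..t}. inv_weight p w x \<partial>lebesgue) = 0"
    using inv_weight_integral[OF assms(1)] by simp
  then have "AE x in lebesgue. inv_weight p w x * indicator {s..t} x = 0"
    by (subst (asm) nn_integral_0_iff_AE) auto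
  then have "AE x in lebesgue. x \<notin> {s..t}"
    by (rule eventually_mono) (auto simp: inv_weight_def indicator_def split: if_splits)
  then have "{s..t} \<in> null_sets lebesgue" by (subst AE_iff_null_sets) auto
  then have "emeasure lebesgue {s..t} = 0" by (rule null_setsD1)
  then show False using assms(2) by simp
qed

lemma energy_density_measurable:
  assumes "g \<in> borel_measurable (lebesgue_on \<I>)" "S \<subseteq> \<I>" "S \<in> sets lebesgue"
  shows "(\<lambda>x. ennreal (\<bar>g x\<bar> powr p * w x) * indicator S x) \<in> borel_measurable lebesgue"
proof -
  have "(\<lambda>x. if x \<in> \<I> then g x else 0) \<in> borel_measurable lebesgue"
    using assms(1) by (simp add: borel_measurable_if)
  then have "(\<lambda>x. ennreal (\<bar>if x \<in> \<I> then g x else 0\<bar> powr p * w x) * indicator S x) \<in> borel_measurable lebesgue"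
    using assms(3) by measurable
  moreover have "(\<lambda>x. ennreal (\<bar>if x \<in> \<I> then g x else 0\<bar> powr p * w x) * indicator S x)
     = (\<lambda>x. ennreal (\<bar>g x\<bar> powr p * w x) * indicator S x)"
  proof
    show "ennreal (\<bar>if x \<in> \<I> then g x else 0\<bar> powr p * w x) * indicator S x = ennreal (\<bar>g x\<bar> powr p * w x) * indicator S x" for x
      using assms(2) by (cases "x \<in> S") auto
  qed
  ultimately show ?thesis by simp
qed

text \<open>Hoelder's inequality for the product of |g| w^(1/p) and w^(-1/p), obtained by
  integrating the tangent inequality \<open>powr_tangent_le\<close>.\<close>

lemma Hoelder_increment:
  assumes sub: "{s..t} \<subseteq> \<I>" and "s < t" and g: "g absolutely_integrable_on {s..t}"
  shows "ennreal (\<bar>integral {s..t} g\<bar> powr p / integral {s..t} \<sigma> powr (p - 1))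
    \<le> (\<integral>\<^sup>+ x \<in> {s..t}. ennreal (\<bar>g x\<bar> powr p * w x) \<partial>lebesgue)"
proof (cases "integral {s..t} g = 0")
  case True
  then show ?thesis by simp
next
  case False
  \<comment> \<open>The optimal slope: for l = X/S both l^(p-1) X and l^p S equal X^p / S^(p-1), and
    they enter with coefficients p and -(p-1).\<close>
  define X S l where "X = \<bar>integral {s..t} g\<bar>" and "S = integral {s..t} \<sigma>" and "l = X / S"
  have pos: "0 < X" "0 < S" "0 < l"
    using False \<sigma>_integral_pos[OF sub \<open>s < t\<close>] by (auto simp: X_def S_def l_def)
  define f where "f x = p * l powr (p - 1) * \<bar>g x\<bar> - (p - 1) * l powr p * \<sigma> x" for x
  have gabs: "(\<lambda>x. \<bar>g x\<bar>) absolutely_integrable_on {s..t}"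
    using absolutely_integrable_abs[OF g] by simp
  have f: "f absolutely_integrable_on {s..t}"
    unfolding f_def[abs_def] using gabs \<sigma>_absolutely_integrable[OF sub]
    by (intro set_integral_diff(1) set_integrable_mult_right) auto
  \<comment> \<open>\<open>f\<close> may be negative while nonnegative integrals are compared; its
    positive part is still below the energy density.\<close>
  have mf: "(\<lambda>x. max 0 (f x)) absolutely_integrable_on {s..t}"
    using f by (intro absolutely_integrable_max_1) auto
  have "X \<le> integral {s..t} (\<lambda>x. \<bar>g x\<bar>)"
    unfolding X_def using integral_norm_bound_integral[of g "{s..t}" "\<lambda>x. \<bar>g x\<bar>"]
      set_lebesgue_integral_eq_integral(1)[OF g] set_lebesgue_integral_eq_integral(1)[OF gabs] by simp
  have Xl: "l powr (p - 1) * X = X powr p / S powr (p - 1)" "l powr p * S = X powr p / S powr (p - 1)"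
    using pos by (simp_all add: l_def powr_divide powr_diff field_simps)
  have "X powr p / S powr (p - 1) = p * (l powr (p - 1) * X) - (p - 1) * (l powr p * S)"
  proof -
    have "c = p * c - (p - 1) * c" for c by (simp add: algebra_simps)
    then show ?thesis unfolding Xl .
  qed
  also have "\<dots> = p * l powr (p - 1) * X - (p - 1) * l powr p * S" by simp
  also have "\<dots> \<le> p * l powr (p - 1) * integral {s..t} (\<lambda>x. \<bar>g x\<bar>) - (p - 1) * l powr p * S"
    using \<open>X \<le> integral {s..t} (\<lambda>x. \<bar>g x\<bar>)\<close> p_gt_1 by (intro diff_right_mono mult_left_mono) auto
  also have "\<dots> = integral {s..t} f"
    unfolding f_def[abs_def] S_def
    by (subst Henstock_Kurzweil_Integration.integral_diff)
      (auto intro!: integrable_on_mult_right set_lebesgue_integral_eq_integral(1)[OF gabs] \<sigma>_integrable[OF sub])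
  also have "\<dots> \<le> integral {s..t} (\<lambda>x. max 0 (f x))"
    by (intro integral_le set_lebesgue_integral_eq_integral(1) f mf) auto
  finally have "ennreal (X powr p / S powr (p - 1)) \<le> ennreal (integral {s..t} (\<lambda>x. max 0 (f x)))"
    by (rule ennreal_leI)
  also have "\<dots> = (\<integral>\<^sup>+ x \<in> {s..t}. ennreal (max 0 (f x)) \<partial>lebesgue)"
    by (rule nn_set_integral_eq_integral[OF mf, symmetric]) simp
  also have "\<dots> \<le> (\<integral>\<^sup>+ x \<in> {s..t}. ennreal (\<bar>g x\<bar> powr p * w x) \<partial>lebesgue)"
  proof (rule nn_integral_mono_AE, use w_pos_AE in eventually_elim)
    fix x assume x: "x \<in> \<I> \<longrightarrow> 0 < w x"
    show "ennreal (max 0 (f x)) * indicator {s..t} x \<le> ennreal (\<bar>g x\<bar> powr p * w x) * indicator {s..t} x"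
    proof (cases "x \<in> {s..t}")
      case True
      then have wx: "0 < w x" using x sub by blast
      then have "f x \<le> \<bar>g x\<bar> powr p * w x"
        using powr_tangent_le[OF p_gt_1 abs_ge_zero pos(3) wx] by (simp add: f_def \<sigma>_def)
      moreover have "0 \<le> \<bar>g x\<bar> powr p * w x" using wx by simp
      ultimately show ?thesis using True by (simp add: ennreal_leI)
    qed simp
  qed
  finally show ?thesis by (simp add: X_def S_def)
qed

lemma sum_increments_le_energy:
  assumes fin: "finite K" and sub: "\<And>i. i \<in> K \<Longrightarrow> {s i..t i} \<subseteq> \<I>" "\<And>i. i \<in> K \<Longrightarrow> s i < t i"
    and disj: "disjoint_family_on (\<lambda>i. {s i<..<t i}) K" and g: "g locally_integrable_on \<I>"
  shows "(\<Sum>i\<in>K. ennreal (\<bar>integral {s i..t i} g\<bar> powr p / integral {s i..t i} \<sigma> powr (p - 1))) \<le> energy g"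
proof -
  let ?e = "\<lambda>x. ennreal (\<bar>g x\<bar> powr p * w x)"
  have gm: "g \<in> borel_measurable (lebesgue_on \<I>)" using g by (simp add: locally_integrable_on_def)
  have Ioo: "{s i<..<t i} \<subseteq> \<I>" if "i \<in> K" for i
    using sub(1)[OF that] greaterThanLessThan_subseteq_atLeastAtMost_iff by fastforce
  have "(\<Sum>i\<in>K. ennreal (\<bar>integral {s i..t i} g\<bar> powr p / integral {s i..t i} \<sigma> powr (p - 1)))
      \<le> (\<Sum>i\<in>K. \<integral>\<^sup>+ x \<in> {s i..t i}. ?e x \<partial>lebesgue)"
    using sub locally_integrable_on_Icc[OF g] by (intro sum_mono Hoelder_increment) auto
  \<comment> \<open>Only the open intervals are disjoint; their endpoints form a null set.\<close>
  also have "\<dots> = (\<Sum>i\<in>K. \<integral>\<^sup>+ x \<in> {s i<..<t i}. ?e x \<partial>lebesgue)"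
  proof (intro sum.cong refl nn_integral_cong_AE)
    fix i
    have "{s i, t i} \<in> null_sets lebesgue" by (intro negligible_iff_null_sets[THEN iffD1]) simp
    then have "AE x in lebesgue. x \<notin> {s i, t i}" by (rule AE_not_in)
    then show "AE x in lebesgue. ?e x * indicator {s i..t i} x = ?e x * indicator {s i<..<t i} x"
      by (rule eventually_mono) (auto simp: indicator_def)
  qed
  also have "\<dots> = (\<integral>\<^sup>+ x. (\<Sum>i\<in>K. ?e x * indicator {s i<..<t i} x) \<partial>lebesgue)"
    using Ioo by (intro nn_integral_sum[symmetric] energy_density_measurable[OF gm]) auto
  also have "\<dots> \<le> energy g"
    unfolding energy_def
  proof (rule nn_integral_mono)
    fix x
    show "(\<Sum>i\<in>K. ?e x * indicator {s i<..<t i} x) \<le> ?e x * indicator \<I> x"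
    proof (cases "\<exists>j\<in>K. x \<in> {s j<..<t j}")
      case True
      then obtain j where j: "j \<in> K" "x \<in> {s j<..<t j}" by blast
      then have "x \<notin> {s i<..<t i}" if "i \<in> K" "i \<noteq> j" for i
        using disj that j unfolding disjoint_family_on_def by blast
      then have "(\<Sum>i\<in>K. ?e x * indicator {s i<..<t i} x) = (\<Sum>i\<in>K. if i = j then ?e x else 0)"
        using j by (intro sum.cong) auto
      then show ?thesis using fin j Ioo by (simp add: subset_iff)
    next
      case False
      then have "(\<Sum>i\<in>K. ?e x * indicator {s i<..<t i} x) = 0" by (intro sum.neutral) auto
      then show ?thesis by simp
    qed
  qed
  finally show ?thesis .
qed

end

section \<open>Lower semicontinuity of the energy\<close>

context degenerate_weight
begin

lemma \<sigma>_integral_nonneg: "{s..t} \<subseteq> \<I> \<Longrightarrow> 0 \<le> integral {s..t} \<sigma>"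
  by (intro integral_nonneg \<sigma>_integrable \<sigma>_nonneg)

lemma \<sigma>_integral_small:
  assumes "x \<in> \<I>" "0 < \<eta>"
  obtains d where "0 < d" "{x..x + d} \<subseteq> \<I>" "\<And>z. z \<in> {x..x + d} \<Longrightarrow> integral {x..z} \<sigma> < \<eta>"
proof -
  obtain r where r: "0 < r" "cball x r \<subseteq> \<I>" using open_I assms(1) open_contains_cball by blast
  have sub: "{x..x + r} \<subseteq> \<I>" using r by (auto simp: cball_def dist_real_def subset_iff)
  have "continuous_on {x..x + r} (\<lambda>z. integral {x..z} \<sigma>)"
    by (intro indefinite_integral_continuous_1 \<sigma>_integrable sub)
  then obtain d where d: "0 < d" "\<And>z. z \<in> {x..x + r} \<Longrightarrow> dist z x < d \<Longrightarrow> dist (integral {x..z} \<sigma>) (integral {x..x} \<sigma>) < \<eta>"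
    using r(1) assms(2) unfolding continuous_on_iff by (metis atLeastAtMost_iff less_eq_real_def add_increasing2)
  show thesis
  proof
    show "0 < min r (d / 2)" using r d by simp
    have "{x..x + min r (d / 2)} \<subseteq> {x..x + r}" by auto
    then show "{x..x + min r (d / 2)} \<subseteq> \<I>" using sub by blast
    show "integral {x..z} \<sigma> < \<eta>" if "z \<in> {x..x + min r (d / 2)}" for z
    proof -
      have "z \<in> {x..x + r}" "z \<le> x + d / 2" "x \<le> z" using that by auto
      then have "\<bar>integral {x..z} \<sigma>\<bar> < \<eta>" using d(2)[of z] d(1) by (simp add: dist_real_def)
      then show ?thesis by simp
    qed
  qed
qed

text \<open>The energy bound makes the functions equicontinuous at each point of
  \<open>\<I>\<close>: |v(z) - v(x)|^p is at most C times the (p-1)-th power of the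
  \<sigma>-integral between them. Points off \<open>N\<close> lie arbitrarily close to every
  \<open>x\<close>, so convergence there forces Cauchy sequences everywhere, and partition sums can
  use arbitrary endpoints.\<close>

lemma energy_bounded_pointwise_convergent:
  fixes v :: "nat \<Rightarrow> real \<Rightarrow> real"
  assumes v: "\<And>n x y. x \<le> y \<Longrightarrow> {x..y} \<subseteq> \<I> \<Longrightarrow> v n y - v n x = integral {x..y} (g n)"
    and g: "\<And>n. g n locally_integrable_on \<I>"
    and en: "\<And>n. energy (g n) \<le> ennreal C" "0 \<le> C"
    and "negligible N" and lim: "\<And>x. x \<in> \<I> - N \<Longrightarrow> (\<lambda>n. v n x) \<longlonglongrightarrow> u x"
  obtains U where "\<And>x. x \<in> \<I> \<Longrightarrow> (\<lambda>n. v n x) \<longlonglongrightarrow> U x"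
proof -
  have single: "\<bar>v n z - v n x\<bar> powr p \<le> C * integral {x..z} \<sigma> powr (p - 1)" if "x < z" "{x..z} \<subseteq> \<I>" for n x z
  proof -
    have pos: "0 < integral {x..z} \<sigma>" by (rule \<sigma>_integral_pos[OF that(2,1)])
    have "ennreal (\<bar>integral {x..z} (g n)\<bar> powr p / integral {x..z} \<sigma> powr (p - 1)) \<le> energy (g n)"
      using sum_increments_le_energy[of "{()}" "\<lambda>_. x" "\<lambda>_. z" "g n"] that g by (simp add: disjoint_family_on_def)
    also have "\<dots> \<le> ennreal C" by (rule en)
    finally have "\<bar>integral {x..z} (g n)\<bar> powr p / integral {x..z} \<sigma> powr (p - 1) \<le> C"
      using en(2) by (simp add: ennreal_le_iff)
    then show ?thesis using v[of x z n] that pos by (simp add: pos_divide_le_eq)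
  qed
  have "convergent (\<lambda>n. v n x)" if x: "x \<in> \<I>" for x
  proof (rule Cauchy_convergent, rule CauchyI)
    fix e :: real assume "0 < e"
    \<comment> \<open>Solves (C + 1) \<eta>^(p-1) = (e/4)^p; the summand 1 avoids division by zero
      and makes the later comparison strict.\<close>
    define \<eta> where "\<eta> = ((e / 4) powr p / (C + 1)) powr (1 / (p - 1))"
    have "0 < \<eta>" using \<open>0 < e\<close> en(2) by (simp add: \<eta>_def)
    obtain d where d: "0 < d" "{x..x + d} \<subseteq> \<I>" "\<And>z. z \<in> {x..x + d} \<Longrightarrow> integral {x..z} \<sigma> < \<eta>"
      using \<sigma>_integral_small[OF x \<open>0 < \<eta>\<close>] by metis
    obtain z where z: "z \<notin> N" "dist (x + d / 2) z < d / 2" using not_negligible_ball[OF \<open>negligible N\<close>, of "d / 2" "x + d / 2"] d(1) by auto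
    then have zx: "x < z" "z \<le> x + d" by (auto simp: dist_real_def abs_if split: if_splits)
    have sub: "{x..z} \<subseteq> \<I>" using d(2) zx by auto
    have close: "\<bar>v n z - v n x\<bar> < e / 4" for n
    proof -
      have "\<bar>v n z - v n x\<bar> powr p \<le> C * integral {x..z} \<sigma> powr (p - 1)" by (rule single[OF zx(1) sub])
      also have "\<dots> \<le> C * \<eta> powr (p - 1)"
        using d(3)[of z] zx en(2) \<sigma>_integral_nonneg[OF sub] p_gt_1 by (intro mult_left_mono powr_mono2) auto
      also have "\<eta> powr (p - 1) = (e / 4) powr p / (C + 1)"
        using p_gt_1 \<open>0 < e\<close> en(2) by (simp add: \<eta>_def powr_powr)
      also have "C * ((e / 4) powr p / (C + 1)) < (e / 4) powr p"
        using en(2) \<open>0 < e\<close> by (simp add: field_simps)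
      finally have "\<bar>v n z - v n x\<bar> powr p < (e / 4) powr p" .
      moreover have "(e / 4) powr p \<le> \<bar>v n z - v n x\<bar> powr p" if "e / 4 \<le> \<bar>v n z - v n x\<bar>"
        using that p_gt_1 \<open>0 < e\<close> by (intro powr_mono2) auto
      ultimately show ?thesis by linarith
    qed
    have "z \<in> \<I> - N" using sub zx z by auto
    then have "Cauchy (\<lambda>n. v n z)" using lim LIMSEQ_imp_Cauchy by blast
    then obtain M where M: "\<And>m n. m \<ge> M \<Longrightarrow> n \<ge> M \<Longrightarrow> norm (v m z - v n z) < e / 4"
      using \<open>0 < e\<close> by (metis CauchyD zero_less_divide_iff zero_less_numeral)
    have "norm (v m x - v n x) < e" if "m \<ge> M" "n \<ge> M" for m n
    proof -
      have "\<bar>v m x - v n x\<bar> \<le> \<bar>v m z - v m x\<bar> + \<bar>v n z - v n x\<bar> + \<bar>v m z - v n z\<bar>" by linarith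
      also have "\<dots> < e" using close[of m] close[of n] M[OF that, unfolded real_norm_def] \<open>0 < e\<close> by linarith
      finally show ?thesis by simp
    qed
    then show "\<exists>M. \<forall>m\<ge>M. \<forall>n\<ge>M. norm (v m x - v n x) < e" by blast
  qed
  then have "\<exists>l. (\<lambda>n. v n x) \<longlonglongrightarrow> l" if "x \<in> \<I>" for x using that by (simp add: convergent_def)
  then show thesis using that by metis
qed

text \<open>The tangent inequality with W = S^(-(p-1)), for which W^(-1/(p-1)) = S, bounds A |u(t) -
  u(s)| by the partition summand plus B S, where \<open>S\<close> is the \<sigma>-integral. A large
  \<open>A\<close> absorbs \<open>C\<close>, and the sum of the \<open>S\<close> is small because
  the indefinite integral of \<sigma> is absolutely continuous.\<close>

lemma increments_bound_imp_AC:
  assumes sums: "\<And>(K :: (real \<times> real) set) s t. finite K \<Longrightarrow> (\<And>i. i \<in> K \<Longrightarrow> {s i..t i} \<subseteq> \<I>) \<Longrightarrow> (\<And>i. i \<in> K \<Longrightarrow> s i < t i)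
      \<Longrightarrow> disjoint_family_on (\<lambda>i. {s i<..<t i}) K
      \<Longrightarrow> (\<Sum>i\<in>K. \<bar>u (t i) - u (s i)\<bar> powr p / integral {s i..t i} \<sigma> powr (p - 1)) \<le> C"
    and "0 \<le> C" and sub: "{c..d} \<subseteq> \<I>"
  shows "u \<in> AC c d"
proof (rule AC_I)
  fix \<epsilon> :: real assume "0 < \<epsilon>"
  \<comment> \<open>\<open>l\<close> is chosen so that p l^(p-1) = A, with \<open>A\<close> so large
    that 4 C \<le> \<epsilon> A. Then \<open>C\<close> costs at most a quarter of \<epsilon> A, and
    the choice of \<open>\<eta>\<close> keeps the other term below another quarter.\<close>
  define A where "A = p * (4 * C / (p * \<epsilon>) + 1)"
  define l where "l = (4 * C / (p * \<epsilon>) + 1) powr (1 / (p - 1))"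
  define B where "B = (p - 1) * l powr p"
  have base: "0 < 4 * C / (p * \<epsilon>) + 1" using \<open>0 \<le> C\<close> p_gt_1 \<open>0 < \<epsilon>\<close> by (simp add: add_nonneg_pos)
  then have l: "0 < l" and A: "p * l powr (p - 1) = A" "0 < A"
    using p_gt_1 by (simp_all add: l_def A_def powr_powr)
  have B: "0 \<le> B" using p_gt_1 by (simp add: B_def)
  have CA: "4 * C \<le> \<epsilon> * A" using p_gt_1 \<open>0 < \<epsilon>\<close> by (simp add: A_def field_simps)
  define \<eta> where "\<eta> = A * \<epsilon> / (4 * (B + 1))"
  have "0 < \<eta>" using A B \<open>0 < \<epsilon>\<close> by (simp add: \<eta>_def)
  have ac: "(\<lambda>x. integral {c..x} \<sigma>) \<in> AC c d"
    by (rule AC_indefinite_integral[OF \<sigma>_absolutely_integrable[OF sub], of _ 0]) simp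
  obtain \<delta> where \<delta>: "0 < \<delta>" "\<And>(K :: (real \<times> real) set) s t. nonoverlapping c d K s t \<Longrightarrow> (\<Sum>i\<in>K. t i - s i) < \<delta>
    \<Longrightarrow> (\<Sum>i\<in>K. \<bar>integral {c..t i} \<sigma> - integral {c..s i} \<sigma>\<bar>) < \<eta>"
    by (rule AC_D[OF ac \<open>0 < \<eta>\<close>]) (rule that; blast)
  have "(\<Sum>i\<in>K. \<bar>u (t i) - u (s i)\<bar>) < \<epsilon>"
    if K: "nonoverlapping c d K s t" and len: "(\<Sum>i\<in>K. t i - s i) < \<delta>" for K :: "(real \<times> real) set" and s t
  proof -
    define J where "J = {i\<in>K. s i < t i}"
    have J: "finite J" "J \<subseteq> K" using K by (auto simp: J_def nonoverlapping_def)
    have st: "c \<le> s i" "s i \<le> t i" "t i \<le> d" if "i \<in> K" for i using K that by (auto simp: nonoverlapping_def)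
    have Jsub: "{s i..t i} \<subseteq> \<I>" "s i < t i" if "i \<in> J" for i
    proof -
      have "{s i..t i} \<subseteq> {c..d}" using st[of i] that J by auto
      then show "{s i..t i} \<subseteq> \<I>" using sub by blast
      show "s i < t i" using that by (simp add: J_def)
    qed
    have one: "A * \<bar>u (t i) - u (s i)\<bar> \<le> \<bar>u (t i) - u (s i)\<bar> powr p / integral {s i..t i} \<sigma> powr (p - 1) + B * integral {s i..t i} \<sigma>"
      if "i \<in> J" for i
    proof -
      define S where "S = integral {s i..t i} \<sigma>"
      have S: "0 < S" unfolding S_def by (rule \<sigma>_integral_pos[OF Jsub[OF that]])
      have T: "p * l powr (p - 1) * \<bar>u (t i) - u (s i)\<bar> - (p - 1) * l powr p * (S powr - (p - 1)) powr (- 1 / (p - 1))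
          \<le> \<bar>u (t i) - u (s i)\<bar> powr p * S powr - (p - 1)"
        using S by (intro powr_tangent_le[OF p_gt_1 _ l]) auto
      have "- (p - 1) * (- 1 / (p - 1)) = 1" using p_gt_1 by (simp add: field_simps)
      then have eq1: "(S powr - (p - 1)) powr (- 1 / (p - 1)) = S" using S by (simp only: powr_powr) simp
      have eq2: "S powr - (p - 1) = 1 / S powr (p - 1)" by (rule powr_minus_divide)
      show ?thesis using T[unfolded eq1 A(1), unfolded eq2] by (simp add: B_def S_def)
    qed
    have "A * (\<Sum>i\<in>K. \<bar>u (t i) - u (s i)\<bar>) = A * (\<Sum>i\<in>J. \<bar>u (t i) - u (s i)\<bar>)"
    proof (intro arg_cong[where f = "\<lambda>r. A * r"] sum.mono_neutral_right)
      show "finite K" using K by (simp add: nonoverlapping_def)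
      show "\<forall>i\<in>K - J. \<bar>u (t i) - u (s i)\<bar> = 0"
      proof
        fix i assume "i \<in> K - J"
        then have "s i = t i" using st[of i] by (auto simp: J_def)
        then show "\<bar>u (t i) - u (s i)\<bar> = 0" by simp
      qed
    qed fact
    also have "\<dots> \<le> (\<Sum>i\<in>J. \<bar>u (t i) - u (s i)\<bar> powr p / integral {s i..t i} \<sigma> powr (p - 1) + B * integral {s i..t i} \<sigma>)"
      unfolding sum_distrib_left by (rule sum_mono) (rule one)
    also have "\<dots> = (\<Sum>i\<in>J. \<bar>u (t i) - u (s i)\<bar> powr p / integral {s i..t i} \<sigma> powr (p - 1)) + B * (\<Sum>i\<in>J. integral {s i..t i} \<sigma>)"
      by (simp add: sum.distrib sum_distrib_left)
    also have "\<dots> \<le> C + B * \<eta>"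
    proof (rule add_mono)
      show "(\<Sum>i\<in>J. \<bar>u (t i) - u (s i)\<bar> powr p / integral {s i..t i} \<sigma> powr (p - 1)) \<le> C"
        using J Jsub K by (intro sums) (auto simp: nonoverlapping_def intro: disjoint_family_on_mono)
      have "(\<Sum>i\<in>J. integral {s i..t i} \<sigma>) \<le> (\<Sum>i\<in>J. \<bar>integral {c..t i} \<sigma> - integral {c..s i} \<sigma>\<bar>)"
      proof (rule sum_mono)
        fix i assume "i \<in> J"
        then have "i \<in> K" using J by blast
        then show "integral {s i..t i} \<sigma> \<le> \<bar>integral {c..t i} \<sigma> - integral {c..s i} \<sigma>\<bar>"
          using integral_Icc_diff[OF \<sigma>_integrable[OF sub] st[of i]] by simp
      qed
      also have "\<dots> \<le> (\<Sum>i\<in>K. \<bar>integral {c..t i} \<sigma> - integral {c..s i} \<sigma>\<bar>)"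
        using K J by (intro sum_mono2) (auto simp: nonoverlapping_def)
      also have "\<dots> < \<eta>" by (rule \<delta>(2)[OF K len])
      finally show "B * (\<Sum>i\<in>J. integral {s i..t i} \<sigma>) \<le> B * \<eta>" using B by (intro mult_left_mono) auto
    qed
    also have "B * \<eta> \<le> A * \<epsilon> / 4"
    proof -
      have "B * \<eta> = (B / (B + 1)) * (A * \<epsilon> / 4)" using B by (simp add: \<eta>_def field_simps)
      also have "\<dots> \<le> 1 * (A * \<epsilon> / 4)" using A B \<open>0 < \<epsilon>\<close> by (intro mult_right_mono) auto
      finally show ?thesis by simp
    qed
    also have "C + A * \<epsilon> / 4 \<le> A * \<epsilon> / 2" using CA by (simp add: mult.commute)
    also have "\<dots> < A * \<epsilon>" using A \<open>0 < \<epsilon>\<close> by simp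
    finally show ?thesis using A by simp
  qed
  then show "\<exists>\<delta>>0. \<forall>(K :: (real \<times> real) set) s t. nonoverlapping c d K s t \<and> (\<Sum>i\<in>K. t i - s i) < \<delta>
    \<longrightarrow> (\<Sum>i\<in>K. \<bar>u (t i) - u (s i)\<bar>) < \<epsilon>" using \<delta>(1) by blast
qed

text \<open>On each dyadic cell the ratio of the integrals of g and \<sigma> is an average of the
  density of g dx with respect to \<sigma> dx. Its p-th power times \<sigma> integrates to the
  partition summand and tends to (|g|/\<sigma>)^p \<sigma> = |g|^p w.\<close>

lemma increments_bound_imp_energy_le:
  assumes sums: "\<And>(K :: int set) s t. finite K \<Longrightarrow> (\<And>i. i \<in> K \<Longrightarrow> {s i..t i} \<subseteq> \<I>) \<Longrightarrow> (\<And>i. i \<in> K \<Longrightarrow> s i < t i)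
      \<Longrightarrow> disjoint_family_on (\<lambda>i. {s i<..<t i}) K
      \<Longrightarrow> (\<Sum>i\<in>K. \<bar>integral {s i..t i} g\<bar> powr p / integral {s i..t i} \<sigma> powr (p - 1)) \<le> C"
    and g: "g locally_integrable_on \<I>"
  shows "energy g \<le> ennreal C"
proof -
  define L R where "L n k = real_of_int k / 2 ^ n" and "R n k = (real_of_int k + 1) / 2 ^ n" for n :: nat and k
  \<comment> \<open>Only cells inside \<open>\<I>\<close> are used: finitely many at each level
    since \<open>\<I>\<close> is bounded, and every point of \<open>\<I>\<close> is eventually in
    one of them.\<close>
  define K where "K n = {k. {L n k..R n k} \<subseteq> \<I>}" for n
  have LR: "L n k < R n k" for n k by (simp add: L_def R_def divide_strict_right_mono)
  have finK: "finite (K n)" for n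
  proof (rule finite_subset)
    show "K n \<subseteq> {\<lfloor>a * 2 ^ n\<rfloor>..\<lceil>b * 2 ^ n\<rceil>}"
    proof
      fix k assume "k \<in> K n"
      then have "L n k \<in> \<I>" using LR[of n k] by (auto simp: K_def)
      then have "a < L n k" "L n k < b" using I_subset by auto
      then have "a * 2 ^ n < k" "k < b * 2 ^ n" by (simp_all add: L_def field_simps)
      then show "k \<in> {\<lfloor>a * 2 ^ n\<rfloor>..\<lceil>b * 2 ^ n\<rceil>}" by (auto simp: floor_le_iff le_ceiling_iff)
    qed
  qed simp
  \<comment> \<open>Half-open cells, so that a point never belongs to two cells of the same
    level.\<close>
  have disj: "disjoint_family_on (\<lambda>k. {L n k..<R n k}) UNIV" for n
    unfolding disjoint_family_on_def
  proof (intro ballI impI)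
    fix k m :: int assume "k \<noteq> m"
    then have "k + 1 \<le> m \<or> m + 1 \<le> k" by linarith
    then have "R n k \<le> L n m \<or> R n m \<le> L n k"
      by (auto simp: L_def R_def intro!: divide_right_mono)
    then show "{L n k..<R n k} \<inter> {L n m..<R n m} = {}" by auto
  qed
  define q where "q n k = (\<bar>integral {L n k..R n k} g\<bar> / integral {L n k..R n k} \<sigma>) powr p" for n k
  define h where "h n x = (\<Sum>k\<in>K n. ennreal (q n k * \<sigma> x) * indicator {L n k..<R n k} x)" for n x
  have hm [measurable]: "h n \<in> borel_measurable lebesgue" for n unfolding h_def[abs_def] by measurable
  have int_h: "(\<integral>\<^sup>+ x. h n x \<partial>lebesgue) \<le> ennreal C" for n
  proof -
    have "(\<integral>\<^sup>+ x. h n x \<partial>lebesgue) = (\<Sum>k\<in>K n. \<integral>\<^sup>+ x \<in> {L n k..<R n k}. ennreal (q n k * \<sigma> x) \<partial>lebesgue)"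
      unfolding h_def by (rule nn_integral_sum) simp
    also have "\<dots> \<le> (\<Sum>k\<in>K n. ennreal (\<bar>integral {L n k..R n k} g\<bar> powr p / integral {L n k..R n k} \<sigma> powr (p - 1)))"
    proof (rule sum_mono)
      fix k assume "k \<in> K n"
      then have sub: "{L n k..R n k} \<subseteq> \<I>" by (simp add: K_def)
      have S: "0 < integral {L n k..R n k} \<sigma>" by (rule \<sigma>_integral_pos[OF sub LR])
      have "(\<integral>\<^sup>+ x \<in> {L n k..<R n k}. ennreal (q n k * \<sigma> x) \<partial>lebesgue)
          \<le> (\<integral>\<^sup>+ x \<in> {L n k..R n k}. ennreal (q n k * \<sigma> x) \<partial>lebesgue)"
        by (intro nn_integral_mono mult_left_mono) (auto simp: indicator_def)
      also have "\<dots> = ennreal (integral {L n k..R n k} (\<lambda>x. q n k * \<sigma> x))"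
        using \<sigma>_absolutely_integrable[OF sub] by (intro nn_set_integral_eq_integral set_integrable_mult_right) (auto simp: q_def \<sigma>_nonneg)
      also have "integral {L n k..R n k} (\<lambda>x. q n k * \<sigma> x) = q n k * integral {L n k..R n k} \<sigma>" by simp
      also have "\<dots> = \<bar>integral {L n k..R n k} g\<bar> powr p / integral {L n k..R n k} \<sigma> powr (p - 1)"
        using S by (simp add: q_def powr_divide powr_diff field_simps)
      finally show "(\<integral>\<^sup>+ x \<in> {L n k..<R n k}. ennreal (q n k * \<sigma> x) \<partial>lebesgue)
        \<le> ennreal (\<bar>integral {L n k..R n k} g\<bar> powr p / integral {L n k..R n k} \<sigma> powr (p - 1))" .
    qed
    also have "\<dots> = ennreal (\<Sum>k\<in>K n. \<bar>integral {L n k..R n k} g\<bar> powr p / integral {L n k..R n k} \<sigma> powr (p - 1))"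
      by (rule sum_ennreal) simp
    also have "\<dots> \<le> ennreal C"
    proof (intro ennreal_leI sums finK LR)
      show "{L n i..R n i} \<subseteq> \<I>" if "i \<in> K n" for i using that by (simp add: K_def)
      have "{L n i<..<R n i} \<subseteq> {L n i..<R n i}" for i by auto
      then show "disjoint_family_on (\<lambda>i. {L n i<..<R n i}) (K n)"
        using disj[of n] unfolding disjoint_family_on_def by blast
    qed
    finally show ?thesis .
  qed
  obtain N1 where N1: "negligible N1"
    "\<forall>x s t. x \<in> \<I> - N1 \<longrightarrow> (\<forall>n. s n \<le> x \<and> x \<le> t n \<and> s n < t n) \<longrightarrow> s \<longlonglongrightarrow> x \<longrightarrow> t \<longlonglongrightarrow> x
      \<longrightarrow> (\<lambda>n::nat. integral {s n..t n} g / (t n - s n)) \<longlonglongrightarrow> g x"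
    using straddled_averages_tendsto[OF g open_I] .
  obtain N2 where N2: "negligible N2"
    "\<forall>x s t. x \<in> \<I> - N2 \<longrightarrow> (\<forall>n. s n \<le> x \<and> x \<le> t n \<and> s n < t n) \<longrightarrow> s \<longlonglongrightarrow> x \<longrightarrow> t \<longlonglongrightarrow> x
      \<longrightarrow> (\<lambda>n::nat. integral {s n..t n} \<sigma> / (t n - s n)) \<longlonglongrightarrow> \<sigma> x"
    using straddled_averages_tendsto[OF \<sigma>_locally_integrable open_I] .
  have pointwise: "(\<lambda>n. h n x) \<longlonglongrightarrow> ennreal (\<bar>g x\<bar> powr p * w x)"
    if x: "x \<in> \<I> - (N1 \<union> N2)" and wx: "0 < w x" for x
  proof -
    define k where "k n = \<lfloor>x * 2 ^ n\<rfloor>" for n :: nat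
    define s t where "s n = L n (k n)" and "t n = R n (k n)" for n
    have "real_of_int (k n) \<le> x * 2 ^ n \<and> x * 2 ^ n < real_of_int (k n) + 1" for n
      unfolding k_def by linarith
    then have st: "s n \<le> x" "x < t n" for n by (auto simp: s_def t_def L_def R_def field_simps)
    have len: "t n - s n = (1/2) ^ n" for n by (simp add: s_def t_def L_def R_def power_divide diff_divide_distrib[symmetric])
    have pow0: "(\<lambda>n. (1/2) ^ n :: real) \<longlonglongrightarrow> 0" by (rule LIMSEQ_power_zero) simp
    have s0: "s \<longlonglongrightarrow> x"
    proof (rule tendsto_sandwich[of "\<lambda>n. x - (1/2) ^ n" _ _ "\<lambda>_. x"])
      have "x - (1/2) ^ n \<le> s n" for n using len[of n] st[of n] by linarith
      then show "\<forall>\<^sub>F n in sequentially. x - (1/2) ^ n \<le> s n" by simp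
      show "(\<lambda>n. x - (1/2) ^ n) \<longlonglongrightarrow> x" using tendsto_diff[OF tendsto_const pow0, of x] by simp
    qed (use st in auto)
    have t0: "t \<longlonglongrightarrow> x"
    proof (rule tendsto_sandwich[of "\<lambda>_. x" _ _ "\<lambda>n. x + (1/2) ^ n"])
      have "t n \<le> x + (1/2) ^ n" for n using len[of n] st[of n] by linarith
      then show "\<forall>\<^sub>F n in sequentially. t n \<le> x + (1/2) ^ n" by simp
      show "(\<lambda>n. x + (1/2) ^ n) \<longlonglongrightarrow> x" using tendsto_add[OF tendsto_const pow0, of x] by simp
      show "\<forall>\<^sub>F n in sequentially. x \<le> t n" by (intro always_eventually allI less_imp_le st(2))
    qed simp
    have cond: "\<forall>n. s n \<le> x \<and> x \<le> t n \<and> s n < t n" using st by (meson less_imp_le order.strict_trans1)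
    have lg: "(\<lambda>n. integral {s n..t n} g / (t n - s n)) \<longlonglongrightarrow> g x"
      using N1(2)[rule_format, of x s t] x cond s0 t0 by blast
    have l\<sigma>: "(\<lambda>n. integral {s n..t n} \<sigma> / (t n - s n)) \<longlonglongrightarrow> \<sigma> x"
      using N2(2)[rule_format, of x s t] x cond s0 t0 by blast
    have \<sigma>x: "0 < \<sigma> x" using wx by (simp add: \<sigma>_def)
    have "(\<lambda>n. ((\<bar>integral {s n..t n} g / (t n - s n)\<bar>) / (integral {s n..t n} \<sigma> / (t n - s n))) powr p * \<sigma> x)
        \<longlonglongrightarrow> (\<bar>g x\<bar> / \<sigma> x) powr p * \<sigma> x"
    proof (rule tendsto_mult_right, rule tendsto_powr2)
      show "(\<lambda>n. (\<bar>integral {s n..t n} g / (t n - s n)\<bar>) / (integral {s n..t n} \<sigma> / (t n - s n))) \<longlonglongrightarrow> \<bar>g x\<bar> / \<sigma> x"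
        using \<sigma>x by (intro tendsto_divide tendsto_rabs lg l\<sigma>) auto
      have "0 \<le> integral {s n..t n} \<sigma>" for n
        by (cases "\<sigma> integrable_on {s n..t n}") (auto intro: integral_nonneg \<sigma>_nonneg simp: not_integrable_integral)
      then show "\<forall>\<^sub>F n in sequentially. 0 \<le> (\<bar>integral {s n..t n} g / (t n - s n)\<bar>) / (integral {s n..t n} \<sigma> / (t n - s n))"
        using cond by (intro always_eventually allI divide_nonneg_nonneg) (auto intro: less_imp_le)
    qed (use p_gt_1 in auto)
    moreover have "((\<bar>integral {s n..t n} g / (t n - s n)\<bar>) / (integral {s n..t n} \<sigma> / (t n - s n))) powr p = q n (k n)" for n
      using cond[rule_format, of n] by (simp add: q_def s_def[symmetric] t_def[symmetric])
    moreover have "(\<bar>g x\<bar> / \<sigma> x) powr p * \<sigma> x = \<bar>g x\<bar> powr p * w x"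
    proof -
      have "- 1 / (p - 1) * (1 - p) = 1" using p_gt_1 by (simp add: field_simps)
      then have "\<sigma> x powr (1 - p) = w x" using wx by (simp add: \<sigma>_def powr_powr)
      then have "\<sigma> x / \<sigma> x powr p = w x" using \<sigma>x by (simp add: powr_diff)
      then show ?thesis using \<sigma>x by (simp add: powr_divide mult.commute times_divide_eq_left[symmetric] del: times_divide_eq_left)
    qed
    ultimately have "(\<lambda>n. q n (k n) * \<sigma> x) \<longlonglongrightarrow> \<bar>g x\<bar> powr p * w x" by simp
    then have "(\<lambda>n. ennreal (q n (k n) * \<sigma> x)) \<longlonglongrightarrow> ennreal (\<bar>g x\<bar> powr p * w x)" by (rule tendsto_ennrealI)
    moreover have "\<forall>\<^sub>F n in sequentially. ennreal (q n (k n) * \<sigma> x) = h n x"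
    proof -
      have xI: "x \<in> \<I>" using x by blast
      obtain d where d: "d > 0" "ball x d \<subseteq> \<I>" using openE[OF open_I xI] .
      have "\<forall>\<^sub>F n in sequentially. x - d < s n \<and> t n < x + d"
        using order_tendstoD(1)[OF s0, of "x - d"] order_tendstoD(2)[OF t0, of "x + d"] d by (intro eventually_conj) auto
      then show ?thesis
      proof (rule eventually_mono)
        fix n assume n: "x - d < s n \<and> t n < x + d"
        have "{s n..t n} \<subseteq> ball x d" using n by (auto simp: dist_real_def)
        then have kK: "k n \<in> K n" using d by (auto simp: K_def s_def t_def)
        have "h n x = (\<Sum>m\<in>K n. if m = k n then ennreal (q n (k n) * \<sigma> x) else 0)"
          unfolding h_def
        proof (rule sum.cong[OF refl])
          fix m assume "m \<in> K n"
          have xk: "x \<in> {L n (k n)..<R n (k n)}" using st[of n] by (simp add: s_def t_def)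
          show "ennreal (q n m * \<sigma> x) * indicator {L n m..<R n m} x = (if m = k n then ennreal (q n (k n) * \<sigma> x) else 0)"
          proof (cases "m = k n")
            case True then show ?thesis using xk by simp
          next
            case False
            then have "x \<notin> {L n m..<R n m}" using disj[of n] xk unfolding disjoint_family_on_def by blast
            then show ?thesis using False by simp
          qed
        qed
        then show "ennreal (q n (k n) * \<sigma> x) = h n x" using finK kK by simp
      qed
    qed
    ultimately show ?thesis by (rule Lim_transform_eventually)
  qed
  have "AE x in lebesgue. x \<notin> N1 \<union> N2"
    using N1(1) N2(1) by (intro AE_not_in) (simp add: negligible_iff_null_sets[symmetric] negligible_Un)
  with w_pos_AE have "AE x in lebesgue. ennreal (\<bar>g x\<bar> powr p * w x) * indicator \<I> x \<le> liminf (\<lambda>n. h n x)"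
  proof eventually_elim
    case (elim x)
    show ?case
    proof (cases "x \<in> \<I>")
      case True
      then have "(\<lambda>n. h n x) \<longlonglongrightarrow> ennreal (\<bar>g x\<bar> powr p * w x)" using elim by (intro pointwise) auto
      then have "liminf (\<lambda>n. h n x) = ennreal (\<bar>g x\<bar> powr p * w x)" by (intro lim_imp_Liminf) auto
      then show ?thesis using True by simp
    qed simp
  qed
  then have "energy g \<le> (\<integral>\<^sup>+ x. liminf (\<lambda>n. h n x) \<partial>lebesgue)"
    unfolding energy_def by (rule nn_integral_mono_AE)
  also have "\<dots> \<le> liminf (\<lambda>n. \<integral>\<^sup>+ x. h n x \<partial>lebesgue)"
    by (rule nn_integral_liminf) (rule hm)
  also have "\<dots> \<le> liminf (\<lambda>_. ennreal C)"
    by (rule Liminf_mono) (intro always_eventually allI int_h)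
  also have "\<dots> = ennreal C" by (rule Liminf_const) simp
  finally show ?thesis .
qed

theorem energy_lower_semicontinuous:
  fixes v :: "nat \<Rightarrow> real \<Rightarrow> real"
  assumes wd: "\<And>n. has_weak_derivative \<I> (v n) (g n)"
    and en: "\<And>n. energy (g n) \<le> ennreal C" "0 \<le> C"
    and lim: "AE x in lebesgue. x \<in> \<I> \<longrightarrow> (\<lambda>n. v n x) \<longlonglongrightarrow> u x"
    and u: "u \<in> borel_measurable (lebesgue_on \<I>)"
  obtains f where "has_weak_derivative \<I> u f" "energy f \<le> ennreal C"
proof -
  have g: "g n locally_integrable_on \<I>" for n using wd by (simp add: has_weak_derivative_def)
  have "\<exists>V N. negligible N \<and> (\<forall>x\<in>\<I> - N. V x = v n x) \<and> (\<forall>x y. x \<le> y \<longrightarrow> {x..y} \<subseteq> \<I> \<longrightarrow> V y - V x = integral {x..y} (g n))" for n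
    by (rule ae_primitive_representative[OF weak_derivative_imp_ae_primitive[OF wd open_I] open_I g]) blast
  then obtain V N where N: "\<And>n. negligible (N n)" and Vv: "\<And>n x. x \<in> \<I> - N n \<Longrightarrow> V n x = v n x"
    and V: "\<And>n x y. x \<le> y \<Longrightarrow> {x..y} \<subseteq> \<I> \<Longrightarrow> V n y - V n x = integral {x..y} (g n)"
    by metis
  obtain N0 where N0: "negligible N0" "\<And>x. x \<in> \<I> - N0 \<Longrightarrow> (\<lambda>n. v n x) \<longlonglongrightarrow> u x"
  proof -
    obtain N0 where "N0 \<in> null_sets lebesgue" "{x \<in> space lebesgue. \<not> (x \<in> \<I> \<longrightarrow> (\<lambda>n. v n x) \<longlonglongrightarrow> u x)} \<subseteq> N0"
      using lim by (auto simp: eventually_ae_filter)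
    then show thesis using that[of N0] by (auto simp: negligible_iff_null_sets)
  qed
  define M where "M = N0 \<union> (\<Union>n. N n)"
  have M: "negligible M" unfolding M_def using N0(1) N by (intro negligible_Un negligible_countable_Union) auto
  have VM: "(\<lambda>n. V n x) \<longlonglongrightarrow> u x" if "x \<in> \<I> - M" for x
  proof -
    have "V n x = v n x" for n using that Vv by (auto simp: M_def)
    then show ?thesis using N0(2)[of x] that by (simp add: M_def)
  qed
  obtain U where U: "\<And>x. x \<in> \<I> \<Longrightarrow> (\<lambda>n. V n x) \<longlonglongrightarrow> U x"
    using energy_bounded_pointwise_convergent[OF V g en M VM] by blast
  have Uu: "U x = u x" if "x \<in> \<I> - M" for x
    using LIMSEQ_unique[OF U VM[OF that]] that by blast
  \<comment> \<open>Finite sums pass to the pointwise limit. The index type stays generic because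
    absolute continuity uses it for pairs of reals and the dyadic argument for integers.\<close>
  have sums: "(\<Sum>i\<in>K. \<bar>U (t i) - U (s i)\<bar> powr p / integral {s i..t i} \<sigma> powr (p - 1)) \<le> C"
    if K: "finite K" "\<And>i. i \<in> K \<Longrightarrow> {s i..t i} \<subseteq> \<I>" "\<And>i. i \<in> K \<Longrightarrow> s i < t i" "disjoint_family_on (\<lambda>i. {s i<..<t i}) K"
    for K :: "'i set" and s t
  proof (rule LIMSEQ_le_const2)
    have stI: "s i \<in> \<I>" "t i \<in> \<I>" if "i \<in> K" for i using K(2)[OF that] K(3)[OF that] by auto
    show "(\<lambda>n. \<Sum>i\<in>K. \<bar>V n (t i) - V n (s i)\<bar> powr p / integral {s i..t i} \<sigma> powr (p - 1))
        \<longlonglongrightarrow> (\<Sum>i\<in>K. \<bar>U (t i) - U (s i)\<bar> powr p / integral {s i..t i} \<sigma> powr (p - 1))"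
    proof (intro tendsto_sum tendsto_divide tendsto_const)
      fix i assume i: "i \<in> K"
      show "(\<lambda>n. \<bar>V n (t i) - V n (s i)\<bar> powr p) \<longlonglongrightarrow> \<bar>U (t i) - U (s i)\<bar> powr p"
        using p_gt_1 U[OF stI(1)[OF i]] U[OF stI(2)[OF i]] by (intro tendsto_powr2 tendsto_rabs tendsto_diff tendsto_const) auto
      show "integral {s i..t i} \<sigma> powr (p - 1) \<noteq> 0" using \<sigma>_integral_pos[OF K(2)[OF i] K(3)[OF i]] by simp
    qed
    have "(\<Sum>i\<in>K. \<bar>V n (t i) - V n (s i)\<bar> powr p / integral {s i..t i} \<sigma> powr (p - 1)) \<le> C" for n
    proof -
      have "ennreal (\<Sum>i\<in>K. \<bar>V n (t i) - V n (s i)\<bar> powr p / integral {s i..t i} \<sigma> powr (p - 1))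
          = (\<Sum>i\<in>K. ennreal (\<bar>V n (t i) - V n (s i)\<bar> powr p / integral {s i..t i} \<sigma> powr (p - 1)))"
        by (rule sum_ennreal[symmetric]) simp
      also have "\<dots> = (\<Sum>i\<in>K. ennreal (\<bar>integral {s i..t i} (g n)\<bar> powr p / integral {s i..t i} \<sigma> powr (p - 1)))"
        using V[of "s _" "t _" n] K by (intro sum.cong refl) (simp add: less_imp_le)
      also have "\<dots> \<le> energy (g n)" by (rule sum_increments_le_energy[OF K g])
      also have "\<dots> \<le> ennreal C" by (rule en)
      finally show ?thesis using en(2) by (simp add: ennreal_le_iff)
    qed
    then show "\<exists>M. \<forall>n\<ge>M. (\<Sum>i\<in>K. \<bar>V n (t i) - V n (s i)\<bar> powr p / integral {s i..t i} \<sigma> powr (p - 1)) \<le> C" by blast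
  qed
  have AC: "U \<in> AC c d" if "{c..d} \<subseteq> \<I>" for c d
    by (rule increments_bound_imp_AC[OF _ en(2) that]) (rule sums; blast)
  define f where "f = deriv U"
  have f: "f locally_integrable_on \<I>"
  proof (rule locally_integrable_onI[OF open_I])
    fix x y assume "{x..y} \<subseteq> \<I>"
    then show "f absolutely_integrable_on {x..y}"
      using AC_fundamental_theorem(1)[OF AC] by (cases "x \<le> y") (auto simp: f_def)
  qed
  have Uf: "U y - U x = integral {x..y} f" if "x \<le> y" "{x..y} \<subseteq> \<I>" for x y
    using AC_fundamental_theorem(2)[OF AC[OF that(2)] that(1), of x y] that by (simp add: f_def integral_unique)
  have "ae_primitive_on \<I> u f"
    unfolding ae_primitive_on_def
  proof (intro exI[of _ M] conjI M allI impI)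
    fix x y assume xy: "x \<notin> M" "y \<notin> M" "x \<le> y" "{x..y} \<subseteq> \<I>"
    then have "x \<in> \<I> - M" "y \<in> \<I> - M" by auto
    then show "u y - u x = integral {x..y} f" using Uf[OF xy(3,4)] Uu by simp
  qed
  then have "has_weak_derivative \<I> u f"
    by (rule ae_primitive_imp_weak_derivative[OF _ open_I f u])
  moreover have "energy f \<le> ennreal C"
  proof (rule increments_bound_imp_energy_le[OF _ f])
    fix K :: "int set" and s t
    assume K: "finite K" "\<And>i. i \<in> K \<Longrightarrow> {s i..t i} \<subseteq> \<I>" "\<And>i. i \<in> K \<Longrightarrow> s i < t i" "disjoint_family_on (\<lambda>i. {s i<..<t i}) K"
    have "(\<Sum>i\<in>K. \<bar>integral {s i..t i} f\<bar> powr p / integral {s i..t i} \<sigma> powr (p - 1))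
       = (\<Sum>i\<in>K. \<bar>U (t i) - U (s i)\<bar> powr p / integral {s i..t i} \<sigma> powr (p - 1))"
      using Uf K by (intro sum.cong refl) (simp add: less_imp_le)
    also have "\<dots> \<le> C" by (rule sums[OF K])
    finally show "(\<Sum>i\<in>K. \<bar>integral {s i..t i} f\<bar> powr p / integral {s i..t i} \<sigma> powr (p - 1)) \<le> C" .
  qed
  ultimately show thesis by (rule that)
qed

end

section \<open>The auxiliary weight and the relaxed energy\<close>

lemma powr_add_le: "\<bar>x + y\<bar> powr p \<le> 2 powr p * (\<bar>x\<bar> powr p + \<bar>y\<bar> powr p)" if "0 \<le> p" for x y p :: real
proof -
  have "\<bar>x + y\<bar> powr p \<le> (2 * max \<bar>x\<bar> \<bar>y\<bar>) powr p" using that by (intro powr_mono2) auto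
  also have "\<dots> = 2 powr p * max \<bar>x\<bar> \<bar>y\<bar> powr p" by (simp add: powr_mult)
  also have "\<dots> \<le> 2 powr p * (\<bar>x\<bar> powr p + \<bar>y\<bar> powr p)"
    by (intro mult_left_mono) (auto simp: max_def)
  finally show ?thesis .
qed

lemma powr_tendsto_0_imp_tendsto_0:
  fixes f :: "nat \<Rightarrow> real"
  assumes "0 < p" and lim: "(\<lambda>n. \<bar>f n\<bar> powr p) \<longlonglongrightarrow> 0"
  shows "f \<longlonglongrightarrow> 0"
proof -
  have "(\<lambda>n. (\<bar>f n\<bar> powr p) powr (1 / p)) \<longlonglongrightarrow> 0 powr (1 / p)"
    using assms by (intro tendsto_powr2) auto
  then have "(\<lambda>n. \<bar>f n\<bar>) \<longlonglongrightarrow> 0" using assms(1) by (simp add: powr_powr)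
  then show ?thesis by (simp add: tendsto_rabs_zero_iff)
qed

context degenerate_weight
begin

lemma bounded_I: "bounded \<I>"
  by (rule bounded_subset[OF bounded_Ioo I_subset])

lemma energy_eq_Dom_energy: "Dom_energy p {a<..<b} w u = energy (weak_deriv \<I> u)"
  by (simp add: Dom_energy_def energy_def)

lemma has_weak_derivative_weak_deriv:
  assumes "u \<in> W11_loc \<I>"
  shows "has_weak_derivative \<I> u (weak_deriv \<I> u)"
proof -
  have "\<exists>g. has_weak_derivative \<I> u g" using assms by (simp add: W11_loc_def)
  then show ?thesis unfolding weak_deriv_def by (rule someI_ex)
qed

lemma energy_weak_deriv:
  assumes g: "has_weak_derivative \<I> u g"
  shows "energy (weak_deriv \<I> u) = energy g"
proof -
  have h: "has_weak_derivative \<I> u (weak_deriv \<I> u)"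
    using g by (intro has_weak_derivative_weak_deriv) (auto simp: W11_loc_def)
  obtain N where N: "negligible N" "\<forall>x\<in>\<I> - N. weak_deriv \<I> u x = g x"
    using ae_primitive_unique[of \<I> u "weak_deriv \<I> u" g] g h open_I
    unfolding has_weak_derivative_iff_ae_primitive[OF open_I] by blast
  have "AE x in lebesgue. x \<notin> N" using N(1) by (intro AE_not_in) (simp add: negligible_iff_null_sets)
  then show ?thesis
    unfolding energy_def
    by (intro nn_integral_cong_AE) (auto elim!: eventually_mono simp: indicator_def N(2)[rule_format])
qed

section \<open>One component of the regular set and the auxiliary weight on it\<close>

context
  fixes C assumes C: "C \<in> components \<I>"
begin

lemma component_interval: "C = {Inf C<..<Sup C}" "Inf C < Sup C"
proof -
  show *: "C = {Inf C<..<Sup C}" by (rule bounded_open_component_eq_interval[OF open_I bounded_I C])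
  show "Inf C < Sup C" using * in_components_nonempty[OF C] by (metis greaterThanLessThan_empty_iff not_le)
qed

lemma component_subset: "C \<subseteq> \<I>"
  by (rule in_components_subset[OF C])

lemma mem_component_iff: "x \<in> C \<longleftrightarrow> Inf C < x \<and> x < Sup C"
  by (subst component_interval(1)) simp

lemma Icc_subset_component: "x \<in> C \<Longrightarrow> y \<in> C \<Longrightarrow> {x..y} \<subseteq> \<I>"
  using component_subset by (auto simp: mem_component_iff subset_iff)

lemma component_bounds: "a \<le> Inf C" "Sup C \<le> b"
proof -
  have "{Inf C<..<Sup C} \<subseteq> {a<..<b}" using component_interval component_subset I_subset by blast
  then show "a \<le> Inf C" "Sup C \<le> b"
    using component_interval(2) by (simp_all add: greaterThanLessThan_subseteq_greaterThanLessThan)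
qed

text \<open>Maximality of components: an endpoint in \<open>\<I>\<close> is joined to the midpoint
  by a segment inside \<open>\<I>\<close>, so it would belong to \<open>C\<close>. This is what
  makes transitions at the endpoints in (a,b) cheap.\<close>

lemma component_endpoints_notin: "Inf C \<notin> \<I>" "Sup C \<notin> \<I>"
proof -
  have *: "y \<in> C" if y: "y \<in> \<I>" "connected T" "y \<in> T" "T \<subseteq> insert y C" "T \<inter> C \<noteq> {}" for y T
  proof -
    have "T \<subseteq> \<I>" using y component_subset by blast
    then have "T \<subseteq> C" using components_maximal[OF C y(2)] y(5) by blast
    then show ?thesis using y by blast
  qed
  define m where "m = (Inf C + Sup C) / 2"
  have m: "Inf C < m" "m < Sup C" using component_interval(2) by (auto simp: m_def)
  have mC: "m \<in> C" using m by (simp add: mem_component_iff)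
  show "Inf C \<notin> \<I>"
  proof
    assume "Inf C \<in> \<I>"
    moreover have "{Inf C..m} \<subseteq> insert (Inf C) C" using m by (auto simp: mem_component_iff)
    moreover have "m \<in> {Inf C..m} \<inter> C" "Inf C \<in> {Inf C..m}" using m mC by auto
    ultimately have "Inf C \<in> C" by (intro *[of "Inf C" "{Inf C..m}"]) auto
    then show False by (simp add: mem_component_iff)
  qed
  show "Sup C \<notin> \<I>"
  proof
    assume "Sup C \<in> \<I>"
    moreover have "{m..Sup C} \<subseteq> insert (Sup C) C" using m by (auto simp: mem_component_iff)
    moreover have "m \<in> {m..Sup C} \<inter> C" "Sup C \<in> {m..Sup C}" using m mC by auto
    ultimately have "Sup C \<in> C" by (intro *[of "Sup C" "{m..Sup C}"]) auto
    then show False by (simp add: mem_component_iff)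
  qed
qed

abbreviation (input) mid where "mid \<equiv> (Inf C + Sup C) / 2"
abbreviation (input) quarter1 where "quarter1 \<equiv> (3 * Inf C + Sup C) / 4"
abbreviation (input) quarter3 where "quarter3 \<equiv> (Inf C + 3 * Sup C) / 4"

lemma component_points: "mid \<in> C" "quarter1 \<in> C" "quarter3 \<in> C"
  using component_interval(2) by (auto simp: mem_component_iff)

lemma hat_weight_component:
  assumes x: "x \<in> C"
  shows "hat_weight p {a<..<b} w x = (if x < quarter1 then inverse (integral {x..mid} \<sigma>)
    else if x \<le> quarter3 then inverse (integral {quarter1..quarter3} \<sigma>)
    else inverse (integral {mid..x} \<sigma>))"
proof -
  have xI: "x \<in> \<I>" using x component_subset by blast
  have CC: "connected_component_set \<I> x = C"
    using C x unfolding components_iff by (metis connected_component_eq)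
  have J: "enn2real (\<integral>\<^sup>+ y \<in> {s..t}. inv_weight p w y \<partial>lebesgue) = integral {s..t} \<sigma>"
    if "s \<in> C" "t \<in> C" for s t
    using inv_weight_integral[OF Icc_subset_component[OF that]] \<sigma>_integral_nonneg[OF Icc_subset_component[OF that]] by simp
  show ?thesis
    unfolding hat_weight_def Let_def CC using xI x by (simp add: J component_points)
qed

lemma \<sigma>_integral_mono:
  assumes "s' \<le> s" "s \<le> t" "t \<le> t'" "s' \<in> C" "t' \<in> C"
  shows "integral {s..t} \<sigma> \<le> integral {s'..t'} \<sigma>"
proof (rule integral_subset_le)
  have sub: "{s'..t'} \<subseteq> \<I>" by (rule Icc_subset_component[OF assms(4,5)])
  then show "\<sigma> integrable_on {s'..t'}" by (rule \<sigma>_integrable)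
  show st: "{s..t} \<subseteq> {s'..t'}" using assms by auto
  show "\<sigma> integrable_on {s..t}" using st sub by (intro \<sigma>_integrable) blast
qed (simp add: \<sigma>_nonneg)

lemma hat_weight_component_pos:
  assumes x: "x \<in> C"
  shows "0 < hat_weight p {a<..<b} w x"
proof -
  have pos: "0 < inverse (integral {s..t} \<sigma>)" if "s \<in> C" "t \<in> C" "s < t" for s t
    using \<sigma>_integral_pos[OF Icc_subset_component[OF that(1,2)] that(3)] by simp
  have lt: "quarter1 < mid" "mid < quarter3" "quarter1 < quarter3" using component_interval(2) by auto
  consider "x < quarter1" | "quarter1 \<le> x" "x \<le> quarter3" | "quarter3 < x" by linarith
  then show ?thesis
  proof cases
    case 1
    then show ?thesis using pos[OF x component_points(1)] lt x by (simp add: hat_weight_component)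
  next
    case 2
    then show ?thesis using pos[OF component_points(2,3) lt(3)] x by (simp add: hat_weight_component)
  next
    case 3
    then show ?thesis using pos[OF component_points(1) x] lt x by (simp add: hat_weight_component)
  qed
qed

text \<open>Each integral in the definition of the weight extends over at least a fixed quarter of
  the component, so its inverse stays bounded; where the integral diverges at an endpoint the weight
  tends to 0.\<close>

lemma hat_weight_component_bounded: "\<exists>H. \<forall>x\<in>C. hat_weight p {a<..<b} w x \<le> H"
proof (intro exI ballI)
  fix x assume x: "x \<in> C"
  have lt: "quarter1 < mid" "mid < quarter3" "quarter1 < quarter3" using component_interval(2) by auto
  have pos: "0 < integral {quarter1..mid} \<sigma>" "0 < integral {quarter1..quarter3} \<sigma>" "0 < integral {mid..quarter3} \<sigma>"
    using lt by (intro \<sigma>_integral_pos Icc_subset_component component_points; simp)+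
  consider "x < quarter1" | "quarter1 \<le> x" "x \<le> quarter3" | "quarter3 < x" by linarith
  then show "hat_weight p {a<..<b} w x \<le> inverse (integral {quarter1..mid} \<sigma>) +
    inverse (integral {quarter1..quarter3} \<sigma>) + inverse (integral {mid..quarter3} \<sigma>)"
  proof cases
    case 1
    then have "integral {quarter1..mid} \<sigma> \<le> integral {x..mid} \<sigma>"
      using lt x by (intro \<sigma>_integral_mono component_points) auto
    then have "inverse (integral {x..mid} \<sigma>) \<le> inverse (integral {quarter1..mid} \<sigma>)"
      using pos by (intro le_imp_inverse_le) auto
    moreover have "0 < inverse (integral {quarter1..quarter3} \<sigma>)" "0 < inverse (integral {mid..quarter3} \<sigma>)" using pos by auto
    moreover have "hat_weight p {a<..<b} w x = inverse (integral {x..mid} \<sigma>)" using 1 x by (simp add: hat_weight_component)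
    ultimately show ?thesis by linarith
  next
    case 2
    moreover have "0 < inverse (integral {quarter1..mid} \<sigma>)" "0 < inverse (integral {mid..quarter3} \<sigma>)" using pos by auto
    moreover have "hat_weight p {a<..<b} w x = inverse (integral {quarter1..quarter3} \<sigma>)" using 2 x by (simp add: hat_weight_component)
    ultimately show ?thesis by linarith
  next
    case 3
    then have "integral {mid..quarter3} \<sigma> \<le> integral {mid..x} \<sigma>"
      using lt x by (intro \<sigma>_integral_mono component_points) auto
    then have "inverse (integral {mid..x} \<sigma>) \<le> inverse (integral {mid..quarter3} \<sigma>)"
      using pos by (intro le_imp_inverse_le) auto
    moreover have "0 < inverse (integral {quarter1..mid} \<sigma>)" "0 < inverse (integral {quarter1..quarter3} \<sigma>)" using pos by auto
    moreover have "hat_weight p {a<..<b} w x = inverse (integral {mid..x} \<sigma>)" using 3 x lt by (simp add: hat_weight_component)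
    ultimately show ?thesis by linarith
  qed
qed

text \<open>For measurability: the weight decreases from the quarter points towards the endpoints,
  so on the right its negative is the monotone function.\<close>

lemma hat_weight_component_mono:
  "mono_on {Inf C<..<quarter1} (hat_weight p {a<..<b} w)"
  "mono_on {quarter3<..<Sup C} (\<lambda>x. - hat_weight p {a<..<b} w x)"
proof -
  have lt: "quarter1 < mid" "mid < quarter3" "mid < Sup C" "Inf C < mid" using component_interval(2) by auto
  show "mono_on {Inf C<..<quarter1} (hat_weight p {a<..<b} w)"
  proof (rule mono_onI)
    fix x y assume xy: "x \<in> {Inf C<..<quarter1}" "y \<in> {Inf C<..<quarter1}" "x \<le> y"
    then have C': "x \<in> C" "y \<in> C" using lt by (auto simp: mem_component_iff)
    have "0 < integral {y..mid} \<sigma>" using xy lt C' by (intro \<sigma>_integral_pos Icc_subset_component component_points) auto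
    moreover have "integral {y..mid} \<sigma> \<le> integral {x..mid} \<sigma>"
      using xy lt C' by (intro \<sigma>_integral_mono component_points) auto
    ultimately show "hat_weight p {a<..<b} w x \<le> hat_weight p {a<..<b} w y"
      using xy C' by (simp add: hat_weight_component le_imp_inverse_le)
  qed
  show "mono_on {quarter3<..<Sup C} (\<lambda>x. - hat_weight p {a<..<b} w x)"
  proof (rule mono_onI)
    fix x y assume xy: "x \<in> {quarter3<..<Sup C}" "y \<in> {quarter3<..<Sup C}" "x \<le> y"
    then have C': "x \<in> C" "y \<in> C" using lt by (auto simp: mem_component_iff)
    have "0 < integral {mid..x} \<sigma>" using xy lt C' by (intro \<sigma>_integral_pos Icc_subset_component component_points) auto
    moreover have "integral {mid..x} \<sigma> \<le> integral {mid..y} \<sigma>"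
      using xy lt C' by (intro \<sigma>_integral_mono component_points) auto
    ultimately show "- hat_weight p {a<..<b} w x \<le> - hat_weight p {a<..<b} w y"
      using xy C' lt by (simp add: hat_weight_component le_imp_inverse_le)
  qed
qed

lemma hat_weight_component_measurable:
  "T \<in> {{Inf C<..<quarter1}, {quarter1..quarter3}, {quarter3<..<Sup C}} \<Longrightarrow>
    hat_weight p {a<..<b} w \<in> borel_measurable (restrict_space borel T)"
proof -
  assume "T \<in> {{Inf C<..<quarter1}, {quarter1..quarter3}, {quarter3<..<Sup C}}"
  then consider "T = {Inf C<..<quarter1}" | "T = {quarter1..quarter3}" | "T = {quarter3<..<Sup C}" by blast
  then show ?thesis
  proof cases
    case 1
    then show ?thesis using borel_measurable_mono_on_fnc[OF hat_weight_component_mono(1)] by simp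
  next
    case 2
    have "hat_weight p {a<..<b} w x = inverse (integral {quarter1..quarter3} \<sigma>)" if "x \<in> T" for x
    proof -
      have "x \<in> C" using that 2 component_interval(2) by (auto simp: mem_component_iff)
      then show ?thesis using that 2 by (simp add: hat_weight_component)
    qed
    then show ?thesis by (subst measurable_cong[where g = "\<lambda>_. inverse (integral {quarter1..quarter3} \<sigma>)"]) (auto simp: space_restrict_space)
  next
    case 3
    have "(\<lambda>x. - (- hat_weight p {a<..<b} w x)) \<in> borel_measurable (restrict_space borel T)"
      unfolding 3 by (rule borel_measurable_uminus[OF borel_measurable_mono_on_fnc[OF hat_weight_component_mono(2)]])
    then show ?thesis by simp
  qed
qed

text \<open>The weight \<open>hat_weight\<close> is designed so that the increment of \<open>u\<close> from \<open>x\<close> towards the midpoint of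
  its component is controlled by Hoelder's inequality.\<close>

lemma increment_times_hat_weight_le:
  assumes g: "g locally_integrable_on \<I>" and fin: "energy g < \<infinity>"
    and v: "\<And>x y. x \<le> y \<Longrightarrow> {x..y} \<subseteq> \<I> \<Longrightarrow> v y - v x = integral {x..y} g"
    and x: "x \<in> C" and y: "min x mid \<le> y" "y \<le> max x mid"
  shows "\<bar>v y - v x\<bar> powr p * hat_weight p {a<..<b} w x powr (p - 1) \<le> enn2real (energy g)"
proof (cases "x = y")
  case True
  then show ?thesis by simp
next
  case False
  define s t where "s = min x y" and "t = max x y"
  have st: "s < t" using False by (auto simp: s_def t_def)
  have yC: "y \<in> C" using x y component_points(1) by (auto simp: mem_component_iff min_def max_def split: if_splits)
  have sC: "s \<in> C" "t \<in> C" using x yC by (auto simp: s_def t_def min_def max_def)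
  have sub: "{s..t} \<subseteq> \<I>" by (rule Icc_subset_component[OF sC])
  define S where "S = integral {s..t} \<sigma>"
  have S: "0 < S" unfolding S_def by (rule \<sigma>_integral_pos[OF sub st])
  \<comment> \<open>Whichever branch applies at \<open>x\<close>, its integral extends over an
    interval containing [s,t]; in the middle branch both \<open>x\<close> and the midpoint lie
    between the quarter points.\<close>
  have "hat_weight p {a<..<b} w x \<le> inverse S"
  proof -
    consider "x < quarter1" | "quarter1 \<le> x" "x \<le> quarter3" | "quarter3 < x" by linarith
    then show ?thesis
    proof cases
      case 1
      then have "S \<le> integral {x..mid} \<sigma>"
        unfolding S_def using y x component_interval(2) by (intro \<sigma>_integral_mono component_points) (auto simp: s_def t_def)
      then show ?thesis using 1 x S by (simp add: hat_weight_component le_imp_inverse_le)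
    next
      case 2
      then have "S \<le> integral {quarter1..quarter3} \<sigma>"
        unfolding S_def using y x component_interval(2) by (intro \<sigma>_integral_mono component_points) (auto simp: s_def t_def min_def max_def split: if_splits)
      then show ?thesis using 2 x S by (simp add: hat_weight_component le_imp_inverse_le)
    next
      case 3
      then have "S \<le> integral {mid..x} \<sigma>"
        unfolding S_def using y x component_interval(2) by (intro \<sigma>_integral_mono component_points) (auto simp: s_def t_def)
      then show ?thesis using 3 x S component_interval(2) by (simp add: hat_weight_component le_imp_inverse_le)
    qed
  qed
  then have "hat_weight p {a<..<b} w x powr (p - 1) \<le> inverse S powr (p - 1)"
    using hat_weight_component_pos[OF x] p_gt_1 by (intro powr_mono2) auto
  also have "\<dots> = inverse (S powr (p - 1))" using S by (simp add: powr_divide inverse_eq_divide)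
  finally have hat: "hat_weight p {a<..<b} w x powr (p - 1) \<le> inverse (S powr (p - 1))" .
  have "\<bar>v y - v x\<bar> = \<bar>integral {s..t} g\<bar>"
    using v[OF less_imp_le[OF st] sub] by (auto simp: s_def t_def min_def max_def abs_minus_commute split: if_splits)
  then have "\<bar>v y - v x\<bar> powr p * hat_weight p {a<..<b} w x powr (p - 1) \<le> \<bar>integral {s..t} g\<bar> powr p / S powr (p - 1)"
    using mult_left_mono[OF hat, of "\<bar>integral {s..t} g\<bar> powr p"] by (simp add: divide_inverse)
  moreover have "ennreal (\<bar>integral {s..t} g\<bar> powr p / S powr (p - 1)) \<le> energy g"
    using sum_increments_le_energy[of "{()}" "\<lambda>_. s" "\<lambda>_. t" g] st sub g by (simp add: disjoint_family_on_def S_def)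
  then have "\<bar>integral {s..t} g\<bar> powr p / S powr (p - 1) \<le> enn2real (energy g)"
    using fin by (metis enn2real_nonneg ennreal_enn2real_if ennreal_le_iff infinity_ennreal_def less_irrefl)
  ultimately show ?thesis by simp
qed

end

end

locale finitely_degenerate_weight = degenerate_weight +
  assumes fd: "finitely_degenerate p {a<..<b} w"
begin

lemma finite_components: "finite (components \<I>)"
  using fd by (simp add: finitely_degenerate_def)

lemma mem_I_component: "x \<in> \<I> \<Longrightarrow> \<exists>C\<in>components \<I>. x \<in> C"
  using Union_components[of \<I>] by blast

abbreviation hat :: "real \<Rightarrow> real" where "hat \<equiv> hat_weight p {a<..<b} w"
abbreviation X where "X \<equiv> Lp_hat p {a<..<b} w"
abbreviation norm_p where "norm_p \<equiv> Lp_hat_integral p {a<..<b} w"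
abbreviation dom where "dom \<equiv> Dom p {a<..<b} w"

lemma hat_outside: "x \<notin> \<I> \<Longrightarrow> hat x = 0"
  by (simp add: hat_weight_def)

lemma hat_pos: "x \<in> \<I> \<Longrightarrow> 0 < hat x"
  using mem_I_component hat_weight_component_pos by blast

lemma hat_nonneg: "0 \<le> hat x"
  using hat_pos hat_outside by (cases "x \<in> \<I>") (auto intro: less_imp_le)

lemma hat_bounded: obtains H where "0 < H" "\<And>x. hat x \<le> H"
proof -
  have "\<forall>C\<in>components \<I>. \<exists>H. \<forall>x\<in>C. hat x \<le> H" using hat_weight_component_bounded by blast
  then obtain h where h: "\<And>C x. C \<in> components \<I> \<Longrightarrow> x \<in> C \<Longrightarrow> hat x \<le> h C" by metis
  show thesis
  proof
    show "0 < (\<Sum>C\<in>components \<I>. \<bar>h C\<bar>) + 1" by (simp add: add_nonneg_pos sum_nonneg)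
    show "hat x \<le> (\<Sum>C\<in>components \<I>. \<bar>h C\<bar>) + 1" for x
    proof (cases "x \<in> \<I>")
      case True
      then obtain C where C: "C \<in> components \<I>" "x \<in> C" using mem_I_component by blast
      have "hat x \<le> \<bar>h C\<bar>" using h[OF C] by linarith
      also have "\<dots> \<le> (\<Sum>C\<in>components \<I>. \<bar>h C\<bar>)" using finite_components C by (intro member_le_sum) auto
      finally show ?thesis by simp
    next
      case False
      have "0 \<le> (\<Sum>C\<in>components \<I>. \<bar>h C\<bar>)" by (simp add: sum_nonneg)
      then show ?thesis using hat_outside[OF False] by linarith
    qed
  qed
qed

text \<open>Finitely many components, each with three pieces on which the weight is monotone or
  constant, and the complement of \<open>\<I>\<close>, where it is 0.\<close>

lemma hat_measurable_borel: "hat \<in> borel_measurable borel"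
proof -
  let ?parts = "\<lambda>C. {{Inf C<..<(3 * Inf C + Sup C) / 4}, {(3 * Inf C + Sup C) / 4..(Inf C + 3 * Sup C) / 4}, {(Inf C + 3 * Sup C) / 4<..<Sup C :: real}}"
  let ?F = "insert (- \<I>) (\<Union>C\<in>components \<I>. ?parts C)"
  show ?thesis
  proof (rule measurable_piecewise_restrict[of ?F])
    show "countable ?F" using finite_components by (intro countable_finite) auto
    show "T \<inter> space borel \<in> sets borel" if "T \<in> ?F" for T
      using that borel_comp[OF borel_open[OF open_I]] by auto
    show "space borel \<subseteq> \<Union>?F"
    proof
      fix x :: real
      show "x \<in> \<Union>?F"
      proof (cases "x \<in> \<I>")
        case True
        then obtain C where C: "C \<in> components \<I>" "x \<in> C" using mem_I_component by blast
        have "x < (3 * Inf C + Sup C) / 4 \<or> (3 * Inf C + Sup C) / 4 \<le> x \<and> x \<le> (Inf C + 3 * Sup C) / 4 \<or> (Inf C + 3 * Sup C) / 4 < x"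
          by linarith
        then have "x \<in> \<Union>(?parts C)" using mem_component_iff[OF C(1), of x] C(2) by (elim disjE) simp_all
        then show ?thesis using C(1) by blast
      qed simp
    qed
    show "hat \<in> borel_measurable (restrict_space borel T)" if T: "T \<in> ?F" for T
    proof (cases "T = - \<I>")
      case True
      then show ?thesis
        by (subst measurable_cong[where g = "\<lambda>_. 0"]) (auto simp: space_restrict_space hat_outside)
    next
      case False
      then obtain C where "C \<in> components \<I>" "T \<in> ?parts C" using T by blast
      then show ?thesis by (rule hat_weight_component_measurable)
    qed
  qed
qed

lemma hat_measurable [measurable]: "hat \<in> borel_measurable lebesgue"
  using hat_measurable_borel by (simp add: measurable_completion)

lemma measurable_on_\<Omega>:
  fixes u :: "real \<Rightarrow> real"
  shows "u \<in> borel_measurable (lebesgue_on {a<..<b}) \<Longrightarrow> (\<lambda>x. if x \<in> {a<..<b} then u x else 0) \<in> borel_measurable lebesgue"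
  by (rule borel_measurable_if_I) auto

lemma measurable_on_I:
  "u \<in> borel_measurable (lebesgue_on {a<..<b}) \<Longrightarrow> u \<in> borel_measurable (lebesgue_on \<I>)"
  using measurable_restrict_mono[OF _ I_subset] by blast

lemma norm_p_eq: "norm_p u = (\<integral>\<^sup>+ x. ennreal (\<bar>if x \<in> {a<..<b} then u x else 0\<bar> powr p * hat x powr (p - 1)) \<partial>lebesgue)"
  unfolding Lp_hat_integral_def using p_gt_1 by (intro nn_integral_cong) (auto simp: indicator_def)

text \<open>\<open>enn2real\<close> sends \<infinity> to 0, so a small seminorm of a difference
  carries information only once the integral is known to be finite.\<close>

lemma norm_p_diff_finite:
  assumes "u \<in> X" "v \<in> X"
  shows "norm_p (\<lambda>x. v x - u x) < \<infinity>"
proof -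
  have m: "(\<lambda>x. ennreal (\<bar>if x \<in> {a<..<b} then f x else 0\<bar> powr p * hat x powr (p - 1))) \<in> borel_measurable lebesgue" if "f \<in> X" for f
    using measurable_on_\<Omega>[of f] that by (simp add: Lp_hat_def)
  have "norm_p (\<lambda>x. v x - u x) \<le> (\<integral>\<^sup>+ x. ennreal (2 powr p) * (ennreal (\<bar>if x \<in> {a<..<b} then v x else 0\<bar> powr p * hat x powr (p - 1))
      + ennreal (\<bar>if x \<in> {a<..<b} then u x else 0\<bar> powr p * hat x powr (p - 1))) \<partial>lebesgue)"
    unfolding norm_p_eq
  proof (rule nn_integral_mono)
    fix x
    define y z k where "y = (if x \<in> {a<..<b} then v x else 0)" and "z = (if x \<in> {a<..<b} then u x else 0)" and "k = hat x powr (p - 1)"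
    have k: "0 \<le> k" by (simp add: k_def)
    have "\<bar>if x \<in> {a<..<b} then v x - u x else 0\<bar> powr p * k = \<bar>y + - z\<bar> powr p * k" by (simp add: y_def z_def)
    also have "\<dots> \<le> 2 powr p * (\<bar>y\<bar> powr p + \<bar>- z\<bar> powr p) * k"
      using powr_add_le[of p y "- z"] p_gt_1 k by (intro mult_right_mono) auto
    also have "\<dots> = 2 powr p * (\<bar>y\<bar> powr p * k + \<bar>z\<bar> powr p * k)" by (simp add: algebra_simps)
    finally have "ennreal (\<bar>if x \<in> {a<..<b} then v x - u x else 0\<bar> powr p * k) \<le> ennreal (2 powr p * (\<bar>y\<bar> powr p * k + \<bar>z\<bar> powr p * k))"
      by (rule ennreal_leI)
    also have "\<dots> = ennreal (2 powr p) * (ennreal (\<bar>y\<bar> powr p * k) + ennreal (\<bar>z\<bar> powr p * k))"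
      using k by (simp add: ennreal_mult ennreal_plus)
    finally show "ennreal (\<bar>if x \<in> {a<..<b} then v x - u x else 0\<bar> powr p * hat x powr (p - 1))
      \<le> ennreal (2 powr p) * (ennreal (\<bar>if x \<in> {a<..<b} then v x else 0\<bar> powr p * hat x powr (p - 1))
      + ennreal (\<bar>if x \<in> {a<..<b} then u x else 0\<bar> powr p * hat x powr (p - 1)))"
      by (simp only: y_def z_def k_def)
  qed
  also have "\<dots> = ennreal (2 powr p) * (norm_p v + norm_p u)"
    unfolding norm_p_eq
    by (simp only: nn_integral_cmult[OF borel_measurable_add[OF m[OF assms(2)] m[OF assms(1)]]]
      nn_integral_add[OF m[OF assms(2)] m[OF assms(1)]])
  also have "\<dots> < \<infinity>" using assms by (simp add: Lp_hat_def ennreal_mult_less_top)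
  finally show ?thesis .
qed

lemma bounded_imp_in_X:
  assumes u: "u \<in> borel_measurable (lebesgue_on {a<..<b})"
    and bd: "AE x in lebesgue. x \<in> {a<..<b} \<longrightarrow> \<bar>u x\<bar> powr p * hat x powr (p - 1) \<le> B"
  shows "u \<in> X"
proof -
  have "norm_p u \<le> (\<integral>\<^sup>+ x. ennreal B * indicator {a<..<b} x \<partial>lebesgue)"
    unfolding Lp_hat_integral_def
    by (rule nn_integral_mono_AE, use bd in eventually_elim) (auto simp: indicator_def intro: ennreal_leI)
  also have "\<dots> < \<infinity>" using a_less_b by (simp add: nn_integral_cmult_indicator ennreal_mult_less_top)
  finally show ?thesis using u by (simp add: Lp_hat_def)
qed

text \<open>On each component \<open>u\<close> is compared with its value at the midpoint: the
  increment, weighted, is bounded by the energy, and the finitely many midpoint values together with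
  the bound on the weight control the rest.\<close>

lemma dom_subset_X: "dom \<subseteq> X"
proof
  fix u assume u: "u \<in> dom"
  define g where "g = weak_deriv \<I> u"
  have wd: "has_weak_derivative \<I> u g" using u has_weak_derivative_weak_deriv by (simp add: Dom_def g_def)
  have fin: "energy g < \<infinity>" using u by (simp add: Dom_def g_def energy_eq_Dom_energy)
  have g: "g locally_integrable_on \<I>" using wd by (simp add: has_weak_derivative_def)
  obtain v N where N: "negligible N" and vu: "\<forall>x\<in>\<I> - N. v x = u x"
    and v: "\<forall>x y. x \<le> y \<longrightarrow> {x..y} \<subseteq> \<I> \<longrightarrow> v y - v x = integral {x..y} g"
    using ae_primitive_representative[OF weak_derivative_imp_ae_primitive[OF wd open_I] open_I g] .
  obtain H where H: "0 < H" "\<And>x. hat x \<le> H" using hat_bounded by blast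
  define B where "B = 2 powr p * (enn2real (energy g) + (\<Sum>C\<in>components \<I>. \<bar>v ((Inf C + Sup C) / 2)\<bar> powr p * H powr (p - 1)))"
  have B0: "0 \<le> B" using H by (auto simp: B_def intro!: mult_nonneg_nonneg add_nonneg_nonneg sum_nonneg)
  have "\<bar>u x\<bar> powr p * hat x powr (p - 1) \<le> B" if "x \<notin> N" for x
  proof (cases "x \<in> \<I>")
    case False
    then show ?thesis using hat_outside B0 p_gt_1 by simp
  next
    case True
    then obtain C where C: "C \<in> components \<I>" "x \<in> C" using mem_I_component by blast
    define m where "m = (Inf C + Sup C) / 2"
    have ux: "u x = v x" using vu True that by auto
    have "\<bar>v x\<bar> powr p \<le> 2 powr p * (\<bar>v m - v x\<bar> powr p + \<bar>v m\<bar> powr p)"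
      using powr_add_le[of p "v x - v m" "v m"] p_gt_1 by (simp add: abs_minus_commute)
    then have "\<bar>v x\<bar> powr p * hat x powr (p - 1) \<le> 2 powr p * (\<bar>v m - v x\<bar> powr p + \<bar>v m\<bar> powr p) * hat x powr (p - 1)"
      by (intro mult_right_mono) auto
    also have "\<dots> = 2 powr p * (\<bar>v m - v x\<bar> powr p * hat x powr (p - 1) + \<bar>v m\<bar> powr p * hat x powr (p - 1))"
      by (simp add: algebra_simps)
    also have "\<dots> \<le> B"
      unfolding B_def
    proof (intro mult_left_mono add_mono)
      show "\<bar>v m - v x\<bar> powr p * hat x powr (p - 1) \<le> enn2real (energy g)"
      proof (rule increment_times_hat_weight_le[OF C(1) g fin _ C(2)])
        show "v z - v y = integral {y..z} g" if "y \<le> z" "{y..z} \<subseteq> \<I>" for y z using v that by blast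
        show "min x ((Inf C + Sup C) / 2) \<le> m" unfolding m_def by (rule min.cobounded2)
        show "m \<le> max x ((Inf C + Sup C) / 2)" unfolding m_def by (rule max.cobounded2)
      qed
      have "\<bar>v m\<bar> powr p * hat x powr (p - 1) \<le> \<bar>v m\<bar> powr p * H powr (p - 1)"
        using H p_gt_1 hat_nonneg by (intro mult_left_mono powr_mono2) auto
      also have "\<dots> \<le> (\<Sum>C\<in>components \<I>. \<bar>v ((Inf C + Sup C) / 2)\<bar> powr p * H powr (p - 1))"
        unfolding m_def using finite_components C(1) by (intro member_le_sum) auto
      finally show "\<bar>v m\<bar> powr p * hat x powr (p - 1) \<le> (\<Sum>C\<in>components \<I>. \<bar>v ((Inf C + Sup C) / 2)\<bar> powr p * H powr (p - 1))" .
    qed auto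
    finally show ?thesis by (simp add: ux)
  qed
  moreover have "AE x in lebesgue. x \<notin> N" using N(1) by (intro AE_not_in) (simp add: negligible_iff_null_sets)
  ultimately have "AE x in lebesgue. x \<in> {a<..<b} \<longrightarrow> \<bar>u x\<bar> powr p * hat x powr (p - 1) \<le> B"
    by (auto elim!: eventually_mono)
  then show "u \<in> X" using u by (intro bounded_imp_in_X) (auto simp: Dom_def)
qed

section \<open>The candidate for the envelope: a lower semicontinuous minorant\<close>

definition relaxed :: "(real \<Rightarrow> real) \<Rightarrow> ennreal"
  where "relaxed u = (if u \<in> dom then Dom_energy p {a<..<b} w u else \<infinity>)"

text \<open>The classical derivative of the absolutely continuous representative is a weak
  derivative on \<open>\<I>\<close>, and restricting its energy from (a,b) to \<open>\<I>\<close>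
  can only lower it.\<close>

lemma relaxed_le_F:
  assumes u: "u \<in> X"
  shows "relaxed u \<le> F_functional p w a b u"
proof (cases "\<exists>v. AC_rep a b u v")
  case False
  then show ?thesis by (simp add: F_functional_def)
next
  case True
  define v where "v = (SOME v. AC_rep a b u v)"
  have "AC_rep a b u v" unfolding v_def using True by (rule someI_ex)
  then have v: "v \<in> AC a b" and ae: "AE x in lebesgue. x \<in> {a<..<b} \<longrightarrow> v x = u x" by (auto simp: AC_rep_def)
  have um: "u \<in> borel_measurable (lebesgue_on {a<..<b})" using u by (simp add: Lp_hat_def)
  have F: "F_functional p w a b u = (\<integral>\<^sup>+ x \<in> {a<..<b}. ennreal (\<bar>deriv v x\<bar> powr p * w x) \<partial>lebesgue)"
    using True by (simp add: F_functional_def v_def)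
  note ftc = AC_fundamental_theorem[OF v less_imp_le[OF a_less_b]]
  have sub: "{x..y} \<subseteq> {a..b}" if "{x..y} \<subseteq> \<I>" for x y using that I_subset by fastforce
  have g: "deriv v locally_integrable_on \<I>"
    by (rule locally_integrable_onI[OF open_I], rule absolutely_integrable_on_subinterval[OF ftc(1)]) (rule sub)
  obtain N where N: "N \<in> null_sets lebesgue" "{x \<in> space lebesgue. \<not> (x \<in> {a<..<b} \<longrightarrow> v x = u x)} \<subseteq> N"
    using ae by (auto simp: eventually_ae_filter)
  have "ae_primitive_on \<I> u (deriv v)"
    unfolding ae_primitive_on_def
  proof (intro exI[of _ N] conjI allI impI)
    show "negligible N" using N(1) by (simp add: negligible_iff_null_sets)
    fix x y assume xy: "x \<notin> N" "y \<notin> N" "x \<le> y" "{x..y} \<subseteq> \<I>"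
    have uv: "v z = u z" if "z \<in> {a<..<b}" "z \<notin> N" for z using N(2) that by auto
    have "x \<in> \<I>" "y \<in> \<I>" using xy by auto
    then have "x \<in> {a<..<b}" "y \<in> {a<..<b}" using I_subset by blast+
    then have "u x = v x" "u y = v y" using uv xy by simp_all
    then show "u y - u x = integral {x..y} (deriv v)"
      using ftc(2)[of x y] \<open>x \<in> {a<..<b}\<close> \<open>y \<in> {a<..<b}\<close> xy(3) by (simp add: integral_unique)
  qed
  then have wd: "has_weak_derivative \<I> u (deriv v)"
    by (rule ae_primitive_imp_weak_derivative[OF _ open_I g measurable_on_I[OF um]])
  have le: "energy (deriv v) \<le> F_functional p w a b u"
    unfolding energy_def F using I_subset by (intro nn_integral_mono mult_left_mono) (auto simp: indicator_def)
  show ?thesis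
  proof (cases "F_functional p w a b u = \<infinity>")
    case False
    have "Dom_energy p {a<..<b} w u = energy (deriv v)"
      using energy_weak_deriv[OF wd] by (simp add: energy_eq_Dom_energy)
    moreover have "energy (deriv v) < \<infinity>" using le False by (simp add: less_top[symmetric]) (metis top.extremum_uniqueI)
    moreover have "u \<in> W11_loc \<I>" using wd by (auto simp: W11_loc_def)
    ultimately have "u \<in> dom" "relaxed u = energy (deriv v)" using um by (auto simp: Dom_def relaxed_def)
    then show ?thesis using le by simp
  qed simp
qed

lemma seminorm_less_imp:
  assumes "u \<in> X" "v \<in> X" "Lp_hat_seminorm p {a<..<b} w (\<lambda>x. v x - u x) < e" "0 < e"
  shows "norm_p (\<lambda>x. v x - u x) < ennreal (e powr p)"
proof -
  have "norm_p (\<lambda>x. v x - u x) < \<infinity>" by (rule norm_p_diff_finite[OF assms(1,2)])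
  then obtain r where r: "norm_p (\<lambda>x. v x - u x) = ennreal r" "0 \<le> r" by (cases "norm_p (\<lambda>x. v x - u x)") auto
  have "r powr (1 / p) < e" using assms(3) r by (simp add: Lp_hat_seminorm_def)
  then have "(r powr (1 / p)) powr p < e powr p" using p_gt_1 by (intro powr_less_mono2) auto
  then have "r < e powr p" using p_gt_1 r(2) by (simp add: powr_powr)
  then show ?thesis using r by (simp add: ennreal_less_iff)
qed

text \<open>If no ball around \<open>u\<close> lies in the superlevel set, there are
  \<open>v n\<close> within 1/(n+1) of \<open>u\<close> with energy at most \<open>c\<close>. The
  weighted p-th powers of the differences tend to 0 in L1, hence almost everywhere along a
  subsequence; on \<open>\<I>\<close> the positive weight can be divided out, and
  \<open>energy_lower_semicontinuous\<close> bounds the energy of \<open>u\<close> by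
  \<open>c\<close>.\<close>

lemma relaxed_lsc: "lsc_map (Lp_hat_topology p {a<..<b} w) relaxed"
  unfolding lsc_map_def
proof
  fix c
  show "openin (Lp_hat_topology p {a<..<b} w) {u \<in> topspace (Lp_hat_topology p {a<..<b} w). c < relaxed u}"
    unfolding openin_Lp_hat_topology topspace_Lp_hat_topology
  proof (intro conjI ballI)
    fix u assume "u \<in> {u \<in> X. c < relaxed u}"
    then have u: "u \<in> X" "c < relaxed u" by auto
    show "\<exists>e>0. \<forall>v\<in>X. Lp_hat_seminorm p {a<..<b} w (\<lambda>x. v x - u x) < e \<longrightarrow> v \<in> {u \<in> X. c < relaxed u}"
    proof (rule ccontr)
      assume no: "\<not> ?thesis"
      have "\<exists>v\<in>X. Lp_hat_seminorm p {a<..<b} w (\<lambda>x. v x - u x) < 1 / real (Suc n) \<and> relaxed v \<le> c" for n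
        using no by (auto simp: not_less dest!: spec[of _ "1 / real (Suc n)"])
      then obtain v where v: "\<And>n. v n \<in> X" "\<And>n. Lp_hat_seminorm p {a<..<b} w (\<lambda>x. v n x - u x) < 1 / real (Suc n)"
        "\<And>n. relaxed (v n) \<le> c" by metis
      have cfin: "c < \<infinity>" using u(2) by (metis infinity_ennreal_def not_less_iff_gr_or_eq not_top_less order.strict_trans top.not_eq_extremum)
      define C where "C = enn2real c"
      have C: "c = ennreal C" "0 \<le> C" using cfin by (auto simp: C_def)
      have vdom: "v n \<in> dom" for n
        using v(3)[of n] cfin by (auto simp: relaxed_def split: if_splits)
      define g where "g n = weak_deriv \<I> (v n)" for n
      have wd: "has_weak_derivative \<I> (v n) (g n)" for n
        using vdom has_weak_derivative_weak_deriv by (simp add: Dom_def g_def)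
      have en: "energy (g n) \<le> ennreal C" for n
        using v(3)[of n] vdom[of n] C by (simp add: relaxed_def energy_eq_Dom_energy g_def)
      define f where "f n x = \<bar>if x \<in> {a<..<b} then v n x - u x else 0\<bar> powr p * hat x powr (p - 1)" for n x
      have f0: "0 \<le> f n x" for n x by (simp add: f_def)
      have fm: "f n \<in> borel_measurable lebesgue" for n
      proof -
        have "(\<lambda>x. v n x - u x) \<in> borel_measurable (lebesgue_on {a<..<b})"
          using u(1) v(1)[of n] by (intro borel_measurable_diff) (auto simp: Lp_hat_def)
        from measurable_on_\<Omega>[OF this] show ?thesis unfolding f_def[abs_def] by measurable
      qed
      have fn: "(\<integral>\<^sup>+ x. ennreal (f n x) \<partial>lebesgue) < ennreal ((1 / real (Suc n)) powr p)" for n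
        using seminorm_less_imp[OF u(1) v(1) v(2)] unfolding norm_p_eq f_def by simp
      have fi: "integrable lebesgue (f n)" for n
        using f0 fn[of n] by (intro integrableI_nonneg fm) (auto intro: less_trans)
      have "(\<lambda>n. \<integral>x. norm (f n x) \<partial>lebesgue) \<longlonglongrightarrow> 0"
      proof (rule tendsto_sandwich[of "\<lambda>_. 0" _ _ "\<lambda>n. (1 / real (Suc n)) powr p"])
        have "(\<integral>x. norm (f n x) \<partial>lebesgue) \<le> (1 / real (Suc n)) powr p" for n
        proof -
          have "ennreal (\<integral>x. f n x \<partial>lebesgue) < ennreal ((1 / real (Suc n)) powr p)"
            using fn[of n] nn_integral_eq_integral[OF fi] f0 by simp
          then show ?thesis using f0 by (simp add: ennreal_less_iff)
        qed
        then show "\<forall>\<^sub>F n in sequentially. (\<integral>x. norm (f n x) \<partial>lebesgue) \<le> (1 / real (Suc n)) powr p" by simp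
        have "(\<lambda>n. (1 / real (Suc n)) powr p) \<longlonglongrightarrow> 0 powr p"
          using p_gt_1 LIMSEQ_Suc[OF lim_const_over_n[of 1]] by (intro tendsto_powr2) auto
        then show "(\<lambda>n. (1 / real (Suc n)) powr p) \<longlonglongrightarrow> 0" by simp
      qed auto
      from tendsto_L1_AE_subseq[OF fi this] obtain r where r: "strict_mono r" "AE x in lebesgue. (\<lambda>n. f (r n) x) \<longlonglongrightarrow> 0" by blast
      have conv: "AE x in lebesgue. x \<in> \<I> \<longrightarrow> (\<lambda>n. v (r n) x) \<longlonglongrightarrow> u x"
        using r(2)
      proof eventually_elim
        case (elim x)
        show ?case
        proof
          assume x: "x \<in> \<I>"
          then have x': "x \<in> {a<..<b}" using I_subset by blast
          have "(\<lambda>n. f (r n) x / hat x powr (p - 1)) \<longlonglongrightarrow> 0 / hat x powr (p - 1)"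
            using hat_pos[OF x] by (intro tendsto_divide elim tendsto_const) simp
          then have "(\<lambda>n. \<bar>v (r n) x - u x\<bar> powr p) \<longlonglongrightarrow> 0" using hat_pos[OF x] x' by (simp add: f_def)
          then have "(\<lambda>n. v (r n) x - u x) \<longlonglongrightarrow> 0" using p_gt_1 powr_tendsto_0_imp_tendsto_0[of p "\<lambda>n. v (r n) x - u x"] by simp
          then show "(\<lambda>n. v (r n) x) \<longlonglongrightarrow> u x" by (simp add: LIM_zero_iff)
        qed
      qed
      have um: "u \<in> borel_measurable (lebesgue_on {a<..<b})" using u(1) by (simp add: Lp_hat_def)
      obtain h where h: "has_weak_derivative \<I> u h" "energy h \<le> ennreal C"
      proof (rule energy_lower_semicontinuous[where v = "\<lambda>n. v (r n)" and g = "\<lambda>n. g (r n)" and C = C and u = u])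
        show "has_weak_derivative \<I> (v (r n)) (g (r n))" "energy (g (r n)) \<le> ennreal C" for n
          by (rule wd, rule en)
      qed (rule C(2), rule conv, rule measurable_on_I[OF um])
      have "Dom_energy p {a<..<b} w u \<le> c"
        using energy_weak_deriv[OF h(1)] h(2) C by (simp add: energy_eq_Dom_energy)
      moreover from this have "Dom_energy p {a<..<b} w u < \<infinity>" using cfin by (rule order.strict_trans1)
      moreover have "u \<in> W11_loc \<I>" using h(1) by (auto simp: W11_loc_def)
      ultimately have "relaxed u \<le> c" using um by (simp add: relaxed_def Dom_def)
      then show False using u(2) by simp
    qed
  qed auto
qed

end

section \<open>Recovery sequences\<close>

text \<open>A crude bound through the largest term; dependence on the number of terms is harmless
  since there are finitely many components.\<close>

lemma abs_sum_powr_le: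
  fixes f :: "'i \<Rightarrow> real"
  assumes "finite S" "1 \<le> p"
  shows "\<bar>\<Sum>i\<in>S. f i\<bar> powr p \<le> real (card S) powr p * (\<Sum>i\<in>S. \<bar>f i\<bar> powr p)"
proof (cases "S = {}")
  case True
  then show ?thesis using assms by simp
next
  case False
  define M where "M = Max ((\<lambda>i. \<bar>f i\<bar>) ` S)"
  have "M \<in> (\<lambda>i. \<bar>f i\<bar>) ` S" unfolding M_def using assms(1) False by (intro Max_in) auto
  then obtain j where j: "j \<in> S" "M = \<bar>f j\<bar>" by blast
  have "\<bar>\<Sum>i\<in>S. f i\<bar> \<le> (\<Sum>i\<in>S. M)"
    using assms(1) by (intro order_trans[OF sum_abs] sum_mono) (auto simp: M_def)
  then have "\<bar>\<Sum>i\<in>S. f i\<bar> \<le> real (card S) * M" by simp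
  then have "\<bar>\<Sum>i\<in>S. f i\<bar> powr p \<le> (real (card S) * M) powr p" using assms(2) by (intro powr_mono2) auto
  also have "\<dots> = real (card S) powr p * \<bar>f j\<bar> powr p" using j by (simp add: powr_mult)
  also have "\<dots> \<le> real (card S) powr p * (\<Sum>i\<in>S. \<bar>f i\<bar> powr p)"
    using j(1) assms(1) by (intro mult_left_mono member_le_sum) auto
  finally show ?thesis .
qed

text \<open>For choosing a length \<open>d\<close>, with \<open>y\<close> the number of components
  times an error constant; the summand 1 covers y = 0.\<close>

lemma double_mult_le_half:
  fixes y d e :: real
  assumes "0 \<le> y" "0 < e" "d \<le> e / (4 * (y + 1))"
  shows "2 * y * d \<le> e / 2"
proof (cases "0 \<le> d")
  case True
  have "4 * (y + 1) * d \<le> e" using assms by (simp add: pos_le_divide_eq mult.commute)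
  moreover have "4 * y * d \<le> 4 * (y + 1) * d" using True by (intro mult_right_mono) auto
  ultimately show ?thesis by linarith
next
  case False
  then have "2 * y * d \<le> 0" using assms(1) by (intro mult_nonneg_nonpos) auto
  then show ?thesis using assms(2) by linarith
qed

text \<open>The functional picks an arbitrary representative, but continuous functions that agree
  almost everywhere agree on all of (a,b), so the derivatives coincide at every point there.\<close>

lemma F_functional_AC:
  assumes v: "v \<in> AC a b"
  shows "F_functional p w a b v = (\<integral>\<^sup>+ x \<in> {a<..<b}. ennreal (\<bar>deriv v x\<bar> powr p * w x) \<partial>lebesgue)"
proof -
  have ex: "\<exists>v'. AC_rep a b v v'" using v by (intro exI[of _ v]) (simp add: AC_rep_def)
  define z where "z = (SOME v'. AC_rep a b v v')"
  have "AC_rep a b v z" unfolding z_def using ex by (rule someI_ex)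
  then have z: "z \<in> AC a b" and ae: "AE x in lebesgue. x \<in> {a<..<b} \<longrightarrow> z x = v x" by (auto simp: AC_rep_def)
  obtain N where N: "N \<in> null_sets lebesgue" "{x \<in> space lebesgue. \<not> (x \<in> {a<..<b} \<longrightarrow> z x = v x)} \<subseteq> N"
    using ae by (auto simp: eventually_ae_filter)
  have negl: "negligible N" using N(1) by (simp add: negligible_iff_null_sets)
  have eq: "z x = v x" if x: "x \<in> {a<..<b}" for x
  proof (rule ccontr)
    assume ne: "z x \<noteq> v x"
    have "continuous_on {a..b} (\<lambda>y. z y - v y)" by (intro continuous_intros AC_imp_continuous_on v z)
    then have "isCont (\<lambda>y. z y - v y) x"
      by (rule continuous_on_interior) (use x in \<open>simp add: interior_atLeastAtMost_real\<close>)
    then obtain d where d: "0 < d" "\<And>y. dist x y < d \<Longrightarrow> z y - v y \<noteq> 0"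
      using continuous_at_avoid[of x "\<lambda>y. z y - v y" 0] ne by auto
    obtain d' where d': "0 < d'" "ball x d' \<subseteq> {a<..<b}" using openE[OF open_greaterThanLessThan x] .
    have "0 < min d d'" using d d' by simp
    then obtain y where y: "y \<notin> N" "dist x y < min d d'" using not_negligible_ball[OF negl] by metis
    then have "y \<in> {a<..<b}" using d'(2) by auto
    then have "z y = v y" using N(2) y(1) by auto
    then show False using d(2)[of y] y(2) by simp
  qed
  have "deriv z x = deriv v x" if x: "x \<in> {a<..<b}" for x
    by (rule deriv_cong_ev) (use x eq in \<open>auto intro!: eventually_nhds_in_open[of "{a<..<b}", THEN eventually_mono]\<close>)
  then have "(\<integral>\<^sup>+ x \<in> {a<..<b}. ennreal (\<bar>deriv z x\<bar> powr p * w x) \<partial>lebesgue)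
      = (\<integral>\<^sup>+ x \<in> {a<..<b}. ennreal (\<bar>deriv v x\<bar> powr p * w x) \<partial>lebesgue)"
    by (intro nn_integral_cong) (auto simp: indicator_def)
  then show ?thesis using ex by (simp add: F_functional_def z_def)
qed

lemma nn_integral_Icc_const:
  "0 \<le> c \<Longrightarrow> s \<le> t \<Longrightarrow> (\<integral>\<^sup>+ x. ennreal (c * indicator {s..t} x) \<partial>lebesgue) = ennreal (c * (t - s))"
  for c s t :: real
  by (simp add: ennreal_mult'' ennreal_indicator nn_integral_cmult_indicator ennreal_mult)

context degenerate_weight
begin

text \<open>Near a point \<open>c\<close> outside \<open>\<I>\<close> the function \<open>\<sigma>\<close> is not integrable, so its truncations,
  normalised to integral one, have arbitrarily small energy.\<close>

lemma cheap_transition: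
  assumes c: "c \<in> {a<..<b}" "c \<notin> \<I>" and "0 < \<epsilon>" "0 < \<kappa>"
  obtains l where "l absolutely_integrable_on {c - \<epsilon>..c + \<epsilon>}" "\<forall>x. 0 \<le> l x" "\<forall>x. x \<notin> {c - \<epsilon>..c + \<epsilon>} \<longrightarrow> l x = 0"
    "integral {c - \<epsilon>..c + \<epsilon>} l = 1" "l \<in> borel_measurable lebesgue"
    "(\<integral>\<^sup>+ x. ennreal (l x powr p * w x) \<partial>lebesgue) \<le> ennreal \<kappa>"
proof -
  define J where "J = {c - \<epsilon><..<c + \<epsilon>}"
  have J [measurable]: "J \<in> sets lebesgue" by (simp add: J_def)
  \<comment> \<open>\<open>inv_weight\<close> truncated at level \<open>k\<close> on
    \<open>J\<close>: where \<open>w\<close> is not positive it is infinite, so the truncation is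
    \<open>k\<close> itself.\<close>
  define \<tau> where "\<tau> k x = (if x \<in> J then if 0 < w x then min (\<sigma> x) (real k) else real k else 0)" for k x
  have \<tau>_meas [measurable]: "\<tau> k \<in> borel_measurable lebesgue" for k unfolding \<tau>_def[abs_def] by measurable
  have \<tau>_bounds: "0 \<le> \<tau> k x" "\<tau> k x \<le> real k" for k x by (auto simp: \<tau>_def \<sigma>_nonneg)
  have \<tau>_eq: "ennreal (\<tau> k x) = min (inv_weight p w x) (of_nat k) * indicator J x" for k x
  proof (cases "0 < w x")
    case True
    then show ?thesis
      by (simp add: \<tau>_def inv_weight_eq_\<sigma> indicator_def ennreal_of_nat_eq_real_of_nat min_def ennreal_le_iff2 \<sigma>_nonneg)
  next
    case False
    then show ?thesis by (simp add: \<tau>_def inv_weight_def indicator_def ennreal_of_nat_eq_real_of_nat)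
  qed
  have SUP_min: "(SUP k. min y (of_nat k :: ennreal)) = y" for y
  proof -
    have "(SUP k. min y (of_nat k :: ennreal)) = min y (SUP k. of_nat k)"
      using inf_SUP[of y "\<lambda>k. of_nat k :: ennreal" UNIV] by (simp add: inf_min)
    then show ?thesis by (simp add: ennreal_SUP_of_nat_eq_top)
  qed
  have "(SUP k. \<integral>\<^sup>+ x. ennreal (\<tau> k x) \<partial>lebesgue) = (\<integral>\<^sup>+ x. (SUP k. ennreal (\<tau> k x)) \<partial>lebesgue)"
  proof (rule nn_integral_monotone_convergence_SUP[symmetric])
    show "incseq (\<lambda>k x. ennreal (\<tau> k x))"
      by (auto simp: incseq_def le_fun_def \<tau>_def intro!: ennreal_leI)
  qed measurable
  also have "\<dots> = (\<integral>\<^sup>+ x \<in> J. inv_weight p w x \<partial>lebesgue)"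
    unfolding \<tau>_eq SUP_mult_right_ennreal[symmetric] SUP_min ..
  also have "\<dots> = \<infinity>"
  proof (rule ccontr)
    assume "\<not> ?thesis"
    then have "(\<integral>\<^sup>+ x \<in> {c - \<epsilon><..<c + \<epsilon>}. inv_weight p w x \<partial>lebesgue) < \<infinity>" by (simp add: J_def less_top)
    then have "c \<in> \<I>" using c(1) \<open>0 < \<epsilon>\<close> by (auto simp: I_set_def)
    then show False using c(2) by simp
  qed
  finally have SUP: "(SUP k. \<integral>\<^sup>+ x. ennreal (\<tau> k x) \<partial>lebesgue) = \<infinity>" .
  \<comment> \<open>The energy of the normalised truncation will be at most T^(1-p), where
    \<open>T\<close> is its mass before normalisation, and M^(1-p) = \<kappa>.\<close>
  define M where "M = \<kappa> powr (- 1 / (p - 1))"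
  have M: "0 < M" using \<open>0 < \<kappa>\<close> by (simp add: M_def)
  have "ennreal M < (SUP k. \<integral>\<^sup>+ x. ennreal (\<tau> k x) \<partial>lebesgue)" unfolding SUP by simp
  then obtain k where k: "ennreal M < (\<integral>\<^sup>+ x. ennreal (\<tau> k x) \<partial>lebesgue)" by (auto simp: less_SUP_iff)
  have int: "integrable lebesgue (\<tau> k)"
  proof (rule integrableI_bounded_set[where A = J and B = "real k"])
    show "emeasure lebesgue J < \<infinity>" using \<open>0 < \<epsilon>\<close> by (simp add: J_def)
    show "AE x in lebesgue. x \<notin> J \<longrightarrow> \<tau> k x = 0" by (simp add: \<tau>_def)
    show "AE x in lebesgue. x \<in> J \<longrightarrow> norm (\<tau> k x) \<le> real k" using \<tau>_bounds by (intro AE_I2) simp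
  qed measurable
  define T where "T = (\<integral>x. \<tau> k x \<partial>lebesgue)"
  have T: "(\<integral>\<^sup>+ x. ennreal (\<tau> k x) \<partial>lebesgue) = ennreal T"
    unfolding T_def using int \<tau>_bounds by (intro nn_integral_eq_integral) auto
  have MT: "M < T" using k M unfolding T by (simp add: ennreal_less_iff)
  then have T0: "0 < T" using M by simp
  define l where "l x = \<tau> k x / T" for x
  have l_int: "integrable lebesgue l" unfolding l_def[abs_def] using int by simp
  have l_out: "l x = 0" if "x \<notin> {c - \<epsilon>..c + \<epsilon>}" for x using that by (auto simp: l_def \<tau>_def J_def)
  have l_ind: "(\<lambda>x. indicator {c - \<epsilon>..c + \<epsilon>} x *\<^sub>R l x) = l"
  proof
    show "indicator {c - \<epsilon>..c + \<epsilon>} x *\<^sub>R l x = l x" for x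
      using l_out[of x] by (cases "x \<in> {c - \<epsilon>..c + \<epsilon>}") auto
  qed
  have l_abs: "l absolutely_integrable_on {c - \<epsilon>..c + \<epsilon>}"
    unfolding set_integrable_def l_ind by (rule l_int)
  show thesis
  proof
    show "l absolutely_integrable_on {c - \<epsilon>..c + \<epsilon>}" by (rule l_abs)
    show "\<forall>x. 0 \<le> l x" using \<tau>_bounds T0 by (simp add: l_def)
    show "\<forall>x. x \<notin> {c - \<epsilon>..c + \<epsilon>} \<longrightarrow> l x = 0" using l_out by blast
    show "l \<in> borel_measurable lebesgue" using l_int by (rule borel_measurable_integrable)
    have "integral {c - \<epsilon>..c + \<epsilon>} l = (\<integral>x. l x \<partial>lebesgue)"
      using set_lebesgue_integral_eq_integral(2)[OF l_abs] by (simp only: set_lebesgue_integral_def l_ind)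
    then show "integral {c - \<epsilon>..c + \<epsilon>} l = 1" using T0 by (simp add: l_def[abs_def] T_def)
    have "(\<integral>\<^sup>+ x. ennreal (l x powr p * w x) \<partial>lebesgue) \<le> (\<integral>\<^sup>+ x. ennreal (T powr - p) * ennreal (\<tau> k x) \<partial>lebesgue)"
    proof (rule nn_integral_mono)
      fix x
      have "l x powr p * w x \<le> T powr - p * \<tau> k x"
      proof (cases "0 < w x \<and> 0 < \<tau> k x")
        case False
        have "l x powr p * w x \<le> 0"
        proof (cases "0 < \<tau> k x")
          case True
          then have "w x \<le> 0" using False by auto
          then show ?thesis by (simp add: mult_nonneg_nonpos)
        next
          case False
          then have "l x = 0" using \<tau>_bounds(1)[of k x] by (simp add: l_def)
          then show ?thesis by simp
        qed
        also have "0 \<le> T powr - p * \<tau> k x" using \<tau>_bounds by simp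
        finally show ?thesis .
      next
        case True
        then have wx: "0 < w x" and tx: "0 < \<tau> k x" by auto
        \<comment> \<open>Since \<sigma>^(p-1) = 1/w, staying below \<sigma> gives \<tau>^p w \<le>
          \<tau>: the energy is bounded by the mass, up to the factor T^(-p).\<close>
        have "\<tau> k x \<le> \<sigma> x" using wx \<sigma>_nonneg by (auto simp: \<tau>_def)
        then have "\<tau> k x powr (p - 1) \<le> \<sigma> x powr (p - 1)" using tx p_gt_1 by (intro powr_mono2) auto
        also have "\<sigma> x powr (p - 1) = w x powr - 1" using wx p_gt_1 by (simp add: \<sigma>_def powr_powr)
        finally have "\<tau> k x powr (p - 1) * w x \<le> 1" using wx by (simp add: powr_minus divide_inverse[symmetric] field_simps)
        then have "\<tau> k x * (\<tau> k x powr (p - 1) * w x) \<le> \<tau> k x * 1" using tx by (intro mult_left_mono) auto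
        then have "\<tau> k x powr p * w x \<le> \<tau> k x" using tx by (simp add: powr_diff)
        then have "T powr - p * (\<tau> k x powr p * w x) \<le> T powr - p * \<tau> k x" by (intro mult_left_mono) auto
        moreover have "l x powr p = \<tau> k x powr p / T powr p"
          unfolding l_def using T0 tx by (simp add: powr_divide)
        moreover have "T powr - p = 1 / T powr p" by (rule powr_minus_divide)
        ultimately show ?thesis by simp
      qed
      then show "ennreal (l x powr p * w x) \<le> ennreal (T powr - p) * ennreal (\<tau> k x)"
        using \<tau>_bounds by (simp add: ennreal_mult[symmetric] ennreal_leI)
    qed
    also have "\<dots> = ennreal (T powr - p * T)"
      using T0 by (subst nn_integral_cmult) (auto simp: T ennreal_mult)
    also have "T powr - p * T = T powr (1 - p)" using T0 by (simp add: powr_diff powr_minus divide_inverse)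
    also have "\<dots> \<le> M powr (1 - p)" using MT M p_gt_1 by (intro powr_mono2') auto
    also have "M powr (1 - p) = \<kappa>"
    proof -
      have "- 1 / (p - 1) * (1 - p) = 1" using p_gt_1 by (simp add: field_simps)
      then show ?thesis using \<open>0 < \<kappa>\<close> by (simp add: M_def powr_powr)
    qed
    finally show "(\<integral>\<^sup>+ x. ennreal (l x powr p * w x) \<partial>lebesgue) \<le> ennreal \<kappa>"
      by (simp add: ennreal_leI)
  qed
qed

text \<open>\<open>L0 + integral {a..x} l\<close> steps from 0 to 1 within \<epsilon> of
  \<open>c\<close>, by integrating the density of \<open>cheap_transition\<close>. At
  \<open>c = a\<close> or \<open>c = b\<close> only one side of \<open>c\<close> lies in (a,b), so
  the constant 1 or 0 serves and costs nothing.\<close>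

lemma cheap_cutoff:
  assumes c: "a \<le> c" "c \<le> b" "c \<notin> \<I>" and "0 < \<epsilon>" "0 < \<kappa>" "c = a \<or> a \<le> c - \<epsilon>" "c = b \<or> c + \<epsilon> \<le> b"
  shows "\<exists>l L0. l absolutely_integrable_on {a..b} \<and> l \<in> borel_measurable lebesgue \<and> (\<forall>x. 0 \<le> l x) \<and> (\<forall>x. \<epsilon> < \<bar>x - c\<bar> \<longrightarrow> l x = 0)
    \<and> (\<integral>\<^sup>+ x. ennreal (l x powr p * w x) \<partial>lebesgue) \<le> ennreal \<kappa>
    \<and> (\<forall>x\<in>{a<..<b}. 0 \<le> L0 + integral {a..x} l \<and> L0 + integral {a..x} l \<le> 1
        \<and> (x \<le> c - \<epsilon> \<longrightarrow> L0 + integral {a..x} l = 0) \<and> (c + \<epsilon> \<le> x \<longrightarrow> L0 + integral {a..x} l = 1))"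
proof (cases "c = a \<or> c = b")
  case True
  show ?thesis
    using True \<open>0 < \<epsilon>\<close> a_less_b
    by (intro exI[of _ "\<lambda>_. 0"] exI[of _ "if c = a then 1 else 0 :: real"]) auto
next
  case False
  then have cb: "c \<in> {a<..<b}" "a \<le> c - \<epsilon>" "c + \<epsilon> \<le> b" using assms by auto
  obtain l where l: "l absolutely_integrable_on {c - \<epsilon>..c + \<epsilon>}" "\<forall>x. 0 \<le> l x" "\<forall>x. x \<notin> {c - \<epsilon>..c + \<epsilon>} \<longrightarrow> l x = 0"
    "integral {c - \<epsilon>..c + \<epsilon>} l = 1" "l \<in> borel_measurable lebesgue"
    "(\<integral>\<^sup>+ x. ennreal (l x powr p * w x) \<partial>lebesgue) \<le> ennreal \<kappa>"
    using cheap_transition[OF cb(1) c(3) \<open>0 < \<epsilon>\<close> \<open>0 < \<kappa>\<close>] .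
  have "(\<lambda>x. indicator {c - \<epsilon>..c + \<epsilon>} x *\<^sub>R l x) = (\<lambda>x. indicator {a..b} x *\<^sub>R l x)"
    using l(3) cb by (auto simp: indicator_def fun_eq_iff)
  then have l_ab: "l absolutely_integrable_on {a..b}"
    using l(1) by (simp add: set_integrable_def)
  have li: "l integrable_on {s..t}" if "a \<le> s" "t \<le> b" for s t
    using that by (intro integrable_on_subinterval[OF set_lebesgue_integral_eq_integral(1)[OF l_ab]]) auto
  have zero: "integral {a..x} l = 0" if "x \<le> c - \<epsilon>" for x
    using that l(3) by (subst integral_spike[of "{c - \<epsilon>}" _ "\<lambda>_. 0"]) auto
  have one: "integral {a..x} l = 1" if "c + \<epsilon> \<le> x" "x \<le> b" for x
  proof -
    have "integral {c + \<epsilon>..x} l = 0" using that l(3) by (subst integral_spike[of "{c + \<epsilon>}" _ "\<lambda>_. 0"]) auto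
    moreover have "integral {c - \<epsilon>..c + \<epsilon>} l = integral {a..c + \<epsilon>} l - integral {a..c - \<epsilon>} l"
      "integral {c + \<epsilon>..x} l = integral {a..x} l - integral {a..c + \<epsilon>} l"
      using cb that \<open>0 < \<epsilon>\<close> by (intro integral_Icc_diff[OF li[of a b]]; simp)+
    ultimately show ?thesis using l(4) zero[of "c - \<epsilon>"] by simp
  qed
  have nn: "0 \<le> integral {a..x} l" if "x \<le> b" for x using l(2) that by (intro integral_nonneg li) auto
  have le1: "integral {a..x} l \<le> 1" if "x \<in> {a<..<b}" for x
  proof -
    have "integral {a..x} l \<le> integral {a..b} l" using l(2) that by (intro integral_subset_le li) auto
    then show ?thesis using one[of b] cb by simp
  qed
  have "l x = 0" if "\<epsilon> < \<bar>x - c\<bar>" for x using l(3) that by (auto simp: abs_if split: if_splits)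
  then show ?thesis
    using l(2,5,6) l_ab zero one nn le1 by (intro exI[of _ l] exI[of _ 0]) auto
qed

end

context finitely_degenerate_weight
begin

lemma component_order:
  assumes "C \<in> components \<I>" "D \<in> components \<I>" "C \<noteq> D"
  shows "Sup C \<le> Inf D \<or> Sup D \<le> Inf C"
proof (rule ccontr)
  assume "\<not> ?thesis"
  then have lt: "max (Inf C) (Inf D) < min (Sup C) (Sup D)"
    using component_interval(2)[OF assms(1)] component_interval(2)[OF assms(2)] by auto
  define z where "z = (max (Inf C) (Inf D) + min (Sup C) (Sup D)) / 2"
  have "max (Inf C) (Inf D) < z" "z < min (Sup C) (Sup D)" using lt by (auto simp: z_def field_simps)
  then have "z \<in> C" "z \<in> D" using mem_component_iff[OF assms(1)] mem_component_iff[OF assms(2)] by auto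
  then show False using components_nonoverlap[OF assms(1,2)] assms(3) by blast
qed

text \<open>For a component with frozen function P, frozen values A and B at its two ends, and steps
  L and M at its left and right endpoint, the summand P - A + A L - B M is 0 well to the left, P
  inside and 0 well to the right. The approximant is the sum over all components; where two
  components share an endpoint, the two steps there are superposed.\<close>

lemma recovery_sequence:
  assumes u: "u \<in> dom" and "0 < e" "0 < \<kappa>"
  obtains v where "v \<in> X" "v \<in> AC a b" "norm_p (\<lambda>x. v x - u x) \<le> ennreal e"
    "F_functional p w a b v \<le> Dom_energy p {a<..<b} w u + ennreal \<kappa>"
proof -
  define Cs where "Cs = components \<I>"
  have finCs: "finite Cs" using finite_components by (simp add: Cs_def)
  define n where "n = real (card Cs)"
  have n0: "0 \<le> n" by (simp add: n_def)
  define g where "g = weak_deriv \<I> u"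
  have wd: "has_weak_derivative \<I> u g" using u has_weak_derivative_weak_deriv by (simp add: Dom_def g_def)
  have Efin: "energy g < \<infinity>" using u by (simp add: Dom_def g_def energy_eq_Dom_energy)
  have g: "g locally_integrable_on \<I>" using wd by (simp add: has_weak_derivative_def)
  have gm: "g \<in> borel_measurable (lebesgue_on \<I>)" using g by (simp add: locally_integrable_on_def)
  obtain U N where N: "negligible N" and Uu: "\<forall>x\<in>\<I> - N. U x = u x"
    and U_all: "\<forall>x y. x \<le> y \<longrightarrow> {x..y} \<subseteq> \<I> \<longrightarrow> U y - U x = integral {x..y} g"
    using ae_primitive_representative[OF weak_derivative_imp_ae_primitive[OF wd open_I] open_I g] .
  then have U: "\<And>x y. x \<le> y \<Longrightarrow> {x..y} \<subseteq> \<I> \<Longrightarrow> U y - U x = integral {x..y} g" by blast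
  have Ucont: "continuous_on \<I> U" by (rule continuous_on_ae_primitive[OF U open_I g])
  define E where "E = enn2real (energy g)"
  have E0: "0 \<le> E" by (simp add: E_def)
  obtain H where H: "0 < H" "\<And>x. hat x \<le> H" using hat_bounded by blast
  have hatH: "hat x powr (p - 1) \<le> H powr (p - 1)" for x
    using H hat_nonneg p_gt_1 by (intro powr_mono2) auto
  have len: "Inf C < Sup C" if "C \<in> Cs" for C using component_interval(2) that by (simp add: Cs_def)
  have memC: "x \<in> C \<longleftrightarrow> Inf C < x \<and> x < Sup C" if "C \<in> Cs" for C x using mem_component_iff that by (simp add: Cs_def)

  \<comment> \<open>Choice of the freezing length\<close>
  define c2 where "c2 = 2 powr p * E"
  have c2: "0 \<le> c2" using E0 by (simp add: c2_def)
  \<comment> \<open>Freezing changes \<open>u\<close> only on two strips of width \<delta> in each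
    of the \<open>n\<close> components, where the weighted error is at most \<open>c2\<close>.
    Staying within the outer quarters ensures that clamping moves points towards the
    midpoint.\<close>
  obtain \<delta> where \<delta>: "0 < \<delta>" "\<And>C. C \<in> Cs \<Longrightarrow> \<delta> \<le> (Sup C - Inf C) / 4" "n * (2 * \<delta> * c2) \<le> e / 2"
  proof
    let ?S = "insert (e / (4 * (n * c2 + 1))) ((\<lambda>C. (Sup C - Inf C) / 4) ` Cs)"
    have fin: "finite ?S" using finCs by simp
    have pos: "0 < e / (4 * (n * c2 + 1))" using \<open>0 < e\<close> n0 c2 by (simp add: add_nonneg_pos)
    show "0 < Min ?S" using fin pos len by (subst Min_gr_iff) auto
    show "Min ?S \<le> (Sup C - Inf C) / 4" if "C \<in> Cs" for C using fin that by (intro Min_le) auto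
    have "Min ?S \<le> e / (4 * (n * c2 + 1))" using fin by (intro Min_le) auto
    then have "2 * (n * c2) * Min ?S \<le> e / 2" using n0 c2 \<open>0 < e\<close> by (intro double_mult_le_half) auto
    then show "n * (2 * Min ?S * c2) \<le> e / 2" by (simp only: mult_ac)
  qed

  define lo hi where "lo C = Inf C + \<delta>" and "hi C = Sup C - \<delta>" for C :: "real set"
  have lohi: "Inf C < lo C" "lo C < hi C" "hi C < Sup C" "lo C \<le> (3 * Inf C + Sup C) / 4" "(Inf C + 3 * Sup C) / 4 \<le> hi C"
    if "C \<in> Cs" for C using \<delta>(1) \<delta>(2)[OF that] len[OF that] by (auto simp: lo_def hi_def field_simps)
  have core: "{lo C..hi C} \<subseteq> \<I>" if C: "C \<in> Cs" for C
  proof -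
    have "lo C \<in> C" "hi C \<in> C" using lohi[OF C] by (auto simp: memC[OF C])
    then show ?thesis using Icc_subset_component[of C] C by (simp add: Cs_def)
  qed
  define cl where "cl C x = max (lo C) (min (hi C) x)" for C x
  have cl_core: "cl C x \<in> {lo C..hi C}" if "C \<in> Cs" for C x using lohi[OF that] by (auto simp: cl_def)
  define P where "P C x = U (cl C x)" for C x
  define A B where "A C = U (lo C)" and "B C = U (hi C)" for C
  \<comment> \<open>\<open>U\<close> is bounded on the compact cores but possibly not on the
    components, so this bound is available only after \<delta> is fixed.\<close>
  obtain K where K: "0 \<le> K" "\<And>C x. C \<in> Cs \<Longrightarrow> \<bar>P C x\<bar> \<le> K"
  proof -
    have "\<forall>C\<in>Cs. \<exists>k. \<forall>y\<in>{lo C..hi C}. \<bar>U y\<bar> \<le> k"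
    proof
      fix C assume "C \<in> Cs"
      then have "continuous_on {lo C..hi C} U" using core Ucont continuous_on_subset by blast
      then have "bounded (U ` {lo C..hi C})" by (intro compact_imp_bounded compact_continuous_image) auto
      then show "\<exists>k. \<forall>y\<in>{lo C..hi C}. \<bar>U y\<bar> \<le> k" by (auto simp: bounded_iff)
    qed
    then obtain k where k: "\<And>C y. C \<in> Cs \<Longrightarrow> y \<in> {lo C..hi C} \<Longrightarrow> \<bar>U y\<bar> \<le> k C" by metis
    show thesis
    proof (rule that[of "\<Sum>C\<in>Cs. \<bar>k C\<bar>"])
      show "0 \<le> (\<Sum>C\<in>Cs. \<bar>k C\<bar>)" by (simp add: sum_nonneg)
      fix C x assume C: "C \<in> Cs"
      have "\<bar>P C x\<bar> \<le> \<bar>k C\<bar>" using k[OF C cl_core[OF C, of x]] by (simp add: P_def)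
      also have "\<dots> \<le> (\<Sum>C\<in>Cs. \<bar>k C\<bar>)" using finCs C by (intro member_le_sum) auto
      finally show "\<bar>P C x\<bar> \<le> (\<Sum>C\<in>Cs. \<bar>k C\<bar>)" .
    qed
  qed
  have PA: "P C (Inf C) = A C" "P C (Sup C) = B C" if "C \<in> Cs" for C
    using lohi[OF that] by (auto simp: P_def A_def B_def cl_def)
  have AK: "\<bar>A C\<bar> \<le> K" "\<bar>B C\<bar> \<le> K" if "C \<in> Cs" for C using K(2)[OF that, of "Inf C"] K(2)[OF that, of "Sup C"] PA[OF that] by auto

  \<comment> \<open>Choice of the transition length and of the transition energy\<close>
  define K2 where "K2 = 4 * n * K + K"
  have K2: "0 \<le> K2" using n0 K(1) by (simp add: K2_def)
  \<comment> \<open>\<open>K2\<close> bounds |v - P|: four terms of size \<open>K\<close> for each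
    component in \<open>v\<close>, and one more for P. The other factors come from splitting a p-th
    power and from the bound \<open>H\<close> on the weight.\<close>
  define c1 where "c1 = 2 powr p * (K2 powr p * H powr (p - 1))"
  have c1: "0 \<le> c1" by (simp add: c1_def)
  \<comment> \<open>\<epsilon> < \<delta> keeps the transitions off the cores; the last two
    conditions keep those at endpoints inside (a,b) within [a,b].\<close>
  obtain \<epsilon> where \<epsilon>: "0 < \<epsilon>" "\<epsilon> < \<delta>" "n * (2 * \<epsilon> * c1) \<le> e / 2"
    "\<And>C. C \<in> Cs \<Longrightarrow> Inf C = a \<or> a \<le> Inf C - \<epsilon>" "\<And>C. C \<in> Cs \<Longrightarrow> Sup C = b \<or> Sup C + \<epsilon> \<le> b"
  proof
    let ?S = "{\<delta> / 2, e / (4 * (n * c1 + 1))} \<union> (\<lambda>C. if Inf C = a then 1 else Inf C - a) ` Cs \<union> (\<lambda>C. if Sup C = b then 1 else b - Sup C) ` Cs"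
    have fin: "finite ?S" using finCs by simp
    have pos: "0 < e / (4 * (n * c1 + 1))" using \<open>0 < e\<close> n0 c1 by (simp add: add_nonneg_pos)
    have bounds: "a \<le> Inf C" "Sup C \<le> b" if "C \<in> Cs" for C using component_bounds that by (auto simp: Cs_def)
    have "\<forall>y\<in>?S. 0 < y" using pos \<delta>(1) bounds by (auto simp: less_le)
    then show "0 < Min ?S" using fin by (subst Min_gr_iff) auto
    have "Min ?S \<le> \<delta> / 2" using fin by (intro Min_le) auto
    then show "Min ?S < \<delta>" using \<delta>(1) by linarith
    have "Min ?S \<le> e / (4 * (n * c1 + 1))" using fin by (intro Min_le) auto
    then have "2 * (n * c1) * Min ?S \<le> e / 2" using n0 c1 \<open>0 < e\<close> by (intro double_mult_le_half) auto
    then show "n * (2 * Min ?S * c1) \<le> e / 2" by (simp only: mult_ac)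
    show "Inf C = a \<or> a \<le> Inf C - Min ?S" if "C \<in> Cs" for C
    proof (cases "Inf C = a")
      case False
      have "(if Inf C = a then 1 else Inf C - a) \<in> ?S" using that by blast
      from Min_le[OF fin this] have "Min ?S \<le> Inf C - a" using False by (simp only: if_False)
      then show ?thesis by simp
    qed simp
    show "Sup C = b \<or> Sup C + Min ?S \<le> b" if "C \<in> Cs" for C
    proof (cases "Sup C = b")
      case False
      have "(if Sup C = b then 1 else b - Sup C) \<in> ?S" using that by blast
      from Min_le[OF fin this] have "Min ?S \<le> b - Sup C" using False by (simp only: if_False)
      then show ?thesis by simp
    qed simp
  qed

  \<comment> \<open>n^p comes from summing over the components, 2^p from the two steps of each, K^p
    from their heights. The 2 n steps of energy at most \<open>\<kappa>'\<close> then cost at most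
    \<kappa>.\<close>
  define c3 where "c3 = n powr p * (2 powr p * K powr p)"
  have c3: "0 \<le> c3" by (simp add: c3_def)
  define \<kappa>' where "\<kappa>' = \<kappa> / (2 * n * c3 + 1)"
  have \<kappa>': "0 < \<kappa>'" using \<open>0 < \<kappa>\<close> n0 c3 by (simp add: \<kappa>'_def add_nonneg_pos)
  have c3\<kappa>: "c3 * (n * (\<kappa>' + \<kappa>')) \<le> \<kappa>"
  proof -
    have "c3 * (n * (\<kappa>' + \<kappa>')) = (2 * n * c3) / (2 * n * c3 + 1) * \<kappa>" by (simp add: \<kappa>'_def field_simps)
    also have "\<dots> \<le> 1 * \<kappa>" using \<open>0 < \<kappa>\<close> n0 c3 by (intro mult_right_mono) (auto simp: divide_le_eq_1 add_nonneg_pos)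
    finally show ?thesis by simp
  qed

  \<comment> \<open>Cutoffs at the endpoints of the components\<close>
  define cutoff where "cutoff c l L0 \<longleftrightarrow> l absolutely_integrable_on {a..b} \<and> l \<in> borel_measurable lebesgue \<and> (\<forall>x. 0 \<le> l x) \<and> (\<forall>x. \<epsilon> < \<bar>x - c\<bar> \<longrightarrow> l x = 0)
    \<and> (\<integral>\<^sup>+ x. ennreal (l x powr p * w x) \<partial>lebesgue) \<le> ennreal \<kappa>'
    \<and> (\<forall>x\<in>{a<..<b}. 0 \<le> L0 + integral {a..x} l \<and> L0 + integral {a..x} l \<le> 1
        \<and> (x \<le> c - \<epsilon> \<longrightarrow> L0 + integral {a..x} l = 0) \<and> (c + \<epsilon> \<le> x \<longrightarrow> L0 + integral {a..x} l = 1))" for c l L0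
  have ends: "a \<le> Inf C" "Inf C \<le> b" "Inf C \<notin> \<I>" "a \<le> Sup C" "Sup C \<le> b" "Sup C \<notin> \<I>" if "C \<in> Cs" for C
    using component_bounds[of C] component_endpoints_notin[of C] len[OF that] that by (auto simp: Cs_def)
  have "\<forall>C\<in>Cs. \<exists>l L0. cutoff (Inf C) l L0"
  proof
    fix C assume C: "C \<in> Cs"
    \<comment> \<open>A left endpoint is never close to \<open>b\<close>, because the component to
      its right is at least 4 \<delta> long.\<close>
    have "Inf C = b \<or> Inf C + \<epsilon> \<le> b" using ends[OF C] \<epsilon>(2) \<delta>(2)[OF C] len[OF C] by (auto simp: field_simps)
    then show "\<exists>l L0. cutoff (Inf C) l L0"
      unfolding cutoff_def by (intro cheap_cutoff ends[OF C] \<epsilon>(1) \<kappa>' \<epsilon>(4)[OF C])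
  qed
  then obtain l L0 where l: "\<And>C. C \<in> Cs \<Longrightarrow> cutoff (Inf C) (l C) (L0 C)" by metis
  have "\<forall>C\<in>Cs. \<exists>l L0. cutoff (Sup C) l L0"
  proof
    fix C assume C: "C \<in> Cs"
    have "Sup C = a \<or> a \<le> Sup C - \<epsilon>" using ends[OF C] \<epsilon>(2) \<delta>(2)[OF C] len[OF C] by (auto simp: field_simps)
    then show "\<exists>l L0. cutoff (Sup C) l L0"
      unfolding cutoff_def by (intro cheap_cutoff ends[OF C] \<epsilon>(1) \<kappa>' \<epsilon>(5)[OF C])
  qed
  then obtain m M0 where m: "\<And>C. C \<in> Cs \<Longrightarrow> cutoff (Sup C) (m C) (M0 C)" by metis
  define L M where "L C x = L0 C + integral {a..x} (l C)" and "M C x = M0 C + integral {a..x} (m C)" for C x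
  have L: "0 \<le> L C x" "L C x \<le> 1" "x \<le> Inf C - \<epsilon> \<Longrightarrow> L C x = 0" "Inf C + \<epsilon> \<le> x \<Longrightarrow> L C x = 1"
    if "C \<in> Cs" "x \<in> {a<..<b}" for C x using l[OF that(1)] that(2) by (auto simp: cutoff_def L_def)
  have M: "0 \<le> M C x" "M C x \<le> 1" "x \<le> Sup C - \<epsilon> \<Longrightarrow> M C x = 0" "Sup C + \<epsilon> \<le> x \<Longrightarrow> M C x = 1"
    if "C \<in> Cs" "x \<in> {a<..<b}" for C x using m[OF that(1)] that(2) by (auto simp: cutoff_def M_def)
  have l_int: "l C absolutely_integrable_on {a..b}" and m_int: "m C absolutely_integrable_on {a..b}" if "C \<in> Cs" for C
    using l[OF that] m[OF that] by (auto simp: cutoff_def)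

  \<comment> \<open>The approximating function as an indefinite integral\<close>
  define gc where "gc C x = (if x \<in> {lo C..hi C} then g x else 0)" for C x
  have core_ab: "{lo C..hi C} \<subseteq> {a..b}" if "C \<in> Cs" for C using lohi[OF that] ends[OF that] by auto
  have gc_int: "gc C absolutely_integrable_on {a..b}" if C: "C \<in> Cs" for C
  proof -
    have "g absolutely_integrable_on {lo C..hi C}" by (rule locally_integrable_on_Icc[OF g core[OF C]])
    moreover have "(\<lambda>x. indicator {lo C..hi C} x *\<^sub>R g x) = (\<lambda>x. indicator {a..b} x *\<^sub>R gc C x)"
      using core_ab[OF C] by (auto simp: gc_def indicator_def fun_eq_iff)
    ultimately show ?thesis by (simp add: set_integrable_def)
  qed
  \<comment> \<open>The intended derivative. Defining \<open>v\<close> as its integral makes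
    absolute continuity immediate; the formula in terms of P, L and M is recovered in
    \<open>v_eq\<close>.\<close>
  define G where "G x = (\<Sum>C\<in>Cs. gc C x + A C * l C x - B C * m C x)" for x
  have G_int: "G absolutely_integrable_on {a..b}"
    unfolding G_def[abs_def]
    by (intro absolutely_integrable_sum finCs set_integral_diff(1) set_integral_add(1) set_integrable_mult_right gc_int l_int m_int)
  define v where "v x = (\<Sum>C\<in>Cs. A C * L0 C - B C * M0 C) + integral {a..x} G" for x
  have vAC: "v \<in> AC a b" by (rule AC_indefinite_integral[OF G_int]) (simp add: v_def)
  have intg: "f integrable_on {a..x}" if "f absolutely_integrable_on {a..b}" "x \<in> {a<..<b}" for f :: "real \<Rightarrow> real" and x
    using that by (intro integrable_on_subinterval[OF set_lebesgue_integral_eq_integral(1)[OF that(1)]]) auto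
  have gc_integral: "integral {a..x} (gc C) = P C x - A C" if C: "C \<in> Cs" and x: "x \<in> {a<..<b}" for C x
  proof -
    have "integral {a..x} (gc C) = integral ({a..x} \<inter> {lo C..hi C}) g"
      unfolding gc_def[abs_def] by (subst Henstock_Kurzweil_Integration.integral_restrict_Int) (simp add: Int_commute)
    also have "\<dots> = U (cl C x) - U (lo C)"
    proof (cases "x < lo C")
      case True
      then have "{a..x} \<inter> {lo C..hi C} = {}" "cl C x = lo C" using lohi[OF C] by (auto simp: cl_def)
      then show ?thesis by simp
    next
      case False
      have "{a..x} \<inter> {lo C..hi C} = {lo C..cl C x}" using False ends[OF C] lohi[OF C] by (auto simp: cl_def)
      moreover have "{lo C..cl C x} \<subseteq> \<I>" "lo C \<le> cl C x" using cl_core[OF C, of x] core[OF C] by auto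
      ultimately show ?thesis using U by simp
    qed
    finally show ?thesis by (simp add: P_def A_def)
  qed
  have v_eq: "v x = (\<Sum>C\<in>Cs. P C x - A C + A C * L C x - B C * M C x)" if x: "x \<in> {a<..<b}" for x
  proof -
    have "integral {a..x} G = (\<Sum>C\<in>Cs. integral {a..x} (\<lambda>x. gc C x + A C * l C x - B C * m C x))"
      unfolding G_def[abs_def]
      by (intro Henstock_Kurzweil_Integration.integral_sum finCs integrable_diff integrable_add integrable_on_mult_right intg[OF _ x] gc_int l_int m_int)
    also have "\<dots> = (\<Sum>C\<in>Cs. P C x - A C + A C * integral {a..x} (l C) - B C * integral {a..x} (m C))"
    proof (rule sum.cong[OF refl])
      fix C assume C: "C \<in> Cs"
      note i = intg[OF gc_int[OF C] x] intg[OF l_int[OF C] x] intg[OF m_int[OF C] x]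
      have "integral {a..x} (\<lambda>x. gc C x + A C * l C x - B C * m C x)
          = integral {a..x} (\<lambda>x. gc C x + A C * l C x) - integral {a..x} (\<lambda>x. B C * m C x)"
        by (intro Henstock_Kurzweil_Integration.integral_diff integrable_add integrable_on_mult_right i)
      also have "integral {a..x} (\<lambda>x. gc C x + A C * l C x) = integral {a..x} (gc C) + integral {a..x} (\<lambda>x. A C * l C x)"
        by (intro Henstock_Kurzweil_Integration.integral_add integrable_on_mult_right i)
      finally show "integral {a..x} (\<lambda>x. gc C x + A C * l C x - B C * m C x) = P C x - A C + A C * integral {a..x} (l C) - B C * integral {a..x} (m C)"
        using gc_integral[OF C x] by simp
    qed
    finally show ?thesis
      by (simp add: v_def L_def M_def sum.distrib[symmetric] sum_subtractf[symmetric] algebra_simps)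
  qed
  have v_bound: "\<bar>v x\<bar> \<le> 4 * n * K" if x: "x \<in> {a<..<b}" for x
  proof -
    have "\<bar>v x\<bar> \<le> (\<Sum>C\<in>Cs. 4 * K)"
      unfolding v_eq[OF x]
    proof (rule order_trans[OF sum_abs sum_mono])
      fix C assume C: "C \<in> Cs"
      have "\<bar>A C * L C x\<bar> \<le> K * 1" "\<bar>B C * M C x\<bar> \<le> K * 1"
        unfolding abs_mult using AK[OF C] L[OF C x] M[OF C x] by (intro mult_mono; simp)+
      then show "\<bar>P C x - A C + A C * L C x - B C * M C x\<bar> \<le> 4 * K" using K(2)[OF C, of x] AK[OF C] by linarith
    qed
    then show ?thesis by (simp add: n_def)
  qed
  \<comment> \<open>For every other component both steps are 0 and P equals A, or both are 1 and P
    equals B; its summand vanishes either way.\<close>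
  have v_inner: "v x = P C x" if C: "C \<in> Cs" and x: "Inf C + \<epsilon> \<le> x" "x \<le> Sup C - \<epsilon>" for C x
  proof -
    have xab: "x \<in> {a<..<b}" using x \<epsilon>(1) ends[OF C] by auto
    have "P D x - A D + A D * L D x - B D * M D x = (if D = C then P C x else 0)" if D: "D \<in> Cs" for D
    proof (cases "D = C")
      case True
      then show ?thesis using L(4)[OF C xab x(1)] M(3)[OF C xab x(2)] by simp
    next
      case False
      then consider "Sup C \<le> Inf D" | "Sup D \<le> Inf C" using component_order[of C D] C D by (auto simp: Cs_def)
      then show ?thesis
      proof cases
        case 1
        then have xD: "x \<le> Inf D - \<epsilon>" using x by linarith
        then have "L D x = 0" using L(3)[OF D xab] by simp
        moreover have "M D x = 0" using M(3)[OF D xab] xD len[OF D] by simp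
        moreover have "cl D x = lo D" using xD \<epsilon>(1) lohi[OF D] by (auto simp: cl_def)
        ultimately show ?thesis using False by (simp add: P_def A_def)
      next
        case 2
        then have xD: "Sup D + \<epsilon> \<le> x" using x by linarith
        then have "M D x = 1" using M(4)[OF D xab] by simp
        moreover have "L D x = 1" using L(4)[OF D xab] xD len[OF D] by simp
        moreover have "cl D x = hi D" using xD \<epsilon>(1) lohi[OF D] by (auto simp: cl_def)
        ultimately show ?thesis using False by (simp add: P_def B_def)
      qed
    qed
    then have "v x = (\<Sum>D\<in>Cs. if D = C then P C x else 0)" unfolding v_eq[OF xab] by (intro sum.cong) auto
    then show ?thesis using finCs C by simp
  qed

  \<comment> \<open>Membership in the space and distance to \<open>u\<close>\<close>
  have vX: "v \<in> X"
  proof (rule bounded_imp_in_X)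
    have "continuous_on {a<..<b} v" using continuous_on_subset[OF AC_imp_continuous_on[OF vAC]] by (simp add: greaterThanLessThan_subseteq_atLeastAtMost_iff)
    then show "v \<in> borel_measurable (lebesgue_on {a<..<b})" by (intro continuous_imp_measurable_on_sets_lebesgue) auto
    have "\<bar>v x\<bar> powr p * hat x powr (p - 1) \<le> (4 * n * K) powr p * H powr (p - 1)" if "x \<in> {a<..<b}" for x
      using v_bound[OF that] p_gt_1 by (intro mult_mono[OF _ hatH] powr_mono2) auto
    then show "AE x in lebesgue. x \<in> {a<..<b} \<longrightarrow> \<bar>v x\<bar> powr p * hat x powr (p - 1) \<le> (4 * n * K) powr p * H powr (p - 1)" by simp
  qed

  have notN: "AE x in lebesgue. x \<notin> N" using N by (intro AE_not_in) (simp add: negligible_iff_null_sets)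
  \<comment> \<open>Counts how many of the two end strips of width \<open>r\<close> contain
    \<open>x\<close>, so that its integral is 2 r even if they overlap.\<close>
  define near where "near r C x = indicator {Inf C..Inf C + r} x + (indicator {Sup C - r..Sup C} x :: real)" for r :: real and C :: "real set" and x :: real
  have pointwise: "\<bar>v x - u x\<bar> powr p * hat x powr (p - 1) \<le> (\<Sum>C\<in>Cs. c1 * near \<epsilon> C x + c2 * near \<delta> C x)"
    if x: "x \<in> {a<..<b}" "x \<notin> N" for x
  proof (cases "x \<in> \<I>")
    case False
    have "0 \<le> (\<Sum>C\<in>Cs. c1 * near \<epsilon> C x + c2 * near \<delta> C x)" using c1 c2 by (intro sum_nonneg) (auto simp: near_def)
    then show ?thesis using hat_outside[OF False] p_gt_1 by simp
  next
    case True
    then obtain C where C: "C \<in> Cs" "x \<in> C" using mem_I_component by (auto simp: Cs_def)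
    have xC: "Inf C < x" "x < Sup C" using C memC by auto
    have ux: "u x = U x" using Uu True x(2) by simp
    have near01: "0 \<le> near r C x" for r by (simp add: near_def)
    \<comment> \<open>Where the steps are not yet settled only boundedness is available; the
      constant may be large, but \<epsilon> was chosen after it.\<close>
    have d1: "\<bar>v x - P C x\<bar> powr p * hat x powr (p - 1) \<le> K2 powr p * H powr (p - 1) * near \<epsilon> C x"
    proof (cases "Inf C + \<epsilon> \<le> x \<and> x \<le> Sup C - \<epsilon>")
      case True
      then have "v x = P C x" using v_inner[OF C(1)] by blast
      then show ?thesis using near01[of \<epsilon>] by simp
    next
      case False
      then have near1: "1 \<le> near \<epsilon> C x" using xC by (auto simp: near_def indicator_def)
      have "\<bar>v x - P C x\<bar> \<le> K2" using v_bound[OF x(1)] K(2)[OF C(1), of x] by (simp add: K2_def)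
      then have "\<bar>v x - P C x\<bar> powr p * hat x powr (p - 1) \<le> K2 powr p * H powr (p - 1)"
        using p_gt_1 by (intro mult_mono[OF _ hatH] powr_mono2) auto
      also have "\<dots> \<le> K2 powr p * H powr (p - 1) * near \<epsilon> C x" using near1 mult_left_mono[of 1 "near \<epsilon> C x" "K2 powr p * H powr (p - 1)"] by simp
      finally show ?thesis .
    qed
    \<comment> \<open>Here the weight does its work: clamping moves \<open>x\<close> towards the
      midpoint, so the weighted increment is at most the energy, uniformly up to endpoints where
      \<open>U\<close> may blow up.\<close>
    have d2: "\<bar>P C x - U x\<bar> powr p * hat x powr (p - 1) \<le> E * near \<delta> C x"
    proof (cases "lo C \<le> x \<and> x \<le> hi C")
      case True
      then have "cl C x = x" by (simp add: cl_def)
      then show ?thesis using near01[of \<delta>] E0 by (simp add: P_def)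
    next
      case False
      then have near1: "1 \<le> near \<delta> C x" using xC by (auto simp: near_def indicator_def lo_def hi_def)
      have "\<bar>U (cl C x) - U x\<bar> powr p * hat x powr (p - 1) \<le> E"
        unfolding E_def
      proof (rule increment_times_hat_weight_le[OF _ g Efin U C(2)])
        show "C \<in> components \<I>" using C by (simp add: Cs_def)
        show "min x ((Inf C + Sup C) / 2) \<le> cl C x" "cl C x \<le> max x ((Inf C + Sup C) / 2)"
          using lohi[OF C(1)] len[OF C(1)] by (auto simp: cl_def min_def max_def)
      qed
      also have "\<dots> \<le> E * near \<delta> C x" using near1 E0 mult_left_mono[of 1 "near \<delta> C x" E] by simp
      finally show ?thesis by (simp add: P_def)
    qed
    have "\<bar>v x - u x\<bar> powr p \<le> 2 powr p * (\<bar>v x - P C x\<bar> powr p + \<bar>P C x - U x\<bar> powr p)"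
      using powr_add_le[of p "v x - P C x" "P C x - U x"] p_gt_1 by (simp add: ux)
    then have "\<bar>v x - u x\<bar> powr p * hat x powr (p - 1) \<le> 2 powr p * (\<bar>v x - P C x\<bar> powr p + \<bar>P C x - U x\<bar> powr p) * hat x powr (p - 1)"
      by (intro mult_right_mono) auto
    also have "\<dots> = 2 powr p * (\<bar>v x - P C x\<bar> powr p * hat x powr (p - 1) + \<bar>P C x - U x\<bar> powr p * hat x powr (p - 1))"
      by (simp add: algebra_simps)
    also have "\<dots> \<le> 2 powr p * (K2 powr p * H powr (p - 1) * near \<epsilon> C x + E * near \<delta> C x)"
      using d1 d2 by (intro mult_left_mono add_mono) auto
    also have "\<dots> = c1 * near \<epsilon> C x + c2 * near \<delta> C x" by (simp add: c1_def c2_def algebra_simps)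
    also have "\<dots> \<le> (\<Sum>C\<in>Cs. c1 * near \<epsilon> C x + c2 * near \<delta> C x)"
      using finCs C(1) c1 c2 by (intro member_le_sum) (auto simp: near_def)
    finally show ?thesis .
  qed
  have near_int: "(\<integral>\<^sup>+ x. ennreal (c * near r C x) \<partial>lebesgue) = ennreal (2 * r * c)" if "0 \<le> c" "0 \<le> r" for c r C
  proof -
    have "(\<integral>\<^sup>+ x. ennreal (c * near r C x) \<partial>lebesgue)
      = (\<integral>\<^sup>+ x. ennreal (c * indicator {Inf C..Inf C + r} x) + ennreal (c * indicator {Sup C - r..Sup C} x) \<partial>lebesgue)"
      using that by (intro nn_integral_cong) (simp add: near_def distrib_left ennreal_plus)
    also have "\<dots> = ennreal (c * r) + ennreal (c * r)"
      using that by (subst nn_integral_add) (auto simp: nn_integral_Icc_const)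
    finally show ?thesis using that by (simp add: ennreal_plus[symmetric] algebra_simps del: ennreal_plus)
  qed
  have near_meas: "(\<lambda>x. ennreal (c * near r C x)) \<in> borel_measurable lebesgue" for c r C
    unfolding near_def by measurable
  have norm: "norm_p (\<lambda>x. v x - u x) \<le> ennreal e"
  proof -
    have "norm_p (\<lambda>x. v x - u x) \<le> (\<integral>\<^sup>+ x. (\<Sum>C\<in>Cs. ennreal (c1 * near \<epsilon> C x) + ennreal (c2 * near \<delta> C x)) \<partial>lebesgue)"
      unfolding Lp_hat_integral_def
    proof (rule nn_integral_mono_AE, use notN in eventually_elim)
      fix x assume xN: "x \<notin> N"
      have "ennreal (\<bar>v x - u x\<bar> powr p * hat x powr (p - 1)) * indicator {a<..<b} x \<le> ennreal (\<Sum>C\<in>Cs. c1 * near \<epsilon> C x + c2 * near \<delta> C x)"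
        using pointwise[OF _ xN] by (cases "x \<in> {a<..<b}") (auto intro: ennreal_leI)
      also have "\<dots> = (\<Sum>C\<in>Cs. ennreal (c1 * near \<epsilon> C x + c2 * near \<delta> C x))"
        using c1 c2 by (intro sum_ennreal[symmetric]) (auto simp: near_def)
      also have "\<dots> = (\<Sum>C\<in>Cs. ennreal (c1 * near \<epsilon> C x) + ennreal (c2 * near \<delta> C x))"
        using c1 c2 by (intro sum.cong refl ennreal_plus) (auto simp: near_def)
      finally show "ennreal (\<bar>v x - u x\<bar> powr p * hat x powr (p - 1)) * indicator {a<..<b} x
        \<le> (\<Sum>C\<in>Cs. ennreal (c1 * near \<epsilon> C x) + ennreal (c2 * near \<delta> C x))" .
    qed
    also have "\<dots> = (\<Sum>C\<in>Cs. \<integral>\<^sup>+ x. ennreal (c1 * near \<epsilon> C x) + ennreal (c2 * near \<delta> C x) \<partial>lebesgue)"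
      by (intro nn_integral_sum borel_measurable_add near_meas)
    also have "\<dots> = (\<Sum>C\<in>Cs. ennreal (2 * \<epsilon> * c1) + ennreal (2 * \<delta> * c2))"
      using c1 c2 \<epsilon>(1) \<delta>(1) by (intro sum.cong refl) (simp add: nn_integral_add near_meas near_int)
    also have "\<dots> = ennreal (n * (2 * \<epsilon> * c1) + n * (2 * \<delta> * c2))"
      using c1 c2 \<epsilon>(1) \<delta>(1) n0
      by (simp add: n_def ennreal_plus[symmetric] ennreal_of_nat_eq_real_of_nat ennreal_mult[symmetric] distrib_left del: ennreal_plus)
    also have "\<dots> \<le> ennreal e" using \<epsilon>(3) \<delta>(3) by (intro ennreal_leI) linarith
    finally show ?thesis .
  qed

  \<comment> \<open>Energy of the approximating function\<close>
  have G_pointwise: "ennreal (\<bar>G x\<bar> powr p * w x) * indicator {a<..<b} x \<le> ennreal (\<bar>g x\<bar> powr p * w x) * indicator \<I> x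
      + (\<Sum>C\<in>Cs. ennreal c3 * (ennreal (l C x powr p * w x) + ennreal (m C x powr p * w x)))" for x
  proof (cases "0 < w x")
    case False
    \<comment> \<open>\<open>ennreal\<close> clips nonpositive densities to 0.\<close>
    then have "\<bar>G x\<bar> powr p * w x \<le> 0" by (simp add: mult_nonneg_nonpos)
    then show ?thesis by (simp add: ennreal_neg)
  next
    case wx: True
    have l0: "l C x = 0" if "C \<in> Cs" "\<epsilon> < \<bar>x - Inf C\<bar>" for C using l[OF that(1)] that(2) by (simp add: cutoff_def)
    have m0: "m C x = 0" if "C \<in> Cs" "\<epsilon> < \<bar>x - Sup C\<bar>" for C using m[OF that(1)] that(2) by (simp add: cutoff_def)
    have lm_nonneg: "0 \<le> l C x" "0 \<le> m C x" if "C \<in> Cs" for C using l[OF that] m[OF that] by (auto simp: cutoff_def)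
    show ?thesis
    proof (cases "\<exists>C\<in>Cs. x \<in> {lo C..hi C}")
      case True
      then obtain C where C: "C \<in> Cs" "x \<in> {lo C..hi C}" by blast
      have xI: "x \<in> \<I>" using core C by blast
      \<comment> \<open>On a core all cutoff densities vanish because \<epsilon> < \<delta>, so
        \<open>G\<close> equals \<open>g\<close>; off the cores only the cutoffs remain. Hence no
        mixed powers arise, and the energy of \<open>g\<close> enters with constant 1.\<close>
      have "gc D x + A D * l D x - B D * m D x = (if D = C then g x else 0)" if D: "D \<in> Cs" for D
      proof (cases "D = C")
        case True
        have "\<epsilon> < \<bar>x - Inf C\<bar>" "\<epsilon> < \<bar>x - Sup C\<bar>" using C(2) \<epsilon>(2) by (auto simp: lo_def hi_def)
        then show ?thesis using True C l0[OF C(1)] m0[OF C(1)] by (simp add: gc_def)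
      next
        case False
        then consider "Sup C \<le> Inf D" | "Sup D \<le> Inf C" using component_order[of C D] C D by (auto simp: Cs_def)
        then have "\<epsilon> < \<bar>x - Inf D\<bar> \<and> \<epsilon> < \<bar>x - Sup D\<bar> \<and> x \<notin> {lo D..hi D}"
        proof cases
          case 1 then show ?thesis using C(2) \<epsilon>(2) len[OF D] \<delta>(1) by (auto simp: lo_def hi_def)
        next
          case 2 then show ?thesis using C(2) \<epsilon>(2) len[OF D] \<delta>(1) by (auto simp: lo_def hi_def)
        qed
        then show ?thesis using False l0[OF D] m0[OF D] by (auto simp: gc_def)
      qed
      then have "G x = (\<Sum>D\<in>Cs. if D = C then g x else 0)" unfolding G_def by (intro sum.cong) auto
      then have "G x = g x" using finCs C by simp
      then have "ennreal (\<bar>G x\<bar> powr p * w x) * indicator {a<..<b} x \<le> ennreal (\<bar>g x\<bar> powr p * w x) * indicator \<I> x"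
        using xI by (auto simp: indicator_def)
      then show ?thesis by (rule order_trans) simp
    next
      case False
      then have Gx: "G x = (\<Sum>C\<in>Cs. A C * l C x + - B C * m C x)"
        unfolding G_def by (intro sum.cong) (auto simp: gc_def)
      have each: "\<bar>A C * l C x + - B C * m C x\<bar> powr p \<le> 2 powr p * K powr p * (l C x powr p + m C x powr p)" if C: "C \<in> Cs" for C
      proof -
        have "\<bar>A C * l C x\<bar> powr p \<le> (K * l C x) powr p" "\<bar>- B C * m C x\<bar> powr p \<le> (K * m C x) powr p"
          using AK[OF C] lm_nonneg[OF C] p_gt_1 by (intro powr_mono2; simp add: abs_mult mult_right_mono)+
        then have "\<bar>A C * l C x\<bar> powr p + \<bar>- B C * m C x\<bar> powr p \<le> K powr p * (l C x powr p + m C x powr p)"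
          using K(1) lm_nonneg[OF C] by (simp add: powr_mult distrib_left)
        then have le: "2 powr p * (\<bar>A C * l C x\<bar> powr p + \<bar>- B C * m C x\<bar> powr p) \<le> 2 powr p * (K powr p * (l C x powr p + m C x powr p))"
          by (intro mult_left_mono) auto
        have "\<bar>A C * l C x + - B C * m C x\<bar> powr p \<le> 2 powr p * (\<bar>A C * l C x\<bar> powr p + \<bar>- B C * m C x\<bar> powr p)"
          using p_gt_1 by (intro powr_add_le) simp
        from order_trans[OF this le] show ?thesis by (simp only: mult.assoc)
      qed
      have "\<bar>G x\<bar> powr p \<le> n powr p * (\<Sum>C\<in>Cs. \<bar>A C * l C x + - B C * m C x\<bar> powr p)"
        unfolding Gx n_def using finCs p_gt_1 by (intro abs_sum_powr_le) auto
      also have "\<dots> \<le> n powr p * (\<Sum>C\<in>Cs. 2 powr p * K powr p * (l C x powr p + m C x powr p))"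
        by (intro mult_left_mono sum_mono each) auto
      also have "\<dots> = (\<Sum>C\<in>Cs. c3 * (l C x powr p + m C x powr p))"
        by (simp add: c3_def sum_distrib_left mult.assoc)
      finally have "\<bar>G x\<bar> powr p * w x \<le> (\<Sum>C\<in>Cs. c3 * (l C x powr p + m C x powr p)) * w x"
        using wx by (intro mult_right_mono) auto
      also have "\<dots> = (\<Sum>C\<in>Cs. c3 * (l C x powr p * w x + m C x powr p * w x))"
        by (simp add: sum_distrib_right distrib_right mult.assoc)
      finally have "ennreal (\<bar>G x\<bar> powr p * w x) \<le> ennreal (\<Sum>C\<in>Cs. c3 * (l C x powr p * w x + m C x powr p * w x))"
        by (rule ennreal_leI)
      also have "\<dots> = (\<Sum>C\<in>Cs. ennreal (c3 * (l C x powr p * w x + m C x powr p * w x)))"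
        using c3 wx by (intro sum_ennreal[symmetric]) auto
      also have "\<dots> = (\<Sum>C\<in>Cs. ennreal c3 * (ennreal (l C x powr p * w x) + ennreal (m C x powr p * w x)))"
        using c3 wx by (intro sum.cong refl) (simp add: ennreal_mult ennreal_plus)
      finally have "ennreal (\<bar>G x\<bar> powr p * w x) \<le> (\<Sum>C\<in>Cs. ennreal c3 * (ennreal (l C x powr p * w x) + ennreal (m C x powr p * w x)))" .
      moreover have "ennreal (\<bar>G x\<bar> powr p * w x) * indicator {a<..<b} x \<le> ennreal (\<bar>G x\<bar> powr p * w x)"
        by (simp add: indicator_def)
      ultimately show ?thesis by (meson order_trans add_increasing zero_le)
    qed
  qed
  have F: "F_functional p w a b v \<le> energy g + ennreal \<kappa>"
  proof -
    obtain N' where N': "negligible N'" "\<forall>x\<in>{a<..<b} - N'. ((\<lambda>y. integral {a..y} G) has_real_derivative G x) (at x)"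
      using lebesgue_differentiation[OF set_lebesgue_integral_eq_integral(1)[OF G_int]] .
    have "deriv v x = G x" if "x \<in> {a<..<b} - N'" for x
    proof (rule DERIV_imp_deriv)
      show "(v has_real_derivative G x) (at x)"
        unfolding v_def[abs_def] by (auto intro!: derivative_eq_intros N'(2)[rule_format, OF that])
    qed
    moreover have "AE x in lebesgue. x \<notin> N'" using N'(1) by (intro AE_not_in) (simp add: negligible_iff_null_sets)
    ultimately have dv: "AE x in lebesgue. x \<in> {a<..<b} \<longrightarrow> deriv v x = G x" by (auto elim!: eventually_mono)
    have lm: "l C \<in> borel_measurable lebesgue" "m C \<in> borel_measurable lebesgue" if "C \<in> Cs" for C
      using l[OF that] m[OF that] by (auto simp: cutoff_def)
    have lmm: "(\<lambda>x. ennreal (l C x powr p * w x)) \<in> borel_measurable lebesgue" "(\<lambda>x. ennreal (m C x powr p * w x)) \<in> borel_measurable lebesgue" if "C \<in> Cs" for C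
      using lm[OF that] by measurable
    have lmm3: "(\<lambda>x. ennreal c3 * (ennreal (l C x powr p * w x) + ennreal (m C x powr p * w x))) \<in> borel_measurable lebesgue" if "C \<in> Cs" for C
      using lm[OF that] by measurable
    have "F_functional p w a b v = (\<integral>\<^sup>+ x \<in> {a<..<b}. ennreal (\<bar>G x\<bar> powr p * w x) \<partial>lebesgue)"
      unfolding F_functional_AC[OF vAC] by (rule nn_integral_cong_AE, use dv in eventually_elim) (auto simp: indicator_def)
    also have "\<dots> \<le> (\<integral>\<^sup>+ x. ennreal (\<bar>g x\<bar> powr p * w x) * indicator \<I> x
      + (\<Sum>C\<in>Cs. ennreal c3 * (ennreal (l C x powr p * w x) + ennreal (m C x powr p * w x))) \<partial>lebesgue)"
      by (rule nn_integral_mono) (rule G_pointwise)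
    also have "\<dots> = energy g + (\<integral>\<^sup>+ x. (\<Sum>C\<in>Cs. ennreal c3 * (ennreal (l C x powr p * w x) + ennreal (m C x powr p * w x))) \<partial>lebesgue)"
      unfolding energy_def
      by (intro nn_integral_add energy_density_measurable[OF gm] borel_measurable_sum lmm3) auto
    also have "(\<integral>\<^sup>+ x. (\<Sum>C\<in>Cs. ennreal c3 * (ennreal (l C x powr p * w x) + ennreal (m C x powr p * w x))) \<partial>lebesgue)
      = (\<Sum>C\<in>Cs. \<integral>\<^sup>+ x. ennreal c3 * (ennreal (l C x powr p * w x) + ennreal (m C x powr p * w x)) \<partial>lebesgue)"
      by (intro nn_integral_sum lmm3)
    also have "\<dots> \<le> (\<Sum>C\<in>Cs. ennreal c3 * (ennreal \<kappa>' + ennreal \<kappa>'))"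
    proof (rule sum_mono)
      fix C assume C: "C \<in> Cs"
      have "(\<integral>\<^sup>+ x. ennreal c3 * (ennreal (l C x powr p * w x) + ennreal (m C x powr p * w x)) \<partial>lebesgue)
        = ennreal c3 * ((\<integral>\<^sup>+ x. ennreal (l C x powr p * w x) \<partial>lebesgue) + (\<integral>\<^sup>+ x. ennreal (m C x powr p * w x) \<partial>lebesgue))"
        by (simp only: nn_integral_cmult[OF borel_measurable_add[OF lmm[OF C]]] nn_integral_add[OF lmm[OF C]])
      also have "\<dots> \<le> ennreal c3 * (ennreal \<kappa>' + ennreal \<kappa>')"
        using l[OF C] m[OF C] by (intro mult_left_mono add_mono) (auto simp: cutoff_def)
      finally show "(\<integral>\<^sup>+ x. ennreal c3 * (ennreal (l C x powr p * w x) + ennreal (m C x powr p * w x)) \<partial>lebesgue)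
        \<le> ennreal c3 * (ennreal \<kappa>' + ennreal \<kappa>')" .
    qed
    also have "\<dots> = ennreal (n * (c3 * (\<kappa>' + \<kappa>')))"
      using c3 \<kappa>' by (simp add: n_def ennreal_plus[symmetric] ennreal_of_nat_eq_real_of_nat ennreal_mult[symmetric] del: ennreal_plus)
    also have "\<dots> \<le> ennreal \<kappa>" using c3\<kappa> by (intro ennreal_leI) (simp add: mult.left_commute)
    finally show ?thesis by (simp add: add_left_mono)
  qed
  show thesis
    using vX vAC norm F by (intro that[of v]) (simp_all add: energy_eq_Dom_energy g_def)
qed

text \<open>For \<open>c\<close> strictly between the two values the superlevel set of the envelope
  is open and contains a ball around \<open>u\<close>. A recovery function in that ball with
  functional at most \<open>c\<close> contradicts that the envelope is a minorant.\<close>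

lemma F_relaxed_le_relaxed:
  assumes u: "u \<in> X"
  shows "F_relaxed p w a b u \<le> relaxed u"
proof (rule ccontr)
  assume "\<not> ?thesis"
  then have lt: "relaxed u < F_relaxed p w a b u" by (simp add: not_le)
  then have udom: "u \<in> dom" by (auto simp: relaxed_def split: if_splits)
  obtain c where c: "relaxed u < c" "c < F_relaxed p w a b u" using dense[OF lt] by blast
  let ?T = "Lp_hat_topology p {a<..<b} w"
  have "openin ?T {v \<in> topspace ?T. c < F_relaxed p w a b v}"
    using lsc_envelope_largest(1)[of ?T "F_functional p w a b"] by (simp add: lsc_map_def F_relaxed_def)
  then obtain e where e: "0 < e" "\<And>v. v \<in> X \<Longrightarrow> Lp_hat_seminorm p {a<..<b} w (\<lambda>x. v x - u x) < e \<Longrightarrow> c < F_relaxed p w a b v"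
    using u c(2) unfolding openin_Lp_hat_topology topspace_Lp_hat_topology by blast
  have "c < \<infinity>" using c(2) by (metis infinity_ennreal_def less_top top.extremum_strict)
  then obtain s where s: "c = ennreal s" "0 \<le> s" by (cases c) auto
  have "relaxed u < \<infinity>" using c(1) \<open>c < \<infinity>\<close> by (rule order.strict_trans)
  then obtain r where r: "relaxed u = ennreal r" "0 \<le> r" by (cases "relaxed u") auto
  have rs: "r < s" using c(1) r s by (simp add: ennreal_less_iff)
  have pos: "0 < (e / 2) powr p" "0 < s - r" using e(1) rs by auto
  \<comment> \<open>Half the radius turns the non-strict distance bound into a strict one; s - r is
    exactly the gap between \<open>c\<close> and the energy of \<open>u\<close>.\<close>
  obtain v where v: "v \<in> X" "v \<in> AC a b" "norm_p (\<lambda>x. v x - u x) \<le> ennreal ((e / 2) powr p)"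
    "F_functional p w a b v \<le> Dom_energy p {a<..<b} w u + ennreal (s - r)"
    using recovery_sequence[OF udom pos] .
  have "enn2real (norm_p (\<lambda>x. v x - u x)) \<le> (e / 2) powr p" using v(3) by (simp add: enn2real_leI)
  then have "enn2real (norm_p (\<lambda>x. v x - u x)) powr (1 / p) \<le> ((e / 2) powr p) powr (1 / p)"
    using p_gt_1 by (intro powr_mono2) auto
  also have "\<dots> = e / 2" using p_gt_1 e(1) by (simp add: powr_powr)
  finally have "Lp_hat_seminorm p {a<..<b} w (\<lambda>x. v x - u x) < e" using e(1) by (simp add: Lp_hat_seminorm_def)
  then have "c < F_relaxed p w a b v" using e(2) v(1) by blast
  also have "\<dots> \<le> F_functional p w a b v"
    unfolding F_relaxed_def by (rule lsc_envelope_largest(2)) (use v(1) in simp)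
  also have "\<dots> \<le> relaxed u + ennreal (s - r)" using v(4) udom by (simp add: relaxed_def)
  also have "\<dots> = c" using r s rs by (simp add: ennreal_plus[symmetric] del: ennreal_plus)
  finally show False by simp
qed

theorem F_relaxed_eq_relaxed:
  assumes u: "u \<in> X"
  shows "F_relaxed p w a b u = relaxed u"
proof (rule antisym)
  show "F_relaxed p w a b u \<le> relaxed u" by (rule F_relaxed_le_relaxed[OF u])
  show "relaxed u \<le> F_relaxed p w a b u"
    unfolding F_relaxed_def by (rule lsc_envelope_largest(3)[OF relaxed_lsc]) (simp add: relaxed_le_F)
qed

end

theorem theorem3p1:
  fixes p a b :: real and w :: "real \<Rightarrow> real"
  assumes "1 < p" and "a < b"
    and "AE x in lebesgue. 0 \<le> w x"
    and "w locally_integrable_on UNIV"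
    and "finitely_degenerate p {a<..<b} w"
  shows "{u \<in> Lp_hat p {a<..<b} w. F_relaxed p w a b u < \<infinity>} = Dom p {a<..<b} w \<and>
    (\<forall>u \<in> Lp_hat p {a<..<b} w. F_relaxed p w a b u =
      (if u \<in> Dom p {a<..<b} w then Dom_energy p {a<..<b} w u else \<infinity>))"
proof -
  interpret finitely_degenerate_weight p a b w by unfold_locales (fact assms)+
  have eq: "F_relaxed p w a b u = (if u \<in> dom then Dom_energy p {a<..<b} w u else \<infinity>)" if "u \<in> X" for u
    using F_relaxed_eq_relaxed[OF that] by (simp add: relaxed_def)
  have "{u \<in> X. F_relaxed p w a b u < \<infinity>} = dom"
  proof (intro set_eqI iffI)
    fix u assume "u \<in> {u \<in> X. F_relaxed p w a b u < \<infinity>}"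
    then show "u \<in> dom" using eq[of u] by (auto split: if_splits)
  next
    fix u assume u: "u \<in> dom"
    \<comment> \<open>The left side ranges over \<open>X\<close> only, so this inclusion rests on
      \<open>dom_subset_X\<close>.\<close>
    then have "u \<in> X" using dom_subset_X by blast
    then show "u \<in> {u \<in> X. F_relaxed p w a b u < \<infinity>}" using u eq[of u] by (simp add: Dom_def)
  qed
  then show ?thesis using eq by blast
qed

end
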